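(* Let $\mathcal{U}_n=\mathbb{C}^n\times(\mathbb{C}^* )^{n-1}$, with points $(a,c)$, $a=(a_1,\dots,a_n)$, $c=(c_1,\dots,c_{n-1})$. For $n\ge 4$, the reduced reducible locus $$R_n^P=\{(a,c)\in\mathcal{U}_n: P_n(t,\lambda)\text{ is reducible in }\mathbb{C}[t,\lambda]\}$$ has codimension at least $2$ in $\mathcal{U}_n$. Moreover, the original reducible locus $$R_n^\chi=\{(a,c)\in\mathcal{U}_n:\chi_n(w,\lambda)\text{ is reducible in }\mathbb{C}[w,\lambda]\}$$ also has codimension at least $2$ in $\mathcal{U}_n$.
   Context: For $a=(a_1,\dots,a_n)\in\mathbb{C}^n$ and $c=(c_1,\dots,c_{n-1})\in\mathbb{C}^{n-1}$, the reduced continuant $P_n(t,\lambda)\in\mathbb{C}[t,\lambda]$ is defined by $P_0=1$, $P_1=\lambda+a_1$, $P_k=(\lambda+a_k)P_{k-1}-t\,c_{k-1}P_{k-2}$ for $2\le k\le n$, and the spectral polynomial is $\chi_n(w,\lambda)=P_n(w^2,\lambda)$. Writing $c_i=b_i^2$, $\chi_n(w,\lambda)=\det(J_n(w)+\lambda I)$, where $J_n(w)$ is the symmetric tridiagonal $n\times n$ matrix with diagonal entries $a_1,\dots,a_n$ and off-diagonal entries $wb_1,\dots,wb_{n-1}$. *)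

theory Defs
  imports "HOL-Analysis.Analysis" "HOL-Computational_Algebra.Computational_Algebra"
begin

text \<open>The ring \<open>\<complex>[t,\<lambda>]\<close> (and likewise \<open>\<complex>[w,\<lambda>]\<close>) is the type \<^typ>\<open>complex poly poly\<close>,
  read as \<open>\<complex>[t][\<lambda>]\<close>: the outer variable is \<open>\<lambda>\<close>, the inner one is \<open>t\<close>.
  Thus \<open>[:[:z:], 1:]\<close> is \<open>\<lambda> + z\<close> and \<open>[:[:0, z:]:]\<close> is \<open>z t\<close>.
  The sequences \<open>a\<close> and \<open>c\<close> are indexed from 1.\<close>

fun reduced_continuant ::
  "(nat \<Rightarrow> complex) \<Rightarrow> (nat \<Rightarrow> complex) \<Rightarrow> nat \<Rightarrow> complex poly poly" where
  "reduced_continuant a c 0 = 1"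
| "reduced_continuant a c (Suc 0) = [:[:a 1:], 1:]"
| "reduced_continuant a c (Suc (Suc k)) =
     [:[:a (Suc (Suc k)):], 1:] * reduced_continuant a c (Suc k)
     - [:[:0, c (Suc k):]:] * reduced_continuant a c k"

text \<open>\<open>\<chi>\<^sub>n(w,\<lambda>) = P\<^sub>n(w\<^sup>2,\<lambda>)\<close>: each coefficient \<open>q(t)\<close> of a power of \<open>\<lambda>\<close> becomes \<open>q(w\<^sup>2)\<close>.\<close>

definition spectral_poly ::
  "(nat \<Rightarrow> complex) \<Rightarrow> (nat \<Rightarrow> complex) \<Rightarrow> nat \<Rightarrow> complex poly poly" where
  "spectral_poly a c n = map_poly (\<lambda>q. pcompose q [:0, 0, 1:]) (reduced_continuant a c n)"

type_synonym point = "(nat \<Rightarrow> complex) \<times> (nat \<Rightarrow> complex)"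

definition ambient_space :: "nat \<Rightarrow> point set" where
  "ambient_space n = ({1..n} \<rightarrow>\<^sub>E UNIV) \<times> ({1..n-1} \<rightarrow>\<^sub>E UNIV)"

definition param_space :: "nat \<Rightarrow> point set" where
  "param_space n = ({1..n} \<rightarrow>\<^sub>E UNIV) \<times> ({1..n-1} \<rightarrow>\<^sub>E (UNIV - {0}))"

inductive_set polynomial_functions :: "nat \<Rightarrow> (point \<Rightarrow> complex) set" for n where
  const: "(\<lambda>_. z) \<in> polynomial_functions n"
| coord_a: "i \<in> {1..n} \<Longrightarrow> (\<lambda>x. fst x i) \<in> polynomial_functions n"
| coord_c: "i \<in> {1..n-1} \<Longrightarrow> (\<lambda>x. snd x i) \<in> polynomial_functions n"
| add: "f \<in> polynomial_functions n \<Longrightarrow> g \<in> polynomial_functions n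
    \<Longrightarrow> (\<lambda>x. f x + g x) \<in> polynomial_functions n"
| mult: "f \<in> polynomial_functions n \<Longrightarrow> g \<in> polynomial_functions n
    \<Longrightarrow> (\<lambda>x. f x * g x) \<in> polynomial_functions n"

text \<open>The Zariski topology on \<open>\<complex>\<^sup>n \<times> \<complex>\<^sup>n\<^sup>-\<^sup>1\<close>, generated by the principal open sets, and the
  one induced on \<open>\<U>\<^sub>n\<close>.\<close>

definition zariski_ambient :: "nat \<Rightarrow> point topology" where
  "zariski_ambient n =
     topology_generated_by {{x \<in> ambient_space n. f x \<noteq> 0} | f. f \<in> polynomial_functions n}"

definition zariski_param :: "nat \<Rightarrow> point topology" where
  "zariski_param n = subtopology (zariski_ambient n) (param_space n)"

definition irreducible_closedin :: "'a topology \<Rightarrow> 'a set \<Rightarrow> bool" where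
  "irreducible_closedin X Z \<longleftrightarrow> closedin X Z \<and> Z \<noteq> {} \<and>
     (\<forall>A B. closedin X A \<longrightarrow> closedin X B \<longrightarrow> Z = A \<union> B \<longrightarrow> Z = A \<or> Z = B)"

text \<open>Codimension as in general topology: for an irreducible closed \<open>Z\<close> it is the supremum of the
  lengths \<open>k\<close> of chains \<open>Z = Z\<^sub>0 \<subset> Z\<^sub>1 \<subset> \<dots> \<subset> Z\<^sub>k\<close> of irreducible closed sets; for a closed set it
  is the infimum over the irreducible closed sets it contains (so \<open>\<infinity>\<close> for the empty set); for an
  arbitrary set it is the codimension of its closure.\<close>

definition irreducible_codim :: "'a topology \<Rightarrow> 'a set \<Rightarrow> enat" where
  "irreducible_codim X Z = Sup {enat k | k. \<exists>C :: nat \<Rightarrow> 'a set. C 0 = Z \<and>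
     (\<forall>i\<le>k. irreducible_closedin X (C i)) \<and> (\<forall>i<k. C i \<subset> C (Suc i))}"

definition codimension :: "'a topology \<Rightarrow> 'a set \<Rightarrow> enat" where
  "codimension X S =
     Inf (irreducible_codim X ` {Z. irreducible_closedin X Z \<and> Z \<subseteq> X closure_of S})"

text \<open>\<open>P\<^sub>n\<close> and \<open>\<chi>\<^sub>n\<close> are monic of degree \<open>n\<close> in \<open>\<lambda>\<close>, so for \<open>n \<ge> 1\<close> they are neither zero nor
  units, and not being \<^const>\<open>irreducible\<close> means being a product of two non-units.\<close>

definition reduced_reducible_locus :: "nat \<Rightarrow> point set" where
  "reduced_reducible_locus n =
     {(a, c) \<in> param_space n. \<not> irreducible (reduced_continuant a c n)}"

definition original_reducible_locus :: "nat \<Rightarrow> point set" where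
  "original_reducible_locus n =
     {(a, c) \<in> param_space n. \<not> irreducible (spectral_poly a c n)}"

end

theory Submission
  imports Defs
begin

text \<open>
  Since \<open>\<chi>\<^sub>n(w,\<lambda>) = P\<^sub>n(w\<^sup>2,\<lambda>)\<close>, every factorization of \<open>P\<^sub>n\<close> gives one of \<open>\<chi>\<^sub>n\<close>, so it is enough to treat
  \<open>\<chi>\<^sub>n\<close>.

  \<^bold>\<open>The rigidity of factors.\<close> Let \<open>\<chi>\<^sub>n = A B\<close> with monic factors. As \<open>\<chi>\<^sub>n\<close> has total degree \<open>n\<close> and is
  monic of degree \<open>n\<close> in \<open>\<lambda>\<close>, the total degree of \<open>A\<close> is its degree in \<open>\<lambda>\<close>; hence the sum of the roots
  of \<open>A\<close> is a polynomial of degree at most one in \<open>w\<close> (\<open>subleading_coeff_bound\<close>). At \<open>w = 0\<close> the roots of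
  \<open>\<chi>\<^sub>n\<close> are the \<open>- a\<^sub>k\<close>, and \<open>A\<close> takes up those with \<open>k\<close> in some proper nonempty set \<open>S\<close>. So along
  the branches that start at the nodes of \<open>S\<close>, the coefficients of \<open>w\<^sup>2\<close> and of \<open>w\<^sup>4\<close> sum to zero.

  \<^bold>\<open>Two conditions at a generic point.\<close> Put \<open>z\<^sub>k = c\<^sub>k / (a\<^sub>k\<^sub>+\<^sub>1 - a\<^sub>k)\<close> and \<open>z\<^sub>0 = z\<^sub>n = 0\<close>. At a node whose
  diagonal entry is simple, the branch is \<open>- a\<^sub>k + (z\<^sub>k - z\<^sub>k\<^sub>-\<^sub>1) w\<^sup>2 + \<dots>\<close>. If all \<open>a\<^sub>k\<close> are distinct,
  the \<open>w\<^sup>2\<close> condition is linear in \<open>z\<close> and cuts out an irreducible hypersurface, parametrized by \<open>a\<close> and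
  a linear space of \<open>z\<close>; the \<open>w\<^sup>4\<close> condition is quadratic in \<open>z\<close>, and for \<open>n \<ge> 4\<close> it does not hold
  identically on that hypersurface (\<open>balanced_slopes_with_nonzero_second_sum\<close>). For \<open>n = 3\<close> and \<open>S = {2}\<close> it
  does, and there the reducible locus contains a hypersurface.

  \<^bold>\<open>The hyperplanes\<close> \<open>a\<^sub>i = a\<^sub>j\<close>. Here one further condition is enough. A further coincidence among the \<open>a\<^sub>k\<close>
  is one. If \<open>i\<close> and \<open>j\<close> are on the same side of the factorization, the \<open>w\<^sup>2\<close> condition for the other
  factor is one. If they are separated, all roots of \<open>A\<close> but one are known to order \<open>w\<^sup>6\<close>, and
  the known sum of the roots determines the last one; substituting it into \<open>\<chi>\<^sub>n\<close> gives the condition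
  (\<open>split_double_branch\<close>).

  \<^bold>\<open>From conditions to codimension.\<close> Thus the locus is covered by finitely many closed sets, each a proper
  subset of an irreducible closed set that is itself proper in \<open>\<U>\<^sub>n\<close>. An irreducible closed subset of
  the closure of the locus lies in one of them, and so begins a chain of length two. Irreducibility is
  obtained from polynomial curves: a set in which any two points are joined by such a curve, with
  finitely many parameters omitted, has irreducible closure.
\<close>

section \<open>Codimension at least two in the parameter space\<close>

lemma polynomial_functions_diff:
  assumes "f \<in> polynomial_functions n" "g \<in> polynomial_functions n"
  shows "(\<lambda>x. f x - g x) \<in> polynomial_functions n"
proof -
  have "(\<lambda>x. f x + (-1) * g x) \<in> polynomial_functions n"
    by (rule polynomial_functions.add[OF assms(1)
          polynomial_functions.mult[OF polynomial_functions.const assms(2)]])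
  then show ?thesis by simp
qed

lemma polynomial_functions_prod:
  assumes "\<And>i. i \<in> I \<Longrightarrow> f i \<in> polynomial_functions n"
  shows "(\<lambda>x. \<Prod>i\<in>I. f i x) \<in> polynomial_functions n"
  using assms
  by (induction I rule: infinite_finite_induct)
    (auto intro: polynomial_functions.const polynomial_functions.mult)

lemma polynomial_functions_power:
  assumes "f \<in> polynomial_functions n"
  shows "(\<lambda>x. f x ^ k) \<in> polynomial_functions n"
  using assms by (induction k) (auto intro: polynomial_functions.const polynomial_functions.mult)

lemma topspace_zariski_param: "topspace (zariski_param n) = param_space n"
proof -
  have "param_space n \<subseteq> ambient_space n"
    by (auto simp: param_space_def ambient_space_def PiE_def Pi_def)
  moreover have "ambient_space n \<subseteq> topspace (zariski_ambient n)"
  proof -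
    have "openin (zariski_ambient n) {x \<in> ambient_space n. (\<lambda>_. 1) x \<noteq> (0::complex)}"
      unfolding zariski_ambient_def
      by (rule topology_generated_by_Basis, rule CollectI, rule exI[of _ "\<lambda>_. 1"])
        (simp add: polynomial_functions.const)
    then show ?thesis using openin_subset by fastforce
  qed
  ultimately show ?thesis
    unfolding zariski_param_def topspace_subtopology by blast
qed

lemma closedin_zero_set:
  assumes "f \<in> polynomial_functions n"
  shows "closedin (zariski_param n) {x \<in> param_space n. f x = 0}"
proof -
  have "openin (zariski_ambient n) {x \<in> ambient_space n. f x \<noteq> 0}"
    unfolding zariski_ambient_def using assms by (intro topology_generated_by_Basis) auto
  then have "openin (zariski_param n) ({x \<in> ambient_space n. f x \<noteq> 0} \<inter> param_space n)"
    unfolding zariski_param_def openin_subtopology by blast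
  moreover have "{x \<in> ambient_space n. f x \<noteq> 0} \<inter> param_space n
      = topspace (zariski_param n) - {x \<in> param_space n. f x = 0}"
    unfolding topspace_zariski_param
    by (auto simp: param_space_def ambient_space_def PiE_def Pi_def)
  ultimately show ?thesis
    unfolding closedin_def topspace_zariski_param by auto
qed

text \<open>The principal open sets form a basis and not only a subbasis, because the product of two
  polynomial functions is a polynomial function.\<close>

lemma principal_neighbourhood:
  assumes "openin (zariski_param n) O'" "y \<in> O'"
  shows "\<exists>f \<in> polynomial_functions n. f y \<noteq> 0 \<and> (\<forall>x \<in> param_space n. f x \<noteq> 0 \<longrightarrow> x \<in> O')"
proof -
  obtain T where T: "openin (zariski_ambient n) T" "O' = T \<inter> param_space n"
    using assms(1) unfolding zariski_param_def openin_subtopology by blast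
  have "generate_topology_on {{x \<in> ambient_space n. f x \<noteq> 0} | f. f \<in> polynomial_functions n} T"
    using T(1) unfolding zariski_ambient_def by (rule openin_topology_generated_by)
  then have "\<forall>y\<in>T. \<exists>f \<in> polynomial_functions n. f y \<noteq> 0 \<and>
      (\<forall>x \<in> ambient_space n. f x \<noteq> 0 \<longrightarrow> x \<in> T)"
  proof (induction rule: generate_topology_on.induct)
    case Empty
    then show ?case by simp
  next
    case (Int A B)
    show ?case
    proof
      fix y assume y: "y \<in> A \<inter> B"
      obtain f where f: "f \<in> polynomial_functions n" "f y \<noteq> 0"
        "\<forall>x \<in> ambient_space n. f x \<noteq> 0 \<longrightarrow> x \<in> A"
        using Int.IH(1) y by (meson IntD1)
      obtain g where g: "g \<in> polynomial_functions n" "g y \<noteq> 0"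
        "\<forall>x \<in> ambient_space n. g x \<noteq> 0 \<longrightarrow> x \<in> B"
        using Int.IH(2) y by (meson IntD2)
      show "\<exists>f \<in> polynomial_functions n. f y \<noteq> 0 \<and>
          (\<forall>x \<in> ambient_space n. f x \<noteq> 0 \<longrightarrow> x \<in> A \<inter> B)"
      proof (rule bexI)
        show "(\<lambda>x. f x * g x) \<in> polynomial_functions n"
          by (rule polynomial_functions.mult[OF f(1) g(1)])
        show "f y * g y \<noteq> 0 \<and> (\<forall>x \<in> ambient_space n. f x * g x \<noteq> 0 \<longrightarrow> x \<in> A \<inter> B)"
          using f g by simp
      qed
    qed
  next
    case (UN K)
    show ?case
    proof
      fix y assume "y \<in> \<Union>K"
      then obtain k where k: "k \<in> K" "y \<in> k" by blast
      obtain f where "f \<in> polynomial_functions n" "f y \<noteq> 0"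
        "\<forall>x \<in> ambient_space n. f x \<noteq> 0 \<longrightarrow> x \<in> k"
        using UN.IH[OF k(1)] k(2) by meson
      then show "\<exists>f \<in> polynomial_functions n. f y \<noteq> 0 \<and>
          (\<forall>x \<in> ambient_space n. f x \<noteq> 0 \<longrightarrow> x \<in> \<Union>K)"
        using k(1) by (intro bexI[of _ f]) auto
    qed
  next
    case (Basis s)
    then show ?case by auto
  qed
  then obtain f where f: "f \<in> polynomial_functions n" "f y \<noteq> 0"
    "\<forall>x \<in> ambient_space n. f x \<noteq> 0 \<longrightarrow> x \<in> T"
    using T(2) assms(2) by (meson IntD1)
  have sub: "param_space n \<subseteq> ambient_space n"
    by (auto simp: param_space_def ambient_space_def PiE_def Pi_def)
  have "\<forall>x \<in> param_space n. f x \<noteq> 0 \<longrightarrow> x \<in> O'"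
    using f(3) subsetD[OF sub] unfolding T(2) by simp
  with f(1,2) show ?thesis by (intro bexI[of _ f]) simp_all
qed

definition curve_point ::
  "nat \<Rightarrow> (nat \<Rightarrow> complex poly) \<Rightarrow> (nat \<Rightarrow> complex poly) \<Rightarrow> complex \<Rightarrow> point" where
  "curve_point n p q s = (\<lambda>i\<in>{1..n}. poly (p i) s, \<lambda>i\<in>{1..n-1}. poly (q i) s)"

lemma polynomial_function_on_curve:
  assumes "f \<in> polynomial_functions n"
  shows "\<exists>r. \<forall>s. f (curve_point n p q s) = poly r s"
  using assms
proof induction
  case (const z)
  show ?case by (rule exI[of _ "[:z:]"]) simp
next
  case (coord_a i)
  then show ?case by (intro exI[of _ "p i"]) (simp add: curve_point_def)
next
  case (coord_c i)
  then show ?case by (intro exI[of _ "q i"]) (simp add: curve_point_def)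
next
  case (add f g)
  then obtain r r' where "\<forall>s. f (curve_point n p q s) = poly r s"
    "\<forall>s. g (curve_point n p q s) = poly r' s" by blast
  then show ?case by (intro exI[of _ "r + r'"]) simp
next
  case (mult f g)
  then obtain r r' where "\<forall>s. f (curve_point n p q s) = poly r s"
    "\<forall>s. g (curve_point n p q s) = poly r' s" by blast
  then show ?case by (intro exI[of _ "r * r'"]) simp
qed

text \<open>Finitely many parameters may lead out of \<open>Y\<close>: the loci below are given by equations together with
  inequations such as \<open>c\<^sub>k \<noteq> 0\<close>, which fail at finitely many points of a curve.\<close>

definition curve_connected :: "nat \<Rightarrow> point set \<Rightarrow> bool" where
  "curve_connected n Y \<longleftrightarrow> Y \<noteq> {} \<and> Y \<subseteq> param_space n \<and>
     (\<forall>y\<in>Y. \<forall>y'\<in>Y. \<exists>p q. curve_point n p q 0 = y \<and> curve_point n p q 1 = y' \<and>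
        finite {s. curve_point n p q s \<notin> Y})"

lemma cofinite_nonzero:
  fixes r r' :: "complex poly"
  assumes "r \<noteq> 0" "r' \<noteq> 0" "finite B"
  shows "\<exists>s. s \<notin> B \<and> poly r s \<noteq> 0 \<and> poly r' s \<noteq> 0"
proof -
  have "finite (B \<union> {s. poly r s = 0} \<union> {s. poly r' s = 0})"
    using assms poly_roots_finite by blast
  then have "\<exists>s. s \<notin> B \<union> {s. poly r s = 0} \<union> {s. poly r' s = 0}"
    by (rule ex_new_if_finite[OF infinite_UNIV_char_0])
  then show ?thesis by blast
qed

text \<open>Two polynomial functions that do not vanish at two given points of \<open>Y\<close> restrict to nonzero
  polynomials on a curve joining these points, so they have a common nonzero on that curve inside \<open>Y\<close>.
  Hence any two nonempty relatively open subsets of \<open>Y\<close> meet.\<close>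

lemma irreducible_closure_of_curve_connected:
  assumes "curve_connected n Y"
  shows "irreducible_closedin (zariski_param n) (zariski_param n closure_of Y)"
  unfolding irreducible_closedin_def
proof (intro conjI allI impI)
  have YU: "Y \<subseteq> param_space n" "Y \<noteq> {}"
    using assms unfolding curve_connected_def by auto
  have Ycl: "Y \<subseteq> zariski_param n closure_of Y"
    using YU(1) by (intro closure_of_subset) (simp add: topspace_zariski_param)
  show "closedin (zariski_param n) (zariski_param n closure_of Y)" by simp
  show "zariski_param n closure_of Y \<noteq> {}" using Ycl YU by auto
  fix A B
  assume A: "closedin (zariski_param n) A" and B: "closedin (zariski_param n) B"
    and un: "zariski_param n closure_of Y = A \<union> B"
  show "zariski_param n closure_of Y = A \<or> zariski_param n closure_of Y = B"
  proof (rule ccontr)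
    assume neg: "\<not> ?thesis"
    have "\<not> Y \<subseteq> A" using closure_of_minimal[OF _ A] un neg by blast
    moreover have "\<not> Y \<subseteq> B" using closure_of_minimal[OF _ B] un neg by blast
    ultimately obtain y z where y: "y \<in> Y" "y \<notin> A" and z: "z \<in> Y" "z \<notin> B" by blast
    have "openin (zariski_param n) (param_space n - A)" "openin (zariski_param n) (param_space n - B)"
      using A B unfolding closedin_def topspace_zariski_param by auto
    then obtain f g where f: "f \<in> polynomial_functions n" "f y \<noteq> 0"
        "\<forall>x \<in> param_space n. f x \<noteq> 0 \<longrightarrow> x \<in> param_space n - A"
      and g: "g \<in> polynomial_functions n" "g z \<noteq> 0"
        "\<forall>x \<in> param_space n. g x \<noteq> 0 \<longrightarrow> x \<in> param_space n - B"
      using principal_neighbourhood[of n "param_space n - A" y]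
        principal_neighbourhood[of n "param_space n - B" z] y z YU by blast
    obtain p q where pq: "curve_point n p q 0 = y" "curve_point n p q 1 = z"
      "finite {s. curve_point n p q s \<notin> Y}"
      using assms y z unfolding curve_connected_def by blast
    obtain r where r: "\<forall>s. f (curve_point n p q s) = poly r s"
      using polynomial_function_on_curve[OF f(1)] by blast
    obtain r' where r': "\<forall>s. g (curve_point n p q s) = poly r' s"
      using polynomial_function_on_curve[OF g(1)] by blast
    have "r \<noteq> 0" "r' \<noteq> 0" using r r' f(2) g(2) pq by (metis poly_0)+
    from cofinite_nonzero[OF this pq(3)] obtain s where
      s: "curve_point n p q s \<in> Y" "poly r s \<noteq> 0" "poly r' s \<noteq> 0" by blast
    have "curve_point n p q s \<notin> A" "curve_point n p q s \<notin> B"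
      using s f(3) g(3) r r' YU by (metis DiffD2 subsetD)+
    then show False using s(1) Ycl un by blast
  qed
qed

lemma curve_connectedI_lines:
  assumes "Y \<noteq> {}" "Y \<subseteq> param_space n"
    and "\<And>a c a' c'. (a, c) \<in> Y \<Longrightarrow> (a', c') \<in> Y \<Longrightarrow>
      finite {s. curve_point n (\<lambda>i. [:a i, a' i - a i:]) (\<lambda>i. [:c i, c' i - c i:]) s \<notin> Y}"
  shows "curve_connected n Y"
  unfolding curve_connected_def
proof (intro conjI assms ballI)
  fix y y' assume y: "y \<in> Y" "y' \<in> Y"
  obtain a c a' c' where e: "y = (a, c)" "y' = (a', c')" by (meson surj_pair)
  have "(a, c) \<in> param_space n" "(a', c') \<in> param_space n" using y e assms(2) by auto
  then have "curve_point n (\<lambda>i. [:a i, a' i - a i:]) (\<lambda>i. [:c i, c' i - c i:]) 0 = y"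
    "curve_point n (\<lambda>i. [:a i, a' i - a i:]) (\<lambda>i. [:c i, c' i - c i:]) 1 = y'"
    unfolding e curve_point_def param_space_def
    by (auto simp: fun_eq_iff PiE_def extensional_def restrict_def)
  then show "\<exists>p q. curve_point n p q 0 = y \<and> curve_point n p q 1 = y' \<and>
        finite {s. curve_point n p q s \<notin> Y}"
    using assms(3) y unfolding e by blast
qed

lemma finite_roots_nonconst:
  fixes p :: "complex poly"
  assumes "poly p s0 \<noteq> 0"
  shows "finite {s. poly p s = 0}"
  using assms poly_roots_finite[of p] by fastforce

lemma finite_some_root:
  fixes p :: "'i \<Rightarrow> complex poly"
  assumes "finite I" "\<And>i. i \<in> I \<Longrightarrow> \<exists>s. poly (p i) s \<noteq> 0"
  shows "finite {s. \<exists>i\<in>I. poly (p i) s = 0}"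
proof -
  have "{s. \<exists>i\<in>I. poly (p i) s = 0} = (\<Union>i\<in>I. {s. poly (p i) s = 0})" by auto
  moreover have "finite \<dots>"
    using assms finite_roots_nonconst by blast
  ultimately show ?thesis by simp
qed

lemma finite_line_outside_param_space:
  assumes *: "(a, c) \<in> param_space n" "(a', c') \<in> param_space n"
  shows "finite {s. curve_point n (\<lambda>i. [:a i, a' i - a i:]) (\<lambda>i. [:c i, c' i - c i:]) s \<notin> param_space n}"
    (is "finite {s. curve_point n ?p ?q s \<notin> _}")
proof -
  have "finite {s. \<exists>i\<in>{1..n-1}. poly (?q i) s = 0}"
  proof (rule finite_some_root)
    fix i assume "i \<in> {1..n-1}"
    then have "poly (?q i) 0 \<noteq> 0" using * by (auto simp: param_space_def PiE_def Pi_def)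
    then show "\<exists>s. poly (?q i) s \<noteq> 0" by blast
  qed simp
  moreover have "{s. curve_point n ?p ?q s \<notin> param_space n}
      \<subseteq> {s. \<exists>i\<in>{1..n-1}. poly (?q i) s = 0}"
    by (auto simp: curve_point_def param_space_def)
  ultimately show ?thesis using finite_subset by blast
qed

lemma curve_connected_param_space: "curve_connected n (param_space n)"
proof (rule curve_connectedI_lines)
  have "(\<lambda>i\<in>{1..n}. 0, \<lambda>i\<in>{1..n-1}. 1) \<in> param_space n"
    by (simp add: param_space_def)
  then show "param_space n \<noteq> {}" by blast
qed (auto intro: finite_line_outside_param_space)

text \<open>A thin set is a proper closed subset of an irreducible closed set that is itself proper: \<open>h\<close>
  witnesses the first inclusion and \<open>e\<close> the second. Every irreducible closed subset of a thin set
  therefore has codimension at least two.\<close>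

inductive thin :: "nat \<Rightarrow> point set \<Rightarrow> bool" for n where
  thinI: "curve_connected n Y \<Longrightarrow> h \<in> polynomial_functions n \<Longrightarrow> y \<in> Y \<Longrightarrow> h y \<noteq> 0
    \<Longrightarrow> e \<in> polynomial_functions n \<Longrightarrow> (\<And>y. y \<in> Y \<Longrightarrow> e y = 0) \<Longrightarrow> u \<in> param_space n \<Longrightarrow> e u \<noteq> 0
    \<Longrightarrow> thin n {x \<in> zariski_param n closure_of Y. h x = 0}"

definition small_locus :: "nat \<Rightarrow> point set \<Rightarrow> bool" where
  "small_locus n R \<longleftrightarrow> (\<exists>\<W>. finite \<W> \<and> (\<forall>W\<in>\<W>. thin n W) \<and> R \<subseteq> \<Union>\<W>)"

lemma closedin_thin:
  assumes "thin n W"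
  shows "closedin (zariski_param n) W"
  using assms
proof cases
  case (thinI Y h y e u)
  note W = thinI(1) and h = thinI(3)
  have "W = zariski_param n closure_of Y \<inter> {x \<in> param_space n. h x = 0}"
    unfolding W using closure_of_subset_topspace[of "zariski_param n" Y]
    by (auto simp: topspace_zariski_param)
  then show ?thesis
    using closedin_zero_set[OF h] by (simp add: closedin_Int)
qed

lemma irreducible_closedin_subset_Union:
  assumes "irreducible_closedin X Z" "finite \<W>" "\<forall>W\<in>\<W>. closedin X W" "Z \<subseteq> \<Union>\<W>"
  shows "\<exists>W\<in>\<W>. Z \<subseteq> W"
  using assms(2-)
proof (induction \<W>)
  case empty
  then show ?case using assms(1) by (auto simp: irreducible_closedin_def)
next
  case (insert W \<W>)
  have Z: "closedin X Z" using assms(1) by (auto simp: irreducible_closedin_def)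
  have "closedin X (Z \<inter> W)" "closedin X (Z \<inter> \<Union>\<W>)"
    using Z insert.prems(1) insert.hyps(1) by (auto intro!: closedin_Int closedin_Union)
  moreover have "Z = (Z \<inter> W) \<union> (Z \<inter> \<Union>\<W>)" using insert.prems(2) by auto
  ultimately have "Z = Z \<inter> W \<or> Z = Z \<inter> \<Union>\<W>"
    using assms(1) unfolding irreducible_closedin_def by blast
  then show ?case using insert by blast
qed

text \<open>The chain \<open>Z \<subset> closure Y \<subset> \<U>\<^sub>n\<close> of a thin set containing \<open>Z\<close> suffices, and \<open>Z\<close> lies in a
  single thin set because it is irreducible.\<close>

lemma codimension_ge_2_if_small_locus:
  assumes "small_locus n R"
  shows "codimension (zariski_param n) R \<ge> 2"
proof -
  let ?X = "zariski_param n"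
  obtain \<W> where \<W>: "finite \<W>" "\<forall>W\<in>\<W>. thin n W" "R \<subseteq> \<Union>\<W>"
    using assms unfolding small_locus_def by blast
  have cl: "\<forall>W\<in>\<W>. closedin ?X W" using \<W>(2) closedin_thin by blast
  have "?X closure_of R \<subseteq> \<Union>\<W>"
    using \<W> cl by (intro closure_of_minimal closedin_Union) auto
  have "2 \<le> irreducible_codim ?X Z"
    if Z: "irreducible_closedin ?X Z" "Z \<subseteq> ?X closure_of R" for Z
  proof -
    obtain W where W: "W \<in> \<W>" "Z \<subseteq> W"
      using irreducible_closedin_subset_Union[OF Z(1) \<W>(1) cl] Z(2) \<open>?X closure_of R \<subseteq> \<Union>\<W>\<close>
      by blast
    have "thin n W" using \<W>(2) W(1) by simp
    obtain Y y u and h e :: "point \<Rightarrow> complex" where Y: "curve_connected n Y"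
      and h: "W = {x \<in> ?X closure_of Y. h x = 0}" "y \<in> Y" "h y \<noteq> 0"
      and e: "e \<in> polynomial_functions n" "\<And>y. y \<in> Y \<Longrightarrow> e y = 0" "u \<in> param_space n" "e u \<noteq> 0"
      using \<open>thin n W\<close>
    proof (rule thin.cases)
      fix Y h y e u
      assume "W = {x \<in> ?X closure_of Y. h x = 0}" "curve_connected n Y"
        "h \<in> polynomial_functions n" "y \<in> Y" "h y \<noteq> 0" "e \<in> polynomial_functions n"
        "\<And>y. y \<in> Y \<Longrightarrow> e y = 0" "u \<in> param_space n" "e u \<noteq> 0"
      then show thesis by (intro that[of Y h y e u])
    qed
    have YU: "Y \<subseteq> param_space n" using Y unfolding curve_connected_def by blast
    have Ycl: "Y \<subseteq> ?X closure_of Y"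
      using YU by (intro closure_of_subset) (simp add: topspace_zariski_param)
    have "?X closure_of Y \<subseteq> {x \<in> param_space n. e x = 0}"
      using YU e by (intro closure_of_minimal closedin_zero_set) auto
    then have VU: "?X closure_of Y \<subset> param_space n" using e(3,4) by auto
    have ZV: "Z \<subset> ?X closure_of Y" using W(2) h Ycl by auto
    have "irreducible_closedin ?X (param_space n)"
      using irreducible_closure_of_curve_connected[OF curve_connected_param_space[of n]]
        closure_of_topspace[of ?X] by (simp add: topspace_zariski_param)
    note irr = Z(1) irreducible_closure_of_curve_connected[OF Y] this
    define C where "C = (\<lambda>i::nat. if i = 0 then Z else if i = 1 then ?X closure_of Y else param_space n)"
    have "C 0 = Z" "\<forall>i\<le>2. irreducible_closedin ?X (C i)" "\<forall>i<2. C i \<subset> C (Suc i)"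
      using irr ZV VU by (auto simp: C_def less_2_cases_iff)
    then have "enat 2 \<le> irreducible_codim ?X Z"
      unfolding irreducible_codim_def by (intro Sup_upper) blast
    then show ?thesis by (simp add: numeral_eq_enat)
  qed
  then show ?thesis
    unfolding codimension_def by (intro Inf_greatest) auto
qed

lemma small_locus_subset: "small_locus n R \<Longrightarrow> R' \<subseteq> R \<Longrightarrow> small_locus n R'"
  unfolding small_locus_def by (meson order_trans)

lemma small_locus_empty: "small_locus n {}"
  unfolding small_locus_def by (intro exI[of _ "{}"]) auto

lemma small_locus_Un:
  assumes "small_locus n R" "small_locus n R'"
  shows "small_locus n (R \<union> R')"
proof -
  obtain A B where "finite A" "\<forall>W\<in>A. thin n W" "R \<subseteq> \<Union>A" "finite B" "\<forall>W\<in>B. thin n W" "R' \<subseteq> \<Union>B"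
    using assms unfolding small_locus_def by blast
  then show ?thesis unfolding small_locus_def by (intro exI[of _ "A \<union> B"]) auto
qed

lemma small_locus_UN:
  assumes "finite I" "\<And>i. i \<in> I \<Longrightarrow> small_locus n (R i)"
  shows "small_locus n (\<Union>i\<in>I. R i)"
  using assms by (induction I) (auto intro: small_locus_Un small_locus_empty)

definition separation :: "(nat \<times> nat) set \<Rightarrow> point \<Rightarrow> complex" where
  "separation Q x = (\<Prod>(k, l)\<in>Q. fst x k - fst x l)"

text \<open>The functions that become polynomial after multiplication with a power of the product of the
  differences \<open>a\<^sub>k - a\<^sub>l\<close>, \<open>(k, l) \<in> Q\<close>. The conditions below arise as rational functions of this kind.\<close>

definition rational_on :: "nat \<Rightarrow> (nat \<times> nat) set \<Rightarrow> (point \<Rightarrow> complex) set" where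
  "rational_on n Q = {f. \<exists>N. \<exists>p\<in>polynomial_functions n. \<forall>x. separation Q x \<noteq> 0 \<longrightarrow>
     p x = f x * separation Q x ^ N}"

lemma separation_polynomial:
  assumes "Q \<subseteq> {1..n} \<times> {1..n}"
  shows "separation Q \<in> polynomial_functions n"
proof -
  have "(\<lambda>x. \<Prod>q\<in>Q. (\<lambda>x. fst x (fst q) - fst x (snd q)) x) \<in> polynomial_functions n"
    using assms
    by (intro polynomial_functions_prod polynomial_functions_diff polynomial_functions.coord_a) auto
  then show ?thesis by (simp add: separation_def[abs_def] case_prod_unfold)
qed

lemma separation_nonzero_iff:
  assumes "finite Q"
  shows "separation Q x \<noteq> 0 \<longleftrightarrow> (\<forall>(k, l)\<in>Q. fst x k \<noteq> fst x l)"
  using assms by (auto simp: separation_def)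

lemma rational_on_polynomial:
  assumes "f \<in> polynomial_functions n"
  shows "f \<in> rational_on n Q"
  unfolding rational_on_def using assms by (auto intro!: exI[of _ 0])

lemma rational_on_mult:
  assumes "f \<in> rational_on n Q" "g \<in> rational_on n Q"
  shows "(\<lambda>x. f x * g x) \<in> rational_on n Q"
proof -
  obtain N p M q where
    "p \<in> polynomial_functions n" "\<forall>x. separation Q x \<noteq> 0 \<longrightarrow> p x = f x * separation Q x ^ N"
    "q \<in> polynomial_functions n" "\<forall>x. separation Q x \<noteq> 0 \<longrightarrow> q x = g x * separation Q x ^ M"
    using assms unfolding rational_on_def by blast
  then show ?thesis unfolding rational_on_def
    by (intro CollectI exI[of _ "N + M"] bexI[of _ "\<lambda>x. p x * q x"])
      (auto intro: polynomial_functions.mult simp: power_add)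
qed

lemma rational_on_add:
  assumes Q: "Q \<subseteq> {1..n} \<times> {1..n}" and "f \<in> rational_on n Q" "g \<in> rational_on n Q"
  shows "(\<lambda>x. f x + g x) \<in> rational_on n Q"
proof -
  obtain N p M q where pq:
    "p \<in> polynomial_functions n" "\<forall>x. separation Q x \<noteq> 0 \<longrightarrow> p x = f x * separation Q x ^ N"
    "q \<in> polynomial_functions n" "\<forall>x. separation Q x \<noteq> 0 \<longrightarrow> q x = g x * separation Q x ^ M"
    using assms unfolding rational_on_def by blast
  have "(\<lambda>x. p x * separation Q x ^ M + q x * separation Q x ^ N) \<in> polynomial_functions n"
    by (intro polynomial_functions.add polynomial_functions.mult polynomial_functions_power
        separation_polynomial Q pq)
  moreover have "\<forall>x. separation Q x \<noteq> 0 \<longrightarrow> p x * separation Q x ^ M + q x * separation Q x ^ N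
      = (f x + g x) * separation Q x ^ (N + M)"
    using pq by (auto simp: power_add algebra_simps)
  ultimately show ?thesis unfolding rational_on_def
    by (intro CollectI exI[of _ "N + M"])
      (rule bexI[of _ "\<lambda>x. p x * separation Q x ^ M + q x * separation Q x ^ N"])
qed

lemma rational_on_const: "(\<lambda>_. z) \<in> rational_on n Q"
  by (intro rational_on_polynomial polynomial_functions.const)

lemma rational_on_diff:
  assumes "Q \<subseteq> {1..n} \<times> {1..n}" and "f \<in> rational_on n Q" "g \<in> rational_on n Q"
  shows "(\<lambda>x. f x - g x) \<in> rational_on n Q"
  using rational_on_add[OF assms(1,2) rational_on_mult[OF rational_on_const[of "-1"] assms(3)]]
  by simp

lemma rational_on_sum:
  assumes "Q \<subseteq> {1..n} \<times> {1..n}" and "\<And>i. i \<in> I \<Longrightarrow> f i \<in> rational_on n Q"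
  shows "(\<lambda>x. \<Sum>i\<in>I. f i x) \<in> rational_on n Q"
  using assms
  by (induction I rule: infinite_finite_induct) (simp_all add: rational_on_const rational_on_add)

lemma rational_on_inverse_difference:
  assumes Q: "Q \<subseteq> {1..n} \<times> {1..n}" and kl: "(k, l) \<in> Q \<or> (l, k) \<in> Q"
  shows "(\<lambda>x. inverse (fst x k - fst x l)) \<in> rational_on n Q"
proof -
  have fin: "finite Q" using Q finite_subset by blast
  have main: "(\<lambda>x. inverse (fst x k - fst x l)) \<in> rational_on n Q" if kl: "(k, l) \<in> Q" for k l
  proof -
    have "separation (Q - {(k, l)}) \<in> polynomial_functions n"
      using Q by (intro separation_polynomial) auto
    moreover have "separation (Q - {(k, l)}) x = inverse (fst x k - fst x l) * separation Q x ^ 1"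
      if "separation Q x \<noteq> 0" for x
    proof -
      have "separation Q x = (fst x k - fst x l) * separation (Q - {(k, l)}) x"
        unfolding separation_def using prod.remove[OF fin kl, of "\<lambda>(k, l). fst x k - fst x l"] by simp
      moreover from this that have "fst x k - fst x l \<noteq> 0" by auto
      ultimately show ?thesis by simp
    qed
    ultimately show ?thesis unfolding rational_on_def by blast
  qed
  show ?thesis
  proof (cases "(k, l) \<in> Q")
    case True
    then show ?thesis by (rule main)
  next
    case False
    then have "(\<lambda>x. (-1) * inverse (fst x l - fst x k)) \<in> rational_on n Q"
      using kl by (intro rational_on_mult rational_on_const main) auto
    moreover have "(\<lambda>x::point. (-1) * inverse (fst x l - fst x k)) = (\<lambda>x. inverse (fst x k - fst x l))"
      by (auto simp: fun_eq_iff) (metis inverse_minus_eq minus_diff_eq)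
    ultimately show ?thesis by simp
  qed
qed

lemma rational_on_divide_difference:
  assumes "Q \<subseteq> {1..n} \<times> {1..n}" "(k, l) \<in> Q \<or> (l, k) \<in> Q" "f \<in> rational_on n Q"
  shows "(\<lambda>x. f x / (fst x k - fst x l)) \<in> rational_on n Q"
  using rational_on_mult[OF assms(3) rational_on_inverse_difference[OF assms(1,2)]]
  by (simp add: divide_inverse)

text \<open>The form in which thin sets are produced. The function \<open>f\<close> has to be nonzero at a single point, and
  this point may lie outside of \<open>Y\<close>, as long as some curve through it runs inside \<open>Y\<close> elsewhere. This makes
  degenerate points with many \<open>c\<^sub>k = 0\<close> available as witnesses.\<close>

lemma small_locus_zero_set:
  assumes Q: "Q \<subseteq> {1..n} \<times> {1..n}" and Y: "curve_connected n Y"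
    and f: "f \<in> rational_on n Q"
    and e: "e \<in> polynomial_functions n" "\<And>y. y \<in> Y \<Longrightarrow> e y = 0" "u \<in> param_space n" "e u \<noteq> 0"
    and curve: "finite {s. curve_point n p q s \<notin> Y}"
    and w: "separation Q (curve_point n p q 0) \<noteq> 0" "f (curve_point n p q 0) \<noteq> 0"
  shows "small_locus n {y \<in> Y. separation Q y \<noteq> 0 \<and> f y = 0}"
proof -
  obtain N g where g: "g \<in> polynomial_functions n"
    "\<forall>x. separation Q x \<noteq> 0 \<longrightarrow> g x = f x * separation Q x ^ N"
    using f unfolding rational_on_def by blast
  obtain r where r: "\<forall>s. g (curve_point n p q s) = poly r s"
    using polynomial_function_on_curve[OF g(1)] by blast
  have "poly r 0 \<noteq> 0" using r g w by (metis mult_eq_0_iff power_not_zero)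
  then have "r \<noteq> 0" by auto
  then obtain s where s: "curve_point n p q s \<in> Y" "g (curve_point n p q s) \<noteq> 0"
    using cofinite_nonzero[OF _ _ curve] r by (metis (mono_tags, lifting) mem_Collect_eq)
  define W where "W = {x \<in> zariski_param n closure_of Y. g x = 0}"
  have "thin n W" unfolding W_def by (rule thinI[OF Y g(1) s e])
  moreover have "{y \<in> Y. separation Q y \<noteq> 0 \<and> f y = 0} \<subseteq> W"
  proof -
    have "Y \<subseteq> zariski_param n closure_of Y"
      using Y by (intro closure_of_subset) (simp add: curve_connected_def topspace_zariski_param)
    then show ?thesis unfolding W_def using g(2) by auto
  qed
  ultimately show ?thesis unfolding small_locus_def by (intro exI[of _ "{W}"]) auto
qed

section \<open>Continuants and factorizations of the spectral polynomial\<close>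

text \<open>Continuants commute with ring homomorphisms. Evaluation at \<open>w = 0\<close>, substitution of a series for
  \<open>\<lambda>\<close>, the passage from \<open>t\<close> to \<open>w\<^sup>2\<close> and homogenization are all instances.\<close>

definition is_ring_hom :: "('a::comm_ring_1 \<Rightarrow> 'b::comm_ring_1) \<Rightarrow> bool" where
  "is_ring_hom h \<longleftrightarrow> h 0 = 0 \<and> h 1 = 1 \<and> (\<forall>x y. h (x + y) = h x + h y) \<and> (\<forall>x y. h (x * y) = h x * h y)"

lemma is_ring_homD:
  assumes "is_ring_hom h"
  shows "h 0 = 0" "h 1 = 1" "h (x + y) = h x + h y" "h (x * y) = h x * h y" "h (x - y) = h x - h y"
proof -
  show "h 0 = 0" "h 1 = 1" "h (x + y) = h x + h y" "h (x * y) = h x * h y"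
    using assms by (auto simp: is_ring_hom_def)
  have "h (x - y) + h y = h x"
    using assms by (metis is_ring_hom_def diff_add_cancel)
  then show "h (x - y) = h x - h y" by (simp add: eq_diff_eq)
qed

lemma is_ring_hom_sum:
  assumes "is_ring_hom h"
  shows "h (\<Sum>i\<in>I. f i) = (\<Sum>i\<in>I. h (f i))"
  by (induction I rule: infinite_finite_induct) (simp_all add: is_ring_homD[OF assms])

lemma is_ring_hom_prod:
  assumes "is_ring_hom h"
  shows "h (\<Prod>i\<in>I. f i) = (\<Prod>i\<in>I. h (f i))"
  by (induction I rule: infinite_finite_induct) (simp_all add: is_ring_homD[OF assms])

lemma is_ring_hom_map_poly:
  assumes "is_ring_hom h"
  shows "is_ring_hom (map_poly h)"
  unfolding is_ring_hom_def
proof (intro conjI allI)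
  note h = is_ring_homD[OF assms]
  show "map_poly h 0 = 0" by simp
  show "map_poly h 1 = 1" by (simp add: h)
  show "map_poly h (x + y) = map_poly h x + map_poly h y" for x y
    by (intro poly_eqI) (simp add: coeff_map_poly h)
  show "map_poly h (x * y) = map_poly h x * map_poly h y" for x y
    by (intro poly_eqI) (simp add: coeff_map_poly h coeff_mult is_ring_hom_sum[OF assms])
qed

lemma is_ring_hom_poly: "is_ring_hom (\<lambda>p. poly p x)"
  by (simp add: is_ring_hom_def)

lemma is_ring_hom_compose: "is_ring_hom g \<Longrightarrow> is_ring_hom h \<Longrightarrow> is_ring_hom (\<lambda>x. g (h x))"
  by (simp add: is_ring_hom_def)

lemma is_ring_hom_pcompose: "is_ring_hom (\<lambda>p. pcompose p r)"
  by (simp add: is_ring_hom_def pcompose_add pcompose_mult pcompose_1)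

lemma is_ring_hom_const_poly: "is_ring_hom (\<lambda>z. [:z:])"
  by (simp add: is_ring_hom_def)

lemma is_ring_hom_coeff_0: "is_ring_hom (\<lambda>q. coeff q 0)"
  by (simp add: is_ring_hom_def coeff_mult_0)

fun continuant :: "(nat \<Rightarrow> 'r::comm_ring_1) \<Rightarrow> (nat \<Rightarrow> 'r) \<Rightarrow> nat \<Rightarrow> 'r" where
  "continuant x d 0 = 1"
| "continuant x d (Suc 0) = x 1"
| "continuant x d (Suc (Suc k)) = x (Suc (Suc k)) * continuant x d (Suc k) - d (Suc k) * continuant x d k"

lemma continuant_hom:
  assumes "is_ring_hom h"
  shows "h (continuant x d n) = continuant (\<lambda>k. h (x k)) (\<lambda>k. h (d k)) n"
  by (induction x d n rule: continuant.induct) (simp_all add: is_ring_homD[OF assms])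

lemma reduced_continuant_eq:
  "reduced_continuant a c n = continuant (\<lambda>k. [:[:a k:], 1:]) (\<lambda>k. [:[:0, c k:]:]) n"
  by (induction a c n rule: reduced_continuant.induct) simp_all

lemma spectral_poly_eq:
  "spectral_poly a c n = continuant (\<lambda>k. [:[:a k:], 1:]) (\<lambda>k. [:[:0, 0, c k:]:]) n"
  unfolding spectral_poly_def reduced_continuant_eq
    continuant_hom[OF is_ring_hom_map_poly[OF is_ring_hom_pcompose]]
  by (simp add: map_poly_pCons pcompose_pCons pcompose_1)

lemma poly_spectral_poly:
  "poly (spectral_poly a c n) \<rho> = continuant (\<lambda>k. [:a k:] + \<rho>) (\<lambda>k. [:0, 0, c k:]) n"
  unfolding spectral_poly_eq continuant_hom[OF is_ring_hom_poly, of _ _ n \<rho>] by simp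

lemma continuant_zero: "continuant x (\<lambda>_. 0) n = (\<Prod>k=1..n. x k)"
  by (induction x "\<lambda>_::nat. 0::'a" n rule: continuant.induct) (simp_all add: mult.commute)

lemma spectral_poly_at_zero:
  "map_poly (\<lambda>q. coeff q 0) (spectral_poly a c n) = (\<Prod>k=1..n. [:a k, 1:])"
  unfolding spectral_poly_eq continuant_hom[OF is_ring_hom_map_poly[OF is_ring_hom_coeff_0]]
  by (simp add: map_poly_pCons continuant_zero)

lemma continuant_monic:
  fixes a e :: "nat \<Rightarrow> 'a::idom"
  shows "degree (continuant (\<lambda>k. [:a k, 1:]) (\<lambda>k. [:e k:]) n) = n"
    "coeff (continuant (\<lambda>k. [:a k, 1:]) (\<lambda>k. [:e k:]) n) n = 1"
proof -
  let ?K = "continuant (\<lambda>k. [:a k, 1:]) (\<lambda>k. [:e k:])"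
  have "degree (?K m) \<le> m \<and> coeff (?K m) m = 1" for m
  proof (induction m rule: less_induct)
    case (less m)
    consider "m = 0" | "m = 1" | k where "m = Suc (Suc k)"
      by (metis One_nat_def not0_implies_Suc)
    then show ?case
    proof cases
      case 3
      have 1: "degree (?K (Suc k)) \<le> Suc k" "coeff (?K (Suc k)) (Suc k) = 1" "degree (?K k) \<le> k"
        using less 3 by auto
      have "degree ([:a (Suc (Suc k)), 1:] * ?K (Suc k)) \<le> Suc (Suc k)"
        using degree_mult_le[of "[:a (Suc (Suc k)), 1:]" "?K (Suc k)"] 1 by simp
      moreover have "degree ([:e (Suc k):] * ?K k) \<le> Suc (Suc k)"
        using degree_mult_le[of "[:e (Suc k):]" "?K k"] 1 by simp
      ultimately have "degree (?K m) \<le> m" unfolding 3 by (simp add: degree_diff_le del: mult_pCons_left)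
      moreover have "coeff (?K m) m = 1"
        unfolding 3 using 1 by (simp add: coeff_eq_0)
      ultimately show ?thesis by simp
    qed auto
  qed
  from this[of n] show "coeff (?K n) n = 1" "degree (?K n) = n"
    by (auto intro!: antisym le_degree)
qed

lemma spectral_poly_monic: "degree (spectral_poly a c n) = n" "coeff (spectral_poly a c n) n = 1"
  unfolding spectral_poly_eq by (rule continuant_monic)+

lemma monic_reducible_factors:
  fixes P :: "'a::idom poly"
  assumes "lead_coeff P = 1" "degree P \<ge> 1" "\<not> irreducible P"
  shows "\<exists>A B. P = A * B \<and> lead_coeff A = 1 \<and> lead_coeff B = 1 \<and> degree A \<ge> 1 \<and> degree B \<ge> 1"
proof -
  have "P \<noteq> 0" using assms(1) by auto
  moreover have "\<not> P dvd 1"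
    using assms(2) by (metis dvd_imp_degree_le degree_1 le_zero_eq one_neq_zero)
  ultimately obtain C D where CD: "P = C * D" "\<not> C dvd 1" "\<not> D dvd 1"
    using assms(3) unfolding irreducible_def by blast
  have lc: "lead_coeff C * lead_coeff D = 1"
    using CD(1) assms(1) by (metis lead_coeff_mult)
  then have nz: "lead_coeff C \<noteq> 0" "lead_coeff D \<noteq> 0" by auto
  have unit: "X dvd 1" if X: "degree X = 0" "lead_coeff X * u = 1" for X :: "'a poly" and u
  proof -
    obtain v where v: "X = [:v:]" using X(1) by (rule degree_eq_zeroE)
    then have "v * u = 1" using X(2) by simp
    then have "X * [:u:] = 1" unfolding v by (simp add: mult.commute one_pCons)
    then show ?thesis by (metis dvdI)
  qed
  have "degree C \<noteq> 0" using CD(2) lc unit by blast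
  moreover have "degree D \<noteq> 0" using CD(3) lc unit by (metis mult.commute)
  moreover have "P = smult (lead_coeff D) C * smult (lead_coeff C) D"
    using CD(1) lc by (simp add: mult.commute)
  moreover have "lead_coeff (smult (lead_coeff D) C) = 1" "lead_coeff (smult (lead_coeff C) D) = 1"
    using lc nz by (simp_all add: mult.commute)
  ultimately show ?thesis
    using nz by (intro exI[of _ "smult (lead_coeff D) C"] exI[of _ "smult (lead_coeff C) D"]) simp
qed

text \<open>The substitution \<open>t = w\<^sup>2\<close> preserves degrees in \<open>\<lambda>\<close>, so it turns a factorization with factors of
  positive degree into another one.\<close>

lemma spectral_poly_reducible_if_reduced_continuant_reducible:
  assumes "\<not> irreducible (reduced_continuant a c n)" "n \<ge> 1"
  shows "\<not> irreducible (spectral_poly a c n)"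
proof
  assume irr: "irreducible (spectral_poly a c n)"
  let ?h = "map_poly (\<lambda>q. pcompose q [:0, 0, 1:]) :: complex poly poly \<Rightarrow> complex poly poly"
  obtain A B where AB: "reduced_continuant a c n = A * B" "degree A \<ge> 1" "degree B \<ge> 1"
    using monic_reducible_factors[OF _ _ assms(1)] assms(2)
      continuant_monic[of "\<lambda>k. [:a k:]" "\<lambda>k. [:0, c k:]" n, folded reduced_continuant_eq] by auto
  have "spectral_poly a c n = ?h A * ?h B"
    unfolding spectral_poly_def AB(1) by (rule is_ring_homD(4)[OF is_ring_hom_map_poly[OF is_ring_hom_pcompose]])
  then have "?h A dvd 1 \<or> ?h B dvd 1" using irr irreducibleD by blast
  then have "degree (?h A) = 0 \<or> degree (?h B) = 0"
    by (metis dvd_imp_degree_le degree_1 le_zero_eq one_neq_zero)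
  moreover have "degree (?h X) = degree X" for X
    by (rule degree_map_poly) (simp add: pcompose_eq_0_iff)
  ultimately show False using AB by simp
qed

text \<open>This substitutes \<open>w \<lambda>\<close> for \<open>\<lambda>\<close> and regards the result as a polynomial in \<open>w\<close> over \<open>\<complex>[\<lambda>]\<close>. Its degree
  is the total degree of \<open>A\<close>, and being a degree over a domain it is additive on products.\<close>

definition homogenize :: "complex poly poly \<Rightarrow> complex poly poly" where
  "homogenize A = poly (map_poly (map_poly (\<lambda>z. [:z:])) A) [:0, [:0, 1:]:]"

lemma is_ring_hom_homogenize: "is_ring_hom homogenize"
  unfolding homogenize_def
  by (intro is_ring_hom_compose[OF is_ring_hom_poly] is_ring_hom_map_poly is_ring_hom_const_poly)

lemma coeff_homogenize:
  "coeff (coeff (homogenize A) m) j = (if j \<le> m then coeff (coeff A j) (m - j) else 0)"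
proof (induction A arbitrary: m j)
  case 0
  then show ?case by (simp add: homogenize_def)
next
  case (pCons q A)
  have "homogenize (pCons q A) = map_poly (\<lambda>z. [:z:]) q + [:0, [:0, 1:]:] * homogenize A"
    by (simp add: homogenize_def map_poly_pCons del: mult_pCons_left)
  then show ?case
    by (cases m; cases j) (auto simp: coeff_map_poly pCons.IH coeff_pCons)
qed

lemma degree_homogenize_spectral_poly: "degree (homogenize (spectral_poly a c n)) \<le> n"
proof -
  let ?x = "\<lambda>k. [:[:a k:], [:0, 1:]:]" and ?d = "\<lambda>k. [:0, 0, [:c k:]:]"
  have "degree (continuant ?x ?d n) \<le> n"
  proof (induction n rule: less_induct)
    case (less n)
    consider "n = 0" | "n = 1" | k where "n = Suc (Suc k)"
      by (metis One_nat_def not0_implies_Suc)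
    then show ?case
    proof cases
      case 3
      have 1: "degree (continuant ?x ?d (Suc k)) \<le> Suc k" "degree (continuant ?x ?d k) \<le> k"
        using less 3 by auto
      have "degree (?x (Suc (Suc k)) * continuant ?x ?d (Suc k)) \<le> Suc (Suc k)"
        using degree_mult_le[of "?x (Suc (Suc k))" "continuant ?x ?d (Suc k)"] 1 by simp
      moreover have "degree (?d (Suc k) * continuant ?x ?d k) \<le> Suc (Suc k)"
      proof -
        have "degree (?d (Suc k)) \<le> 2" by (simp add: numeral_2_eq_2)
        then show ?thesis
          using degree_mult_le[of "?d (Suc k)" "continuant ?x ?d k"] 1 by linarith
      qed
      ultimately show ?thesis unfolding 3 by (simp add: degree_diff_le del: mult_pCons_left)
    qed auto
  qed
  moreover have "homogenize (spectral_poly a c n) = continuant ?x ?d n"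
    unfolding spectral_poly_eq continuant_hom[OF is_ring_hom_homogenize]
    by (simp add: homogenize_def map_poly_pCons)
  ultimately show ?thesis by simp
qed

lemma degree_homogenize_monic:
  assumes "coeff A s = 1"
  shows "s \<le> degree (homogenize A)" "homogenize A \<noteq> 0"
proof -
  have "coeff (coeff (homogenize A) s) s = 1" by (simp add: coeff_homogenize assms)
  then have "coeff (homogenize A) s \<noteq> 0" by auto
  then show "s \<le> degree (homogenize A)" "homogenize A \<noteq> 0" by (auto intro: le_degree)
qed

text \<open>The total degrees of \<open>A\<close> and \<open>B\<close> add up to at most \<open>n\<close>, and each is at least the degree in
  \<open>\<lambda>\<close>; as these also add up to \<open>n\<close>, equality holds.\<close>

lemma subleading_coeff_bound:
  assumes AB: "spectral_poly a c n = A * B" and A: "lead_coeff A = 1" and B: "lead_coeff B = 1"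
    and "degree A \<ge> 1" "m \<ge> 2"
  shows "coeff (coeff A (degree A - 1)) m = 0"
proof -
  have "A \<noteq> 0" "B \<noteq> 0" using A B by auto
  then have n: "n = degree A + degree B"
    using AB spectral_poly_monic(1)[of a c n] by (metis degree_mult_eq)
  have nz: "homogenize A \<noteq> 0" "homogenize B \<noteq> 0"
    and le: "degree A \<le> degree (homogenize A)" "degree B \<le> degree (homogenize B)"
    using degree_homogenize_monic A B by auto
  have "degree (homogenize A) + degree (homogenize B) \<le> n"
    using degree_homogenize_spectral_poly[of a c n] nz
    unfolding AB is_ring_homD(4)[OF is_ring_hom_homogenize] by (simp add: degree_mult_eq)
  then have "degree (homogenize A) = degree A" using le n by linarith
  then have "coeff (homogenize A) (m + (degree A - 1)) = 0"
    using assms(4,5) by (intro coeff_eq_0) linarith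
  then have "coeff (coeff (homogenize A) (m + (degree A - 1))) (degree A - 1) = 0" by simp
  then show ?thesis unfolding coeff_homogenize by simp
qed

lemma monic_factors_of_linear_product:
  fixes A B :: "complex poly"
  assumes "finite I" "A * B = (\<Prod>k\<in>I. [:a k, 1:])" "lead_coeff A = 1" "lead_coeff B = 1"
  shows "\<exists>S\<subseteq>I. A = (\<Prod>k\<in>S. [:a k, 1:]) \<and> B = (\<Prod>k\<in>I-S. [:a k, 1:])"
  using assms
proof (induction I arbitrary: A B)
  case empty
  then have "A * B = 1" by simp
  moreover have "A \<noteq> 0" "B \<noteq> 0" using empty by auto
  ultimately have "degree A = 0" "degree B = 0"
    using degree_mult_eq[of A B] by simp_all
  then show ?case using empty by (auto elim!: degree_eq_zeroE)
next
  case (insert i I)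
  have key: "\<exists>S\<subseteq>insert i I. A = (\<Prod>k\<in>S. [:a k, 1:]) \<and> B = (\<Prod>k\<in>insert i I-S. [:a k, 1:])"
    if AB: "A * B = (\<Prod>k\<in>insert i I. [:a k, 1:])" and m: "lead_coeff A = 1" "lead_coeff B = 1"
      and root: "poly A (- a i) = 0" for A B
  proof -
    obtain A' where A': "A = [:a i, 1:] * A'"
      using root by (metis dvdE minus_minus poly_eq_0_iff_dvd)
    have "[:a i, 1:] * (A' * B) = [:a i, 1:] * (\<Prod>k\<in>I. [:a k, 1:])"
      using AB insert.hyps unfolding A' by (simp add: mult.assoc del: mult_pCons_left)
    then have "A' * B = (\<Prod>k\<in>I. [:a k, 1:])"
      by (metis mult_left_cancel pCons_eq_0_iff zero_neq_one)
    moreover have "lead_coeff A' = 1" using m(1) unfolding A' lead_coeff_mult by simp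
    ultimately obtain S where S: "S \<subseteq> I" "A' = (\<Prod>k\<in>S. [:a k, 1:])" "B = (\<Prod>k\<in>I-S. [:a k, 1:])"
      using insert.IH m(2) by blast
    have "finite S" "i \<notin> S" using S(1) insert.hyps finite_subset by auto
    then have "A = (\<Prod>k\<in>insert i S. [:a k, 1:])" unfolding A' S(2) by simp
    moreover have "insert i I - insert i S = I - S" using insert.hyps by auto
    ultimately show ?thesis using S(1,3) by (intro exI[of _ "insert i S"]) auto
  qed
  have "poly (A * B) (- a i) = 0" unfolding insert.prems(1) poly_prod using insert.hyps by simp
  then consider "poly A (- a i) = 0" | "poly B (- a i) = 0" by auto
  then show ?case
  proof cases
    case 1
    then show ?thesis using key insert.prems by blast
  next
    case 2
    have "B * A = (\<Prod>k\<in>insert i I. [:a k, 1:])" using insert.prems(1) by (simp add: mult.commute)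
    from key[OF this insert.prems(3,2) 2] obtain S where
      "S \<subseteq> insert i I" "B = (\<Prod>k\<in>S. [:a k, 1:])" "A = (\<Prod>k\<in>insert i I-S. [:a k, 1:])" by blast
    then show ?thesis by (intro exI[of _ "insert i I - S"]) (auto simp: double_diff)
  qed
qed

text \<open>The set \<open>S\<close> records which of the roots \<open>- a\<^sub>k\<close> at \<open>w = 0\<close> belong to \<open>A\<close>.\<close>

definition spectral_factorization ::
  "(nat \<Rightarrow> complex) \<Rightarrow> (nat \<Rightarrow> complex) \<Rightarrow> nat \<Rightarrow> nat set \<Rightarrow> complex poly poly \<Rightarrow> complex poly poly \<Rightarrow> bool" where
  "spectral_factorization a c n S A B \<longleftrightarrow>
     spectral_poly a c n = A * B \<and> lead_coeff A = 1 \<and> lead_coeff B = 1 \<and>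
     S \<subseteq> {1..n} \<and> S \<noteq> {} \<and> S \<noteq> {1..n} \<and>
     map_poly (\<lambda>q. coeff q 0) A = (\<Prod>k\<in>S. [:a k, 1:]) \<and>
     map_poly (\<lambda>q. coeff q 0) B = (\<Prod>k\<in>{1..n}-S. [:a k, 1:])"

lemma spectral_factorization_swap:
  assumes "spectral_factorization a c n S A B"
  shows "spectral_factorization a c n ({1..n} - S) B A"
  using assms unfolding spectral_factorization_def
  by (auto simp: mult.commute double_diff)

lemma degree_prod_linear:
  fixes r :: "'i \<Rightarrow> 'a::idom"
  shows "degree (\<Prod>k\<in>S. [:r k, 1:]) = card S"
  by (subst degree_prod_eq_sum_degree) auto

lemma lead_coeff_prod_linear:
  fixes r :: "'i \<Rightarrow> 'a::idom"
  shows "coeff (\<Prod>k\<in>S. [:r k, 1:]) (card S) = 1"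
  using lead_coeff_prod[of "\<lambda>k. [:r k, 1:]" S] by (simp add: degree_prod_linear)

lemma degree_map_coeff_0:
  fixes A :: "complex poly poly"
  assumes "lead_coeff A = 1"
  shows "degree (map_poly (\<lambda>q. coeff q 0) A) = degree A"
    "lead_coeff (map_poly (\<lambda>q. coeff q 0) A) = 1"
proof -
  show "degree (map_poly (\<lambda>q. coeff q 0) A) = degree A"
    using assms by (intro antisym le_degree degree_le) (auto simp: coeff_map_poly coeff_eq_0)
  then show "lead_coeff (map_poly (\<lambda>q. coeff q 0) A) = 1"
    using assms by (simp add: coeff_map_poly)
qed

lemma spectral_factorization_degree:
  assumes "spectral_factorization a c n S A B"
  shows "degree A = card S" "card S \<ge> 1"
proof -
  show "degree A = card S"
    using assms degree_map_coeff_0(1)[of A] degree_prod_linear[of a S]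
    unfolding spectral_factorization_def by simp
  show "card S \<ge> 1"
    using assms unfolding spectral_factorization_def
    by (metis One_nat_def Suc_leI card_gt_0_iff finite_atLeastAtMost finite_subset)
qed

lemma exists_spectral_factorization:
  assumes "\<not> irreducible (spectral_poly a c n)" "n \<ge> 1"
  shows "\<exists>S A B. spectral_factorization a c n S A B"
proof -
  obtain A B where AB: "spectral_poly a c n = A * B" and lead: "lead_coeff A = 1" "lead_coeff B = 1"
    and deg: "degree A \<ge> 1" "degree B \<ge> 1"
    using monic_reducible_factors[OF _ _ assms(1)] assms(2) spectral_poly_monic[of a c n] by auto
  have "map_poly (\<lambda>q. coeff q 0) A * map_poly (\<lambda>q. coeff q 0) B = (\<Prod>k\<in>{1..n}. [:a k, 1:])"
    using spectral_poly_at_zero[of a c n] unfolding AB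
    by (simp only: is_ring_homD(4)[OF is_ring_hom_map_poly[OF is_ring_hom_coeff_0]])
  from monic_factors_of_linear_product[OF _ this] degree_map_coeff_0(2) lead
  obtain S where S: "S \<subseteq> {1..n}" "map_poly (\<lambda>q. coeff q 0) A = (\<Prod>k\<in>S. [:a k, 1:])"
    "map_poly (\<lambda>q. coeff q 0) B = (\<Prod>k\<in>{1..n}-S. [:a k, 1:])"
    by (metis finite_atLeastAtMost)
  have "card S = degree A" "card ({1..n} - S) = degree B"
    using degree_map_coeff_0(1)[OF lead(1)] degree_map_coeff_0(1)[OF lead(2)]
    unfolding S(2,3) degree_prod_linear by simp_all
  then have "S \<noteq> {}" "S \<noteq> {1..n}" using deg by auto
  then show ?thesis
    unfolding spectral_factorization_def using AB lead S by blast
qed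

lemma monom_dvd_cancel:
  fixes x y :: "complex poly"
  assumes "monom 1 N dvd x * y" "coeff x 0 \<noteq> 0"
  shows "monom 1 N dvd y"
proof (cases "y = 0")
  case False
  have "x \<noteq> 0" using assms(2) by auto
  moreover have "order 0 x = 0" using assms(2) by (simp add: order_0I poly_0_coeff_0)
  ultimately show ?thesis
    using assms(1) False by (simp add: monom_1_dvd_iff order_mult)
qed simp

text \<open>The factor theorem modulo \<open>w\<^sup>N\<close>. Roots with distinct values at \<open>w = 0\<close> can be split off one after
  the other, because their differences are units modulo \<open>w\<^sup>N\<close>. The degree bound on the error term \<open>E\<close>
  keeps the coefficients of the product comparable with those of \<open>A\<close>.\<close>

lemma approximate_linear_factors:
  fixes A :: "complex poly poly"
  assumes "finite T" "lead_coeff A = 1" "card T \<le> degree A"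
    and "\<And>k. k \<in> T \<Longrightarrow> monom 1 N dvd poly A (r k)" "inj_on (\<lambda>k. coeff (r k) 0) T"
  shows "\<exists>A' E. A = (\<Prod>k\<in>T. [:- r k, 1:]) * A' + smult (monom 1 N) E \<and>
    lead_coeff A' = 1 \<and> degree A' = degree A - card T \<and> (\<forall>m\<ge>degree A. coeff E m = 0)"
  using assms
proof (induction T)
  case empty
  then show ?case by (intro exI[of _ A] exI[of _ 0]) simp
next
  case (insert t T)
  let ?F = "\<Prod>k\<in>T. [:- r k, 1:]" and ?W = "monom 1 N :: complex poly"
  from insert obtain A' E where A: "A = ?F * A' + smult ?W E" and A': "lead_coeff A' = 1"
    "degree A' = degree A - card T" and E: "\<forall>m\<ge>degree A. coeff E m = 0"
    by (auto simp: inj_on_insert)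
  have "?W dvd poly ?F (r t) * poly A' (r t)"
  proof -
    have "poly ?F (r t) * poly A' (r t) = poly A (r t) - ?W * poly E (r t)"
      unfolding A by simp
    then show ?thesis using insert.prems(3)[of t] by (metis dvd_diff dvd_triv_left insertI1)
  qed
  moreover have "coeff (poly ?F (r t)) 0 \<noteq> 0"
  proof -
    have "coeff (poly ?F (r t)) 0 = (\<Prod>k\<in>T. coeff (r t) 0 - coeff (r k) 0)"
      unfolding poly_prod is_ring_hom_prod[OF is_ring_hom_coeff_0] by simp
    then show ?thesis
      using insert.prems(4) insert.hyps by (auto simp: inj_on_def)
  qed
  ultimately have "?W dvd poly A' (r t)" by (rule monom_dvd_cancel)
  then obtain g where g: "poly A' (r t) = ?W * g" by auto
  define Q where "Q = synthetic_div A' (r t)"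
  have A'Q: "A' = [:- r t, 1:] * Q + [:?W * g:]"
    using synthetic_div_correct'[of "r t" A'] g by (simp add: Q_def)
  have dA': "degree A' \<ge> 1" using A'(2) insert.prems(2) insert.hyps by simp
  have dQ: "degree Q = degree A' - 1" by (simp add: Q_def degree_synthetic_div)
  have "lead_coeff Q = coeff A' (Suc (degree Q))"
    by (subst A'Q) (simp add: coeff_eq_0)
  then have lQ: "lead_coeff Q = 1" using A'(1) dQ dA' by simp
  have "A = (\<Prod>k\<in>insert t T. [:- r k, 1:]) * Q + smult ?W (E + ?F * [:g:])"
  proof -
    have "(\<Prod>k\<in>insert t T. [:- r k, 1:]) * Q + smult ?W (E + ?F * [:g:])
        = ?F * ([:- r t, 1:] * Q + [:?W * g:]) + smult ?W E"
      using insert.hyps by (simp add: algebra_simps smult_add_right)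
    then show ?thesis using A A'Q by simp
  qed
  moreover have "\<forall>m\<ge>degree A. coeff (E + ?F * [:g:]) m = 0"
  proof (intro allI impI)
    fix m assume m: "degree A \<le> m"
    have "card T < degree A" using insert.prems(2) insert.hyps by simp
    then have "coeff ?F m = 0" using m degree_prod_linear[of "\<lambda>k. - r k" T] by (intro coeff_eq_0) simp
    then show "coeff (E + ?F * [:g:]) m = 0" using E m by simp
  qed
  moreover have "degree Q = degree A - card (insert t T)"
    using dQ A'(2) insert.hyps by simp
  ultimately show ?case using lQ by blast
qed

lemma subleading_coeff_prod_linear:
  fixes r :: "'i \<Rightarrow> 'a::idom"
  assumes "finite S" "S \<noteq> {}"
  shows "coeff (\<Prod>k\<in>S. [:- r k, 1:]) (card S - 1) = - (\<Sum>k\<in>S. r k)"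
  using assms
proof (induction rule: finite_ne_induct)
  case (insert i S)
  then obtain m where m: "card S = Suc m" by (metis card_gt_0_iff gr0_implies_Suc)
  have "coeff (\<Prod>k\<in>S. [:- r k, 1:]) (Suc m) = 1"
    using lead_coeff_prod_linear[of "\<lambda>k. - r k" S] m by simp
  then show ?case using insert m by simp
qed simp

lemma sum_of_approximate_roots:
  assumes fac: "spectral_factorization a c n S A B"
    and roots: "\<And>k. k \<in> S \<Longrightarrow> monom 1 N dvd poly A (r k)" "inj_on (\<lambda>k. coeff (r k) 0) S"
    and m: "2 \<le> m" "m < N"
  shows "(\<Sum>k\<in>S. coeff (r k) m) = 0"
proof -
  have A: "lead_coeff A = 1" "lead_coeff B = 1" "spectral_poly a c n = A * B" and S: "finite S" "S \<noteq> {}"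
    using fac finite_subset unfolding spectral_factorization_def by auto
  note deg = spectral_factorization_degree[OF fac]
  obtain A' E where AE: "A = (\<Prod>k\<in>S. [:- r k, 1:]) * A' + smult (monom 1 N) E"
    "lead_coeff A' = 1" "degree A' = 0"
    using approximate_linear_factors[OF S(1) A(1) _ roots] deg(1) by auto
  have "A' = 1" using AE(2,3) by (auto elim!: degree_eq_zeroE)
  have "coeff A (card S - 1) = - (\<Sum>k\<in>S. r k) + monom 1 N * coeff E (card S - 1)"
    by (subst AE(1)) (simp add: \<open>A' = 1\<close> subleading_coeff_prod_linear[OF S] del: One_nat_def)
  then have "coeff (coeff A (card S - 1)) m = - (\<Sum>k\<in>S. coeff (r k) m)"
    using m by (simp add: coeff_sum coeff_monom_mult)
  then show ?thesis
    using subleading_coeff_bound[OF A(3,1,2) _ m(1)] deg by simp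
qed

text \<open>Once all linear factors but one are split off, the cofactor is linear. The sum of all roots has no
  terms of order two or more, so the last root is determined up to its coefficient of \<open>w\<close>.\<close>

lemma remaining_approximate_root:
  assumes fac: "spectral_factorization a c n S A B" and i: "i \<in> S" and N: "N \<ge> 1"
    and roots: "\<And>k. k \<in> S - {i} \<Longrightarrow> monom 1 N dvd poly A (r k)"
    and r0: "\<And>k. k \<in> S - {i} \<Longrightarrow> coeff (r k) 0 = - a k" and inj: "inj_on a (S - {i})"
  shows "\<exists>\<rho>. monom 1 N dvd poly A \<rho> \<and> coeff \<rho> 0 = - a i \<and>
    (\<forall>m. 2 \<le> m \<longrightarrow> m < N \<longrightarrow> coeff \<rho> m = - (\<Sum>k\<in>S-{i}. coeff (r k) m))"
proof -
  have A: "lead_coeff A = 1" "lead_coeff B = 1" "spectral_poly a c n = A * B" and S: "finite S" "S \<noteq> {}"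
    using fac finite_subset unfolding spectral_factorization_def by auto
  note deg = spectral_factorization_degree[OF fac]
  have inj': "inj_on (\<lambda>k. coeff (r k) 0) (S - {i})"
    using inj r0 by (auto simp: inj_on_def)
  have "card (S - {i}) \<le> degree A" "degree A - card (S - {i}) = 1" using deg S i by auto
  then obtain A' E where AE: "A = (\<Prod>k\<in>S-{i}. [:- r k, 1:]) * A' + smult (monom 1 N) E"
    "lead_coeff A' = 1" "degree A' = 1"
    using approximate_linear_factors[OF _ A(1) _ roots inj'] S(1) by auto
  obtain \<rho>' where "A' = [:\<rho>', 1:]"
    using AE(2,3) by (cases A' rule: pCons_cases) (auto simp: degree_eq_zeroE elim!: degree_eq_zeroE split: if_splits)
  define \<rho> where "\<rho> = - \<rho>'"
  have A': "A' = [:- \<rho>, 1:]" using \<open>A' = [:\<rho>', 1:]\<close> by (simp add: \<rho>_def)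
  have "poly A \<rho> = monom 1 N * poly E \<rho>" by (subst AE(1)) (simp add: A')
  then have 1: "monom 1 N dvd poly A \<rho>" by simp
  define r' where "r' = (\<lambda>k. if k = i then \<rho> else r k)"
  have F: "(\<Prod>k\<in>S-{i}. [:- r k, 1:]) * A' = (\<Prod>k\<in>S. [:- r' k, 1:])"
  proof -
    have "(\<Prod>k\<in>S. [:- r' k, 1:]) = [:- r' i, 1:] * (\<Prod>k\<in>S-{i}. [:- r' k, 1:])"
      using S(1) i by (rule prod.remove)
    also have "(\<Prod>k\<in>S-{i}. [:- r' k, 1:]) = (\<Prod>k\<in>S-{i}. [:- r k, 1:])"
      by (intro prod.cong) (auto simp: r'_def)
    finally show ?thesis by (simp add: A' r'_def mult.commute)
  qed
  have "map_poly (\<lambda>q. coeff q 0) A = (\<Prod>k\<in>S. [:- coeff (r' k) 0, 1:])"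
    unfolding AE(1) F
    using N by (simp add: is_ring_homD(3,4)[OF is_ring_hom_map_poly[OF is_ring_hom_coeff_0]]
        is_ring_hom_prod[OF is_ring_hom_map_poly[OF is_ring_hom_coeff_0]] map_poly_pCons
        poly_eq_iff coeff_map_poly coeff_monom_mult)
  then have "(\<Prod>k\<in>S. [:- coeff (r' k) 0, 1:]) = (\<Prod>k\<in>S. [:a k, 1:])"
    using fac unfolding spectral_factorization_def by simp
  moreover have "(\<Prod>k\<in>S-{i}. [:- coeff (r' k) 0, 1:]) = (\<Prod>k\<in>S-{i}. [:a k, 1:])"
    by (intro prod.cong) (auto simp: r'_def r0)
  moreover have "(\<Prod>k\<in>S-{i}. [:a k, 1:]) \<noteq> 0" using S(1) by simp
  ultimately have "[:- coeff (r' i) 0, 1:] = [:a i, 1:]"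
    using prod.remove[OF S(1) i, of "\<lambda>k. [:- coeff (r' k) 0, 1:]"]
      prod.remove[OF S(1) i, of "\<lambda>k. [:a k, 1:]"] by (metis mult_right_cancel)
  then have 2: "coeff \<rho> 0 = - a i" by (simp add: r'_def) (metis minus_minus)
  have "coeff A (card S - 1) = - (\<Sum>k\<in>S. r' k) + monom 1 N * coeff E (card S - 1)"
    by (subst AE(1)) (simp add: F subleading_coeff_prod_linear[OF S] del: One_nat_def)
  then have "coeff (coeff A (card S - 1)) m = - (\<Sum>k\<in>S. coeff (r' k) m)" if "m < N" for m
    using that by (simp add: coeff_sum coeff_monom_mult)
  moreover have "(\<Sum>k\<in>S. coeff (r' k) m) = coeff \<rho> m + (\<Sum>k\<in>S-{i}. coeff (r k) m)" for m
  proof -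
    have "(\<Sum>k\<in>S-{i}. coeff (r' k) m) = (\<Sum>k\<in>S-{i}. coeff (r k) m)"
      by (intro sum.cong) (auto simp: r'_def)
    then show ?thesis using sum.remove[OF S(1) i, of "\<lambda>k. coeff (r' k) m"] by (simp add: r'_def)
  qed
  ultimately have 3: "coeff \<rho> m = - (\<Sum>k\<in>S-{i}. coeff (r k) m)" if "2 \<le> m" "m < N" for m
    using subleading_coeff_bound[OF A(3,1,2) _ that(1)] deg that by (simp add: add_eq_0_iff2) (metis minus_minus)
  show ?thesis using 1 2 3 by blast
qed

lemma coeff_0_poly: "coeff (poly B \<rho>) 0 = poly (map_poly (\<lambda>q. coeff q 0) B) (coeff \<rho> 0)"
  by (induction B) (simp_all add: map_poly_pCons coeff_mult_0)

text \<open>The other factor takes a unit value at the approximate root, since \<open>- a\<^sub>k\<close> is not one of its roots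
  at \<open>w = 0\<close>.\<close>

lemma approximate_root_of_factor:
  assumes fac: "spectral_factorization a c n S A B" and k: "k \<in> S"
    and simple: "\<And>l. l \<in> {1..n} - {k} \<Longrightarrow> a l \<noteq> a k"
    and root: "monom 1 N dvd poly (spectral_poly a c n) \<rho>" "coeff \<rho> 0 = - a k"
  shows "monom 1 N dvd poly A \<rho>"
proof -
  have "poly (map_poly (\<lambda>q. coeff q 0) B) (- a k) = coeff (poly B \<rho>) 0"
    by (simp add: coeff_0_poly root(2))
  moreover have "poly (map_poly (\<lambda>q. coeff q 0) B) (- a k) = (\<Prod>l\<in>{1..n}-S. a l - a k)"
    using fac unfolding spectral_factorization_def by (simp add: poly_prod)
  moreover have "\<dots> \<noteq> 0" using simple k by (auto simp: prod_zero_iff) metis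
  ultimately have "coeff (poly B \<rho>) 0 \<noteq> 0" by simp
  moreover have "monom 1 N dvd poly B \<rho> * poly A \<rho>"
    using root(1) fac unfolding spectral_factorization_def by (simp add: mult.commute)
  ultimately show ?thesis using monom_dvd_cancel by blast
qed

section \<open>Local expansions of the branches at \<open>w = 0\<close>\<close>

lemma continuant_rec:
  assumes "m \<ge> 1"
  shows "continuant x d m = x m * continuant x d (m - 1)
    - (if m = 1 then 0 else d (m - 1) * continuant x d (m - 2))"
proof (cases "m = 1")
  case False
  then obtain k where "m = Suc (Suc k)" using assms by (metis One_nat_def not0_implies_Suc not_one_le_zero)
  then show ?thesis by simp
qed simp

text \<open>The root near a simple node \<open>k\<close>, to second order in \<open>\<tau>\<close>. Formally it solves the continued fraction equation
  \<open>y = \<tau> c\<^sub>k / (\<delta>\<^sub>k\<^sub>+\<^sub>1 + y - \<tau> c\<^sub>k\<^sub>+\<^sub>1 / (\<delta>\<^sub>k\<^sub>+\<^sub>2 + \<dots>)) + \<tau> c\<^sub>k\<^sub>-\<^sub>1 / (\<delta>\<^sub>k\<^sub>-\<^sub>1 + y - \<dots>)\<close> with \<open>\<delta>\<^sub>l = a\<^sub>l - a\<^sub>k\<close>, and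
  \<open>\<alpha>\<close> and \<open>right2 + left2\<close> are read off from it. Here \<open>A l\<close>, \<open>C l\<close> and \<open>I l\<close> stand for \<open>\<delta>\<^sub>l\<close>,
  \<open>c\<^sub>l\<close> and \<open>1 / \<delta>\<^sub>l\<close>. The verification runs through the recursion from left to right: up to node \<open>k\<close> the
  left half of the fraction cancels, at the next two nodes the right half does, and from then on
  the continuants are divisible by \<open>\<tau>\<^sup>3\<close>.\<close>

lemma continuant_approximate_root:
  fixes A C I :: "nat \<Rightarrow> 'r::comm_ring_1" and \<tau> :: 'r
  assumes k: "1 \<le> k" "k \<le> n" and A: "A k = 0" "\<And>l. l \<in> {1..n} - {k} \<Longrightarrow> A l * I l = 1"
  defines "right \<equiv> (if k < n then C k * I (k + 1) else 0)"
    and "left \<equiv> (if 1 < k then C (k - 1) * I (k - 1) else 0)"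
  defines "\<alpha> \<equiv> right + left"
  defines "right2 \<equiv> right * I (k + 1) * ((if k + 1 < n then C (k + 1) * I (k + 2) else 0) - \<alpha>)"
    and "left2 \<equiv> left * I (k - 1) * ((if 2 < k then C (k - 2) * I (k - 2) else 0) - \<alpha>)"
  defines "Y \<equiv> \<tau> * \<alpha> + \<tau>^2 * (right2 + left2)"
  shows "\<tau>^3 dvd continuant (\<lambda>l. A l + Y) (\<lambda>l. \<tau> * C l) n"
proof -
  let ?K = "continuant (\<lambda>l. A l + Y) (\<lambda>l. \<tau> * C l)"
  let ?L = "?K (k - 1)"
  have split: "X - L * (\<tau> * right + \<tau>^2 * right2) = L * (\<tau> * left + \<tau>^2 * left2) - \<tau> * D"
    if "X = Y * L - \<tau> * D" for X L D
    unfolding that Y_def \<alpha>_def by (simp add: algebra_simps)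
  have witness: "\<exists>u. P = Q + R * u" if "P - Q = R * v" for P Q R v :: 'r
    using that by (intro exI[of _ v]) (simp add: diff_eq_eq add.commute)
  have Kk: "\<exists>u. ?K k = ?L * (\<tau> * right + \<tau>^2 * right2) + \<tau>^3 * u"
  proof -
    consider "k = 1" | "k = 2" | "k \<ge> 3" using k by linarith
    then show ?thesis
    proof cases
      case 1
      then show ?thesis
        by (intro exI[of _ 0]) (use A(1) in \<open>simp add: Y_def \<alpha>_def left_def left2_def 1\<close>)
    next
      case 2
      have inv: "A 1 * I 1 = 1" using A(2)[of 1] k 2 by simp
      have K: "?K k = Y * (A 1 + Y) - \<tau> * C 1" "?L = A 1 + Y"
        using 2 A by (simp_all add: numeral_2_eq_2)
      have lft: "left = C 1 * I 1" "left2 = left * I 1 * (- \<alpha>)"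
        using 2 by (simp_all add: left_def left2_def)
      define b where "b = right2 + left2"
      have Y: "Y = \<tau> * \<alpha> + \<tau>^2 * b" by (simp add: Y_def b_def)
      have cancel: "x * I 1 * A 1 = x" for x using inv by (metis mult.assoc mult.commute mult.right_neutral)
      have al: "left * A 1 = C 1" "left2 * A 1 = - left * \<alpha>"
        using cancel[of "C 1"] cancel[of "- left * \<alpha>"] by (simp_all add: lft mult_ac)
      have eq: "?K k - ?L * (\<tau> * right + \<tau>^2 * right2) = (A 1 + Y) * (\<tau> * left + \<tau>^2 * left2) - \<tau> * C 1"
        using split[of "?K k" "A 1 + Y" "C 1"] K by simp
      have "\<dots> = \<tau> * (left * A 1 - C 1) + \<tau>^2 * (left2 * A 1 + left * \<alpha>)
          + \<tau>^3 * (left2 * \<alpha> + left * b + \<tau> * b * left2)"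
        unfolding Y by (simp add: algebra_simps power2_eq_square power3_eq_cube)
      also have "\<dots> = \<tau>^3 * (left2 * \<alpha> + left * b + \<tau> * b * left2)"
        unfolding al by simp
      finally have "(A 1 + Y) * (\<tau> * left + \<tau>^2 * left2) - \<tau> * C 1
          = \<tau>^3 * (left2 * \<alpha> + left * b + \<tau> * b * left2)" .
      from witness[OF trans[OF eq this]] show ?thesis .
    next
      case 3
      define j where "j = k - 3"
      have kj: "k = Suc (Suc (Suc j))" using 3 by (simp add: j_def)
      have inv: "A (k - 1) * I (k - 1) = 1" "A (k - 2) * I (k - 2) = 1"
      proof -
        have "k - 1 \<in> {1..n} - {k}" "k - 2 \<in> {1..n} - {k}" using k 3 by auto
        then show "A (k - 1) * I (k - 1) = 1" "A (k - 2) * I (k - 2) = 1" using A(2) by blast+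
      qed
      define M where "M = ?K (k - 2)"
      define N where "N = ?K (k - 3)"
      define e where "e = C (k - 2) * I (k - 2)"
      define b where "b = right2 + left2"
      have Y: "Y = \<tau> * \<alpha> + \<tau>^2 * b" by (simp add: Y_def b_def)
      have K: "?K k = Y * ?L - \<tau> * C (k - 1) * M"
        using continuant_rec[of k "\<lambda>l. A l + Y" "\<lambda>l. \<tau> * C l"] 3 A(1) by (simp add: M_def)
      have L: "?L = (A (k - 1) + Y) * M - \<tau> * C (k - 2) * N"
        using continuant_rec[of "k - 1" "\<lambda>l. A l + Y" "\<lambda>l. \<tau> * C l"] 3
        by (simp add: M_def N_def kj numeral_3_eq_3 numeral_2_eq_2)
      have "\<exists>v. M = A (k - 2) * N + \<tau> * v"
      proof -
        have "M = (A (k - 2) + Y) * N - (if k - 2 = 1 then 0 else \<tau> * C (k - 3) * ?K (k - 4))"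
          using continuant_rec[of "k - 2" "\<lambda>l. A l + Y" "\<lambda>l. \<tau> * C l"] 3
          by (simp add: M_def N_def kj numeral_3_eq_3 numeral_2_eq_2 eval_nat_numeral)
        moreover define R where "R = (if k - 2 = 1 then 0 else C (k - 3) * ?K (k - 4))"
        ultimately have "M = (A (k - 2) + Y) * N - \<tau> * R" by (simp split: if_splits)
        also have "\<dots> = A (k - 2) * N + \<tau> * ((\<alpha> + \<tau> * b) * N - R)"
          by (subst Y) (simp add: algebra_simps power2_eq_square)
        finally have "M = A (k - 2) * N + \<tau> * ((\<alpha> + \<tau> * b) * N - R)" .
        then show ?thesis by blast
      qed
      then obtain v where v: "M = A (k - 2) * N + \<tau> * v" by blast
      have lft: "left = C (k - 1) * I (k - 1)" "left2 = left * I (k - 1) * (e - \<alpha>)"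
        using 3 by (simp_all add: left_def left2_def e_def)
      have cancel: "x * I (k - 1) * A (k - 1) = x" "x * I (k - 2) * A (k - 2) = x" for x
        using inv by (metis mult.assoc mult.commute mult.right_neutral)+
      have al: "left * A (k - 1) = C (k - 1)" "left2 * A (k - 1) = left * (e - \<alpha>)" "e * A (k - 2) = C (k - 2)"
        using cancel(1)[of "C (k - 1)"] cancel(1)[of "left * (e - \<alpha>)"] cancel(2)[of "C (k - 2)"]
        by (simp_all add: lft e_def mult_ac)
      have L': "?L = (A (k - 1) + Y) * M - \<tau> * e * (M - \<tau> * v)"
      proof -
        have "\<tau> * e * (M - \<tau> * v) = \<tau> * (e * A (k - 2)) * N" unfolding v by (simp add: mult_ac)
        then show ?thesis unfolding L al(3) by simp
      qed
      have eq: "?K k - ?L * (\<tau> * right + \<tau>^2 * right2) = ?L * (\<tau> * left + \<tau>^2 * left2) - \<tau> * C (k - 1) * M"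
        using split[of "?K k" ?L "C (k - 1) * M"] K by (simp add: mult.assoc)
      have "X * (\<tau> * left + \<tau>^2 * left2) - \<tau> * C (k - 1) * M = \<tau>^3 * (left * (b * M + e * v) + left2 * (\<alpha> - e) * M + \<tau> * left2 * (b * M + e * v))"
        if X: "X = (A (k - 1) + Y) * M - \<tau> * e * (M - \<tau> * v)" for X
      proof -
        have "X * (\<tau> * left + \<tau>^2 * left2) - \<tau> * C (k - 1) * M
          = \<tau> * M * (left * A (k - 1) - C (k - 1)) + \<tau>^2 * M * (left2 * A (k - 1) - left * (e - \<alpha>))
            + \<tau>^3 * (left * (b * M + e * v) + left2 * (\<alpha> - e) * M + \<tau> * left2 * (b * M + e * v))"
          unfolding X Y by (simp add: algebra_simps power2_eq_square power3_eq_cube)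
        then show ?thesis unfolding al by simp
      qed
      note this[OF L']
      from witness[OF trans[OF eq this]] show ?thesis .
    qed
  qed
  then obtain u where u: "?K k = ?L * (\<tau> * right + \<tau>^2 * right2) + \<tau>^3 * u" by blast
  define E where "E = (if k + 1 < n then C (k + 1) * I (k + 2) else 0)"
  define b where "b = right2 + left2"
  have Y: "Y = \<tau> * \<alpha> + \<tau>^2 * b" by (simp add: Y_def b_def)
  have K1: "\<exists>u. ?K (k + 1) = \<tau>^2 * (?L * right * E) + \<tau>^3 * u" if "k < n"
  proof -
    have inv: "A (k + 1) * I (k + 1) = 1" using A(2)[of "k + 1"] that by simp
    have r: "right = C k * I (k + 1)" "right2 = right * I (k + 1) * (E - \<alpha>)"
      using that by (simp_all add: right_def right2_def E_def)
    have cancel: "x * I (k + 1) * A (k + 1) = x" for x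
      using inv by (metis mult.assoc mult.commute mult.right_neutral)
    have al: "right * A (k + 1) = C k" "right2 * A (k + 1) = right * (E - \<alpha>)"
      using cancel[of "C k"] cancel[of "right * (E - \<alpha>)"] by (simp_all add: r mult_ac)
    have "?K (k + 1) = (A (k + 1) + Y) * ?K k - \<tau> * C k * ?L"
      using continuant_rec[of "k + 1" "\<lambda>l. A l + Y" "\<lambda>l. \<tau> * C l"] k by simp
    also have "\<dots> = \<tau>^2 * (?L * right * E)
        + \<tau>^3 * (?L * (right2 * \<alpha> + right * b + \<tau> * right2 * b) + (A (k + 1) + Y) * u)"
    proof -
      have "(A (k + 1) + Y) * X - \<tau> * C k * L = \<tau>^2 * (L * right * E)
          + \<tau>^3 * (L * (right2 * \<alpha> + right * b + \<tau> * right2 * b) + (A (k + 1) + Y) * u)"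
        if X: "X = L * (\<tau> * right + \<tau>^2 * right2) + \<tau>^3 * u" for X L
      proof -
        have "(A (k + 1) + Y) * X - \<tau> * C k * L = \<tau> * L * (right * A (k + 1) - C k)
            + \<tau>^2 * L * (right2 * A (k + 1) - right * (E - \<alpha>)) + \<tau>^2 * (L * right * E)
            + \<tau>^3 * (L * (right2 * \<alpha> + right * b + \<tau> * right2 * b) + (A (k + 1) + Y) * u)"
          unfolding X Y by (simp add: algebra_simps power2_eq_square power3_eq_cube)
        then show ?thesis unfolding al by simp
      qed
      from this[OF u] show ?thesis .
    qed
    finally show ?thesis by blast
  qed
  have K2: "\<tau>^3 dvd ?K (k + 2) \<and> \<tau>^2 dvd ?K (k + 1)" if kn: "k + 1 < n"
  proof -
    have inv: "A (k + 2) * I (k + 2) = 1" using A(2)[of "k + 2"] kn by simp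
    have E: "E * A (k + 2) = C (k + 1)" using kn inv unfolding E_def by (simp add: mult.assoc mult.commute[of "I _"])
    obtain v where v: "?K (k + 1) = \<tau>^2 * (?L * right * E) + \<tau>^3 * v" using K1 kn by auto
    have "?K (k + 2) = (A (k + 2) + Y) * ?K (k + 1) - \<tau> * C (k + 1) * ?K k"
      using continuant_rec[of "k + 2" "\<lambda>l. A l + Y" "\<lambda>l. \<tau> * C l"] k by simp
    also have "\<dots> = \<tau>^3 * ((\<alpha> + \<tau> * b) * ?L * right * E + (A (k + 2) + Y) * v
        - C (k + 1) * (?L * right2 + \<tau> * u))"
    proof -
      have "(A (k + 2) + Y) * Z - \<tau> * C (k + 1) * X
          = \<tau>^3 * ((\<alpha> + \<tau> * b) * L * right * E + (A (k + 2) + Y) * v - C (k + 1) * (L * right2 + \<tau> * u))"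
        if X: "X = L * (\<tau> * right + \<tau>^2 * right2) + \<tau>^3 * u"
          and Z: "Z = \<tau>^2 * (L * right * E) + \<tau>^3 * v" for X Z L
      proof -
        have "(A (k + 2) + Y) * Z - \<tau> * C (k + 1) * X = \<tau>^2 * (L * right * (E * A (k + 2) - C (k + 1)))
          + \<tau>^3 * ((\<alpha> + \<tau> * b) * L * right * E + (A (k + 2) + Y) * v - C (k + 1) * (L * right2 + \<tau> * u))"
          unfolding X Z Y by (simp add: algebra_simps power2_eq_square power3_eq_cube)
        then show ?thesis unfolding E by simp
      qed
      from this[OF u v] show ?thesis .
    qed
    finally have "\<tau>^3 dvd ?K (k + 2)" by simp
    moreover have "?K (k + 1) = \<tau>^2 * (?L * right * E + \<tau> * v)"
      unfolding v by (simp add: algebra_simps power2_eq_square power3_eq_cube)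
    ultimately show ?thesis by (metis dvd_triv_left)
  qed
  have rest: "\<tau>^3 dvd ?K (k + 2 + m) \<and> \<tau>^2 dvd ?K (k + 1 + m)" if "k + 1 < n" for m
  proof (induction m)
    case 0
    then show ?case using K2 that by simp
  next
    case (Suc m)
    have "?K (k + 2 + Suc m) = (A (k + 2 + Suc m) + Y) * ?K (k + 2 + m) - \<tau> * C (k + 2 + m) * ?K (k + 1 + m)"
      using continuant_rec[of "k + 2 + Suc m" "\<lambda>l. A l + Y" "\<lambda>l. \<tau> * C l"] by simp
    moreover have "\<tau>^3 dvd \<tau> * C (k + 2 + m) * ?K (k + 1 + m)"
    proof -
      obtain q where "?K (k + 1 + m) = \<tau>^2 * q" using Suc.IH by blast
      then have "\<tau> * C (k + 2 + m) * ?K (k + 1 + m) = \<tau>^3 * (C (k + 2 + m) * q)"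
        by (simp only: power2_eq_square power3_eq_cube mult_ac)
      then show ?thesis by simp
    qed
    ultimately have "\<tau>^3 dvd ?K (k + 2 + Suc m)" using Suc.IH by (simp add: dvd_diff)
    moreover have "\<tau>^2 dvd ?K (k + 1 + Suc m)"
    proof -
      have "\<tau>^2 dvd \<tau>^3" by (rule le_imp_power_dvd) simp
      then have "\<tau>^2 dvd ?K (k + 2 + m)" using Suc.IH dvd_trans by blast
      moreover have "k + 2 + m = k + 1 + Suc m" by simp
      ultimately show ?thesis by simp
    qed
    ultimately show ?case by simp
  qed
  consider "k = n" | "k + 1 = n" | "k + 1 < n" using k by linarith
  then show ?thesis
  proof cases
    case 1
    then have "right = 0" "right2 = 0" by (simp_all add: right_def right2_def)
    then show ?thesis using u 1 by simp
  next
    case 2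
    then have "E = 0" by (simp add: E_def)
    then show ?thesis using K1 2 by auto
  next
    case 3
    then have "k + 2 + (n - (k + 2)) = n" by simp
    then show ?thesis using rest[OF 3, of "n - (k + 2)"] by (simp only:)
  qed
qed

text \<open>The edge between the nodes \<open>k\<close> and \<open>k + 1\<close> moves the roots at its two ends by \<open>\<plusminus> slope n a c k\<close> times
  \<open>w\<^sup>2\<close>. The values outside \<open>1, \<dots>, n - 1\<close> are zero, so that the two end nodes need no separate formulas.\<close>

definition slope :: "nat \<Rightarrow> (nat \<Rightarrow> complex) \<Rightarrow> (nat \<Rightarrow> complex) \<Rightarrow> nat \<Rightarrow> complex" where
  "slope n a c k = (if 1 \<le> k \<and> k < n then c k / (a (k + 1) - a k) else 0)"

text \<open>The coefficients of \<open>w\<^sup>2\<close> and \<open>w\<^sup>4\<close> in the branch at node \<open>k\<close>, in terms of the slopes \<open>z\<close>. The truncated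
  differences \<open>k - 1\<close> and \<open>k - 2\<close> are harmless, since \<open>z 0 = 0\<close>.\<close>

definition branch_coeff1 :: "(nat \<Rightarrow> complex) \<Rightarrow> nat \<Rightarrow> complex" where
  "branch_coeff1 z k = z k - z (k - 1)"

definition branch_coeff2 :: "(nat \<Rightarrow> complex) \<Rightarrow> (nat \<Rightarrow> complex) \<Rightarrow> nat \<Rightarrow> complex" where
  "branch_coeff2 a z k =
     - branch_coeff1 z k * (z k / (a (k + 1) - a k) + z (k - 1) / (a k - a (k - 1)))
     + z k * z (k + 1) * (a (k + 2) - a (k + 1)) / ((a (k + 1) - a k) * (a (k + 2) - a k))
     - z (k - 1) * z (k - 2) * (a (k - 1) - a (k - 2)) / ((a k - a (k - 1)) * (a k - a (k - 2)))"

lemma slope_mult: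
  assumes "1 \<le> k" "k < n" "a (k + 1) \<noteq> a k"
  shows "c k = slope n a c k * (a (k + 1) - a k)"
  using assms by (simp add: slope_def)

text \<open>The formula for the second coefficient divides by all differences of nearby diagonal entries, whereas
  the first one only needs node \<open>k\<close> to be simple.\<close>

lemma spectral_poly_approximate_root:
  assumes k: "k \<in> {1..n}" and simple: "\<And>l. l \<in> {1..n} - {k} \<Longrightarrow> a l \<noteq> a k"
    and z: "z = slope n a c"
  shows "\<exists>\<beta>. monom 1 6 dvd poly (spectral_poly a c n) [:- a k, 0, branch_coeff1 z k, 0, \<beta>:] \<and>
    (inj_on a {1..n} \<longrightarrow> \<beta> = branch_coeff2 a z k)"
proof -
  define right where "right = (if k < n then c k * (1 / (a (k + 1) - a k)) else 0)"
  define left where "left = (if 1 < k then c (k - 1) * (1 / (a (k - 1) - a k)) else 0)"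
  define right2 where "right2 = right * (1 / (a (k + 1) - a k)) *
    ((if k + 1 < n then c (k + 1) * (1 / (a (k + 2) - a k)) else 0) - (right + left))"
  define left2 where "left2 = left * (1 / (a (k - 1) - a k)) *
    ((if 2 < k then c (k - 2) * (1 / (a (k - 2) - a k)) else 0) - (right + left))"
  have r: "right = z k" using k by (simp add: right_def z slope_def)
  have l: "left = - z (k - 1)"
  proof (cases "1 < k")
    case True
    then have "k - 1 \<in> {1..n} - {k}" using k by auto
    then have "a (k - 1) \<noteq> a k" "k - 1 + 1 = k" "k - 1 < n" "1 \<le> k - 1" using simple True k by auto
    then show ?thesis using True by (simp add: left_def z slope_def field_simps)
  next
    case False
    then show ?thesis using k by (simp add: left_def z slope_def)
  qed
  have \<alpha>: "right + left = branch_coeff1 z k" by (simp add: r l branch_coeff1_def)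
  have \<beta>: "right2 + left2 = branch_coeff2 a z k" if inj: "inj_on a {1..n}"
  proof -
    have ne: "a l \<noteq> a m" if "l \<in> {1..n}" "m \<in> {1..n}" "l \<noteq> m" for l m
      using that inj by (meson inj_onD)
    have r2: "right2 = - branch_coeff1 z k * (z k / (a (k + 1) - a k))
       + z k * z (k + 1) * (a (k + 2) - a (k + 1)) / ((a (k + 1) - a k) * (a (k + 2) - a k))"
    proof (cases "k + 1 < n")
      case True
      have "c (k + 1) = z (k + 1) * (a (k + 2) - a (k + 1))"
        using slope_mult[of "k + 1" n a c] ne[of "k + 2" "k + 1"] True by (simp add: z)
      then show ?thesis
        using True unfolding right2_def \<alpha> unfolding r by (simp add: ring_distribs diff_divide_distrib mult_ac)
    next
      case False
      then have "z (k + 1) = 0" by (simp add: z slope_def)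
      then show ?thesis using False unfolding right2_def \<alpha> unfolding r by simp
    qed
    have flip: "x / (p - q) = - (x / (q - p))" for x p q :: complex
      by (metis minus_diff_eq minus_divide_right)
    have l2: "left2 = - branch_coeff1 z k * (z (k - 1) / (a k - a (k - 1)))
       - z (k - 1) * z (k - 2) * (a (k - 1) - a (k - 2)) / ((a k - a (k - 1)) * (a k - a (k - 2)))"
    proof (cases "2 < k")
      case True
      have "c (k - 2) = z (k - 2) * (a (k - 1) - a (k - 2))"
      proof -
        have "k - 2 + 1 = k - 1" using True by simp
        then show ?thesis
          using slope_mult[of "k - 2" n a c] ne[of "k - 1" "k - 2"] True k by (simp add: z)
      qed
      then show ?thesis
        using True unfolding left2_def \<alpha> unfolding l flip[of _ "a (k - 1)" "a k"] flip[of _ "a (k - 2)" "a k"]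
        by (simp add: ring_distribs diff_divide_distrib mult_ac)
    next
      case False
      then have "z (k - 2) = 0" by (simp add: z slope_def)
      then show ?thesis using False unfolding left2_def \<alpha> unfolding l flip[of _ "a (k - 1)" "a k"] by simp
    qed
    show ?thesis
      unfolding r2 l2 branch_coeff2_def by (simp add: algebra_simps)
  qed
  let ?A = "\<lambda>l. [:a l - a k:]" and ?I = "\<lambda>l. [:1 / (a l - a k):]" and ?C = "\<lambda>l. [:c l:]"
  let ?\<tau> = "[:0, 0, 1:] :: complex poly"
  have conv: "(if k < n then ?C k * ?I (k + 1) else 0) = [:right:]"
    "(if 1 < k then ?C (k - 1) * ?I (k - 1) else 0) = [:left:]"
    "(if k + 1 < n then ?C (k + 1) * ?I (k + 2) else 0) = [:if k + 1 < n then c (k + 1) * (1 / (a (k + 2) - a k)) else 0:]"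
    "(if 2 < k then ?C (k - 2) * ?I (k - 2) else 0) = [:if 2 < k then c (k - 2) * (1 / (a (k - 2) - a k)) else 0:]"
    by (simp_all add: right_def left_def)
  have conv2: "[:right:] * ?I (k + 1) * ([:if k + 1 < n then c (k + 1) * (1 / (a (k + 2) - a k)) else 0:]
      - ([:right:] + [:left:])) = [:right2:]"
    "[:left:] * ?I (k - 1) * ([:if 2 < k then c (k - 2) * (1 / (a (k - 2) - a k)) else 0:]
      - ([:right:] + [:left:])) = [:left2:]"
    by (simp_all add: right2_def left2_def)
  have k': "1 \<le> k" "k \<le> n" using k by simp_all
  have "?A k = 0" "\<And>l. l \<in> {1..n} - {k} \<Longrightarrow> ?A l * ?I l = 1"
    using simple by (auto simp: one_pCons)
  from continuant_approximate_root[of k n ?A ?I ?\<tau> ?C, OF k' this, unfolded conv conv2]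
  have "?\<tau>^3 dvd continuant (\<lambda>l. ?A l + (?\<tau> * ([:right:] + [:left:]) + ?\<tau>^2 * ([:right2:] + [:left2:])))
      (\<lambda>l. ?\<tau> * ?C l) n"
    .
  moreover have "(\<lambda>l. ?A l + (?\<tau> * ([:right:] + [:left:]) + ?\<tau>^2 * ([:right2:] + [:left2:])))
      = (\<lambda>l. [:a l:] + [:- a k, 0, branch_coeff1 z k, 0, right2 + left2:])"
    by (simp add: \<alpha>[symmetric] power2_eq_square)
  moreover have "(\<lambda>l. ?\<tau> * ?C l) = (\<lambda>l. [:0, 0, c l:])" by simp
  moreover have "?\<tau>^3 = monom 1 6"
    by (simp add: monom_altdef eval_nat_numeral)
  ultimately show ?thesis
    using \<beta> by (intro exI[of _ "right2 + left2"]) (simp add: poly_spectral_poly)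
qed

text \<open>This means \<open>x = e w\<^sup>d + O(w\<^sup>d\<^sup>+\<^sup>1)\<close>, where \<open>e\<close> may be zero.\<close>

definition leading_term :: "nat \<Rightarrow> complex \<Rightarrow> complex poly \<Rightarrow> bool" where
  "leading_term d e x \<longleftrightarrow> (\<forall>m<d. coeff x m = 0) \<and> coeff x d = e"

lemma leading_term_iff: "leading_term d e x \<longleftrightarrow> (\<exists>u. x = monom 1 d * u \<and> coeff u 0 = e)"
proof
  assume *: "leading_term d e x"
  then have "monom 1 d dvd x" by (simp add: monom_1_dvd_iff' leading_term_def)
  then obtain u where "x = monom 1 d * u" by auto
  moreover have "coeff u 0 = e" using * calculation by (simp add: leading_term_def coeff_monom_mult)
  ultimately show "\<exists>u. x = monom 1 d * u \<and> coeff u 0 = e" by blast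
qed (auto simp: leading_term_def coeff_monom_mult)

lemma leading_term_mult:
  assumes "leading_term d e x" "leading_term d' e' y"
  shows "leading_term (d + d') (e * e') (x * y)"
proof -
  obtain u v where "x = monom 1 d * u" "coeff u 0 = e" "y = monom 1 d' * v" "coeff v 0 = e'"
    using assms unfolding leading_term_iff by blast
  then have "x * y = monom 1 (d + d') * (u * v)" "coeff (u * v) 0 = e * e'"
    by (simp_all add: coeff_mult_0 mult_monom mult_ac flip: mult.assoc)
  then show ?thesis unfolding leading_term_iff by blast
qed

lemma leading_term_diff:
  "leading_term d e x \<Longrightarrow> leading_term d e' y \<Longrightarrow> leading_term d (e - e') (x - y)"
  by (simp add: leading_term_def)

lemma leading_term_lower: "leading_term d e x \<Longrightarrow> d' < d \<Longrightarrow> leading_term d' 0 x"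
  by (simp add: leading_term_def)

section \<open>Necessary conditions for a factorization\<close>

text \<open>If all nodes of \<open>S\<close> are simple, all roots of \<open>A\<close> are known to order \<open>w\<^sup>6\<close>, and their sum has degree at
  most one in \<open>w\<close>.\<close>

lemma branch_sums_vanish:
  assumes fac: "spectral_factorization a c n S A B"
    and simple: "\<And>k l. k \<in> S \<Longrightarrow> l \<in> {1..n} - {k} \<Longrightarrow> a l \<noteq> a k"
    and z: "z = slope n a c"
  shows "(\<Sum>k\<in>S. branch_coeff1 z k) = 0"
    and "inj_on a {1..n} \<Longrightarrow> (\<Sum>k\<in>S. branch_coeff2 a z k) = 0"
proof -
  have S: "S \<subseteq> {1..n}" using fac by (simp add: spectral_factorization_def)
  have "\<exists>\<beta>. monom 1 6 dvd poly (spectral_poly a c n) [:- a k, 0, branch_coeff1 z k, 0, \<beta>:] \<and>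
      (inj_on a {1..n} \<longrightarrow> \<beta> = branch_coeff2 a z k)" if "k \<in> S" for k
    using that S simple by (intro spectral_poly_approximate_root z) auto
  then obtain \<beta> where \<beta>: "\<And>k. k \<in> S \<Longrightarrow>
      monom 1 6 dvd poly (spectral_poly a c n) [:- a k, 0, branch_coeff1 z k, 0, \<beta> k:]"
      "\<And>k. k \<in> S \<Longrightarrow> inj_on a {1..n} \<Longrightarrow> \<beta> k = branch_coeff2 a z k"
    by metis
  define r where "r = (\<lambda>k. [:- a k, 0, branch_coeff1 z k, 0, \<beta> k:])"
  have root: "monom 1 6 dvd poly A (r k)" if "k \<in> S" for k
    unfolding r_def using approximate_root_of_factor[OF fac that simple[OF that] \<beta>(1)[OF that]] by simp
  have inj: "inj_on (\<lambda>k. coeff (r k) 0) S"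
    unfolding r_def inj_on_def using simple S by (auto, metis DiffI empty_iff insert_iff atLeastAtMost_iff subsetD)
  have sum: "(\<Sum>k\<in>S. coeff (r k) m) = 0" if "2 \<le> m" "m < 6" for m
    using sum_of_approximate_roots[OF fac root inj that] by simp
  show "(\<Sum>k\<in>S. branch_coeff1 z k) = 0"
    using sum[of 2] by (simp add: r_def numeral_2_eq_2)
  show "(\<Sum>k\<in>S. branch_coeff2 a z k) = 0" if "inj_on a {1..n}"
    using sum[of 4] \<beta>(2)[OF _ that] by (simp add: r_def eval_nat_numeral)
qed

lemma leading_term_zero: "leading_term d 0 0"
  by (simp add: leading_term_def)

lemma leading_term_edge: "leading_term 2 e [:0, 0, e:]"
  by (auto simp: leading_term_def numeral_2_eq_2 less_Suc_eq)

lemma leading_term_unique: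
  "leading_term d e x \<Longrightarrow> monom 1 N dvd x \<Longrightarrow> d < N \<Longrightarrow> e = 0"
  by (auto simp: leading_term_def monom_1_dvd_iff')

lemma leading_term_cong: "leading_term d e x \<Longrightarrow> e = e' \<Longrightarrow> leading_term d e' x"
  by simp

text \<open>A double node \<open>a\<^sub>i = a\<^sub>j\<close>. The leading terms of the continuants at \<open>\<lambda> = \<rho>(w)\<close> are followed from the
  left; every passage of \<open>i\<close> or \<open>j\<close> raises their order.\<close>

context
  fixes a c :: "nat \<Rightarrow> complex" and n i j :: nat and \<rho> :: "complex poly"
  assumes ij: "1 \<le> i" "i < j" "j \<le> n" and aij: "a j = a i" and \<rho>0: "coeff \<rho> 0 = - a i"
begin

abbreviation K where "K \<equiv> continuant (\<lambda>l. [:a l:] + \<rho>) (\<lambda>l. [:0, 0, c l:])"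

text \<open>The value at \<open>w = 0\<close> of the product of the factors of all nodes up to \<open>m\<close> other than \<open>i\<close> and \<open>j\<close>.\<close>

definition node_product where "node_product m = (\<Prod>l\<in>{1..m} - {i, j}. a l - a i)"

lemma node_product_Suc: "node_product (Suc m) = (if Suc m \<in> {i, j} then 1 else a (Suc m) - a i) * node_product m"
proof -
  have "{1..Suc m} - {i, j} = (if Suc m \<in> {i, j} then {1..m} - {i, j} else insert (Suc m) ({1..m} - {i, j}))"
    by (auto simp: atLeastAtMostSuc_conv)
  then show ?thesis by (auto simp: node_product_def)
qed

lemma node_product_pred: "m \<ge> 1 \<Longrightarrow> node_product m = (if m \<in> {i, j} then 1 else a m - a i) * node_product (m - 1)"
  using node_product_Suc[of "m - 1"] by simp

lemma node_product_nonzero: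
  assumes "\<And>l. l \<in> {1..n} - {i, j} \<Longrightarrow> a l \<noteq> a i"
  shows "node_product n \<noteq> 0"
  using assms by (auto simp: node_product_def)

lemma node_lead: "leading_term 0 (a m - a i) ([:a m:] + \<rho>)"
  using \<rho>0 by (simp add: leading_term_def)

lemma double_node_lead: "m = i \<or> m = j \<Longrightarrow> leading_term 1 (coeff \<rho> 1) ([:a m:] + \<rho>)"
  using \<rho>0 aij by (auto simp: leading_term_def)

lemma edge_lead:
  assumes "m \<ge> 1" "m > 1 \<Longrightarrow> leading_term d e (K (m - 2))" "d' \<le> d + 1"
  shows "leading_term d' 0 (if m = 1 then 0 else [:0, 0, c (m - 1):] * K (m - 2))"
proof (cases "m = 1")
  case False
  then have "leading_term (2 + d) (c (m - 1) * e) ([:0, 0, c (m - 1):] * K (m - 2))"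
    using assms by (intro leading_term_mult leading_term_edge) auto
  then have "leading_term d' 0 ([:0, 0, c (m - 1):] * K (m - 2))"
    by (rule leading_term_lower) (use assms(3) in simp)
  then show ?thesis using False by simp
qed (simp add: leading_term_zero)

text \<open>For adjacent \<open>i\<close> and \<open>j\<close> the two nodes are coupled at first order in \<open>w\<close>, and the branches start
  with \<open>\<plusminus> w \<surd>c\<^sub>i\<close>; otherwise they have no linear term.\<close>

lemma double_branch_order_two:
  shows "m < i \<Longrightarrow> leading_term 0 (node_product m) (K m)"
    and "i \<le> m \<Longrightarrow> m < j \<Longrightarrow> leading_term 1 (coeff \<rho> 1 * node_product m) (K m)"
    and "j \<le> m \<Longrightarrow> leading_term 2 ((coeff \<rho> 1 ^ 2 - (if j = i + 1 then c i else 0)) * node_product m) (K m)"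
proof -
  let ?r = "coeff \<rho> 1"
  let ?q = "?r ^ 2 - (if j = i + 1 then c i else 0)"
  let ?D = "\<lambda>m. if m = 1 then 0 else [:0, 0, c (m - 1):] * K (m - 2)"
  have any: "leading_term 0 (coeff (K m) 0) (K m)" for m by (simp add: leading_term_def)
  have "(m < i \<longrightarrow> leading_term 0 (node_product m) (K m)) \<and>
    (i \<le> m \<and> m < j \<longrightarrow> leading_term 1 (?r * node_product m) (K m)) \<and>
    (j \<le> m \<longrightarrow> leading_term 2 (?q * node_product m) (K m))"
  proof (induction m rule: less_induct)
    case (less m)
    show ?case
    proof (cases "m = 0")
      case True
      then show ?thesis using ij by (simp add: node_product_def leading_term_def)
    next
      case False
      then have m: "m \<ge> 1" "m - 1 < m" by auto
      have rec: "K m = ([:a m:] + \<rho>) * K (m - 1) - ?D m" by (rule continuant_rec[OF m(1)])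
      note IH = less.IH[OF m(2)]
      consider "m < i" | "m = i" | "i < m" "m < j" | "m = j" | "j < m" by linarith
      then show ?thesis
      proof cases
        case 1
        have main: "leading_term (0 + 0) ((a m - a i) * node_product (m - 1)) (([:a m:] + \<rho>) * K (m - 1))"
          using IH 1 by (intro leading_term_mult node_lead) auto
        have D: "leading_term 0 0 (?D m)" by (rule edge_lead[OF m(1) any]) simp
        have "leading_term 0 ((a m - a i) * node_product (m - 1) - 0) (K m)"
          unfolding rec by (rule leading_term_diff[OF main[unfolded add_0] D])
        then show ?thesis using 1 ij node_product_pred[OF m(1)] by simp
      next
        case 2
        have main: "leading_term (1 + 0) (?r * node_product (m - 1)) (([:a m:] + \<rho>) * K (m - 1))"
          using IH 2 m by (intro leading_term_mult double_node_lead) auto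
        have D: "leading_term 1 0 (?D m)" by (rule edge_lead[OF m(1) any]) simp
        have "leading_term 1 (?r * node_product (m - 1) - 0) (K m)"
          unfolding rec by (rule leading_term_diff[OF main[unfolded add_0_right] D])
        then show ?thesis using 2 ij node_product_pred[OF m(1)] by simp
      next
        case 3
        have main: "leading_term (0 + 1) ((a m - a i) * (?r * node_product (m - 1))) (([:a m:] + \<rho>) * K (m - 1))"
          using IH 3 by (intro leading_term_mult node_lead) auto
        have D: "leading_term 1 0 (?D m)" by (rule edge_lead[OF m(1) any]) simp
        have "leading_term 1 ((a m - a i) * (?r * node_product (m - 1)) - 0) (K m)"
          unfolding rec by (rule leading_term_diff[OF main[unfolded add_0] D])
        then show ?thesis using 3 ij node_product_pred[OF m(1)] by (simp add: mult_ac)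
      next
        case 4
        have "leading_term (1 + 1) (?r * (?r * node_product (m - 1))) (([:a m:] + \<rho>) * K (m - 1))"
          using IH 4 ij by (intro leading_term_mult double_node_lead) auto
        then have main: "leading_term 2 (?r * (?r * node_product (m - 1))) (([:a m:] + \<rho>) * K (m - 1))"
          by (simp add: numeral_2_eq_2)
        have D: "leading_term 2 ((if j = i + 1 then c i else 0) * node_product (m - 1)) (?D m)"
        proof (cases "j = i + 1")
          case True
          have e: "m - 2 = i - 1" "m - 1 = i" "m \<noteq> 1" using True 4 ij by auto
          have "leading_term (2 + 0) (c i * node_product (i - 1)) ([:0, 0, c i:] * K (i - 1))"
            using less.IH[of "i - 1"] ij 4 by (intro leading_term_mult leading_term_edge) auto
          moreover have "node_product i = node_product (i - 1)" using node_product_pred[of i] ij by simp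
          ultimately show ?thesis using True e by simp
        next
          case False
          have "leading_term 1 (?r * node_product (m - 2)) (K (m - 2))"
            using less.IH[of "m - 2"] False 4 ij by auto
          then show ?thesis using edge_lead[OF m(1), of 1 _ 2] False by simp
        qed
        have "leading_term 2 (?r * (?r * node_product (m - 1)) - (if j = i + 1 then c i else 0) * node_product (m - 1)) (K m)"
          unfolding rec by (rule leading_term_diff[OF main D])
        moreover have "node_product m = node_product (m - 1)" using node_product_pred[OF m(1)] 4 by simp
        ultimately show ?thesis using 4 ij by (simp add: algebra_simps power2_eq_square split: if_splits)
      next
        case 5
        have main: "leading_term (0 + 2) ((a m - a i) * (?q * node_product (m - 1))) (([:a m:] + \<rho>) * K (m - 1))"
          using IH 5 by (intro leading_term_mult node_lead) auto
        have "leading_term 1 (coeff (K (m - 2)) 1) (K (m - 2))"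
          using less.IH[of "m - 2"] 5 ij
          by (cases "m - 2 < j") (auto simp: leading_term_def numeral_2_eq_2 less_Suc_eq)
        then have D: "leading_term 2 0 (?D m)" by (intro edge_lead[OF m(1)]) auto
        have "leading_term 2 ((a m - a i) * (?q * node_product (m - 1)) - 0) (K m)"
          unfolding rec by (rule leading_term_diff[OF main[unfolded add_0] D])
        then show ?thesis using 5 ij node_product_pred[OF m(1)] by (simp add: mult_ac)
      qed
    qed
  qed
  then show "m < i \<Longrightarrow> leading_term 0 (node_product m) (K m)"
    "i \<le> m \<Longrightarrow> m < j \<Longrightarrow> leading_term 1 (?r * node_product m) (K m)"
    "j \<le> m \<Longrightarrow> leading_term 2 (?q * node_product m) (K m)" by auto
qed

lemma left_edge_node_product:
  assumes z: "z = slope n a c" and "i > 1" "a (i - 1) \<noteq> a i"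
  shows "c (i - 1) * node_product (i - 2) = - z (i - 1) * node_product (i - 1)"
proof -
  have e: "i - 1 + 1 = i" "i - 1 - 1 = i - 2" using assms by auto
  have cz: "c (i - 1) = z (i - 1) * (a i - a (i - 1))"
    using slope_mult[of "i - 1" n a c] assms ij e by simp
  have w: "node_product (i - 1) = (a (i - 1) - a i) * node_product (i - 2)"
    using node_product_pred[of "i - 1"] assms ij e by auto
  show ?thesis unfolding cz w by (simp add: algebra_simps)
qed

lemma first_edge_term:
  assumes z: "z = slope n a c" and distinct: "\<And>l. l \<in> {1..n} - {i, j} \<Longrightarrow> a l \<noteq> a i"
  shows "leading_term 2 (- z (i - 1) * node_product (i - 1))
    (if i = 1 then 0 else [:0, 0, c (i - 1):] * K (i - 2))"
proof (cases "i = 1")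
  case True
  then show ?thesis using z by (simp add: slope_def leading_term_zero)
next
  case False
  have "leading_term (2 + 0) (c (i - 1) * node_product (i - 2)) ([:0, 0, c (i - 1):] * K (i - 2))"
    using double_branch_order_two(1)[of "i - 2"] ij False by (intro leading_term_mult leading_term_edge) auto
  moreover have "i - 1 \<in> {1..n} - {i, j}" using False ij by auto
  ultimately show ?thesis using left_edge_node_product[OF z] False ij distinct by simp
qed

text \<open>Up to a nonzero factor, the term of order four is the characteristic polynomial, at \<open>- \<sigma>\<close>, of the effective second order
  perturbation on the double eigenspace. This \<open>2 \<times> 2\<close> matrix is diagonal with entries \<open>branch_coeff1\<close>, except
  for \<open>j = i + 2\<close>, when the common neighbour couples both nodes and contributes \<open>\<kappa>\<close>.\<close>

lemma nonadjacent_double_branch: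
  assumes nonadj: "i + 1 < j" and r: "coeff \<rho> 1 = 0" and z: "z = slope n a c"
    and distinct: "\<And>l. l \<in> {1..n} - {i, j} \<Longrightarrow> a l \<noteq> a i"
  defines "\<sigma> \<equiv> - coeff \<rho> 2"
  defines "\<kappa> \<equiv> (if j = i + 2 then z i * z (i + 1) else 0)"
  shows "leading_term 4
    (((\<sigma> + branch_coeff1 z i) * (\<sigma> + branch_coeff1 z j) + \<kappa>) * node_product n) (K n)"
proof -
  let ?\<alpha> = "branch_coeff1 z"
  let ?D = "\<lambda>m. if m = 1 then 0 else [:0, 0, c (m - 1):] * K (m - 2)"
  let ?q = "(\<sigma> + ?\<alpha> i) * (\<sigma> + ?\<alpha> j) + \<kappa>"
  note low = double_branch_order_two(1)
  have dn: "leading_term 2 (- \<sigma>) ([:a m:] + \<rho>)" if "m = i \<or> m = j" for m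
    using double_node_lead[OF that] r by (auto simp: leading_term_def \<sigma>_def numeral_2_eq_2 less_Suc_eq)
  have "i \<le> m \<longrightarrow> m \<le> n \<longrightarrow>
    (m = i \<longrightarrow> leading_term 2 (- (\<sigma> - z (i - 1)) * node_product m) (K m)) \<and>
    (i < m \<and> m < j \<longrightarrow> leading_term 2 (- (\<sigma> + ?\<alpha> i) * node_product m) (K m)) \<and>
    (m = j \<longrightarrow> leading_term 4 (((\<sigma> + ?\<alpha> i) * (\<sigma> - z (j - 1)) + \<kappa>) * node_product m) (K m)) \<and>
    (j < m \<longrightarrow> leading_term 4 (?q * node_product m) (K m))" for m
  proof (induction m rule: less_induct)
    case (less m)
    show ?case
    proof (intro impI)
      assume mi: "i \<le> m" and mn: "m \<le> n"
      have m: "m \<ge> 1" "m - 1 < m" using mi ij by auto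
      have rec: "K m = ([:a m:] + \<rho>) * K (m - 1) - ?D m" by (rule continuant_rec[OF m(1)])
      have IH1: "leading_term 2 (- (\<sigma> + ?\<alpha> i) * node_product l) (K l)" if "i < l" "l < j" "l < m" for l
        using less.IH[OF that(3)] that mn by simp
      have IHi: "leading_term 2 (- (\<sigma> - z (i - 1)) * node_product i) (K i)" if "i < m"
        using less.IH[OF that] that mn by simp
      have wi: "node_product i = node_product (i - 1)" using node_product_pred[of i] ij by simp
      have wj: "node_product j = node_product (j - 1)" using node_product_pred[of j] ij by simp
      consider "m = i" | "m = i + 1" | "i + 1 < m" "m < j" | "m = j" | "m = j + 1" | "j + 1 < m"
        using mi by linarith
      then show "(m = i \<longrightarrow> leading_term 2 (- (\<sigma> - z (i - 1)) * node_product m) (K m)) \<and>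
        (i < m \<and> m < j \<longrightarrow> leading_term 2 (- (\<sigma> + ?\<alpha> i) * node_product m) (K m)) \<and>
        (m = j \<longrightarrow> leading_term 4 (((\<sigma> + ?\<alpha> i) * (\<sigma> - z (j - 1)) + \<kappa>) * node_product m) (K m)) \<and>
        (j < m \<longrightarrow> leading_term 4 (?q * node_product m) (K m))"
      proof cases
        case 1
        have "leading_term (2 + 0) (- \<sigma> * node_product (i - 1)) (([:a m:] + \<rho>) * K (m - 1))"
          using low[of "i - 1"] ij 1 by (intro leading_term_mult dn) auto
        then have main: "leading_term 2 (- \<sigma> * node_product (i - 1)) (([:a m:] + \<rho>) * K (m - 1))" by simp
        have D: "leading_term 2 (- z (i - 1) * node_product (i - 1)) (?D m)"
          unfolding 1 by (rule first_edge_term[OF z distinct])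
        have "leading_term 2 (- \<sigma> * node_product (i - 1) - - z (i - 1) * node_product (i - 1)) (K m)"
          unfolding rec by (rule leading_term_diff[OF main D])
        then show ?thesis using 1 wi ij by (simp add: algebra_simps)
      next
        case 2
        have main: "leading_term (0 + 2) ((a m - a i) * (- (\<sigma> - z (i - 1)) * node_product i)) (([:a m:] + \<rho>) * K (m - 1))"
          using IHi 2 by (intro leading_term_mult node_lead) auto
        have D: "leading_term (2 + 0) (c i * node_product (i - 1)) ([:0, 0, c i:] * K (i - 1))"
          using low[of "i - 1"] ij by (intro leading_term_mult leading_term_edge) auto
        have L: "leading_term 2 ((a m - a i) * (- (\<sigma> - z (i - 1)) * node_product i) - c i * node_product (i - 1)) (K m)"
          unfolding rec using leading_term_diff[OF main[unfolded add_0] D[unfolded add_0_right]] 2 ij by simp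
        have cz: "c i = z i * (a m - a i)"
          using slope_mult[of i n a c] ij nonadj distinct[of "i + 1"] z 2 by simp
        have w: "node_product m = (a m - a i) * node_product i" using node_product_pred[of m] 2 nonadj by simp
        have "(a m - a i) * (- (\<sigma> - z (i - 1)) * node_product i) - c i * node_product (i - 1) = - (\<sigma> + ?\<alpha> i) * node_product m"
          unfolding cz w wi[symmetric] branch_coeff1_def by (simp add: algebra_simps)
        from leading_term_cong[OF L this] have "leading_term 2 (- (\<sigma> + ?\<alpha> i) * node_product m) (K m)" .
        then show ?thesis using 2 nonadj by simp
      next
        case 3
        have main: "leading_term (0 + 2) ((a m - a i) * (- (\<sigma> + ?\<alpha> i) * node_product (m - 1))) (([:a m:] + \<rho>) * K (m - 1))"
          using IH1[of "m - 1"] 3 by (intro leading_term_mult node_lead) auto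
        have "leading_term 1 (coeff \<rho> 1 * node_product (m - 2)) (K (m - 2))"
          using double_branch_order_two(2)[of "m - 2"] 3 by auto
        then have D: "leading_term 2 0 (?D m)" by (intro edge_lead[OF m(1)]) auto
        have "leading_term 2 ((a m - a i) * (- (\<sigma> + ?\<alpha> i) * node_product (m - 1)) - 0) (K m)"
          unfolding rec by (rule leading_term_diff[OF main[unfolded add_0] D])
        then show ?thesis using 3 node_product_pred[OF m(1)] by (simp add: mult_ac)
      next
        case 4
        have "leading_term (2 + 2) (- \<sigma> * (- (\<sigma> + ?\<alpha> i) * node_product (j - 1))) (([:a m:] + \<rho>) * K (m - 1))"
          using IH1[of "j - 1"] 4 nonadj by (intro leading_term_mult dn) auto
        then have main: "leading_term 4 (- \<sigma> * (- (\<sigma> + ?\<alpha> i) * node_product (j - 1))) (([:a m:] + \<rho>) * K (m - 1))"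
          by simp
        \<comment> \<open>node \<open>j - 2\<close> is \<open>i\<close> itself for \<open>j = i + 2\<close>, where the edge \<open>i\<close> has not entered yet\<close>
        define t where "t = (if j = i + 2 then \<sigma> - z (i - 1) else \<sigma> + ?\<alpha> i)"
        have "leading_term 2 (- t * node_product (j - 2)) (K (j - 2))"
        proof (cases "j = i + 2")
          case True
          then have "j - 2 = i" by simp
          then show ?thesis using IHi 4 ij True by (simp add: t_def)
        next
          case False
          then show ?thesis using IH1[of "j - 2"] 4 nonadj by (simp add: t_def)
        qed
        then have "leading_term (2 + 2) (c (j - 1) * (- t * node_product (j - 2))) ([:0, 0, c (j - 1):] * K (j - 2))"
          by (intro leading_term_mult leading_term_edge)
        then have D: "leading_term 4 (c (j - 1) * (- t * node_product (j - 2))) (?D m)"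
          using 4 ij by simp
        have e: "j - 1 + 1 = j" "j - 1 - 1 = j - 2" "j - 1 \<in> {1..n} - {i, j}" using nonadj ij by auto
        have cw: "c (j - 1) * node_product (j - 2) = - z (j - 1) * node_product (j - 1)"
        proof -
          have cz: "c (j - 1) = z (j - 1) * (a i - a (j - 1))"
            using slope_mult[of "j - 1" n a c] e distinct[OF e(3)] z ij nonadj aij by simp
          have w: "node_product (j - 1) = (a (j - 1) - a i) * node_product (j - 2)"
            using node_product_pred[of "j - 1"] e nonadj by auto
          show ?thesis unfolding cz w by (simp add: algebra_simps)
        qed
        have eq: "- \<sigma> * (- (\<sigma> + ?\<alpha> i) * node_product (j - 1)) - c (j - 1) * (- t * node_product (j - 2))
            = ((\<sigma> + ?\<alpha> i) * (\<sigma> - z (j - 1)) + \<kappa>) * node_product j"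
        proof -
          have "c (j - 1) * (- t * node_product (j - 2)) = - t * (c (j - 1) * node_product (j - 2))" by simp
          also have "\<dots> = t * z (j - 1) * node_product j" unfolding cw wj by simp
          finally show ?thesis
            unfolding wj[symmetric] t_def \<kappa>_def branch_coeff1_def using e
            by (cases "j = i + 2") (simp_all add: algebra_simps)
        qed
        have "leading_term 4 (((\<sigma> + ?\<alpha> i) * (\<sigma> - z (j - 1)) + \<kappa>) * node_product j) (K m)"
          unfolding rec using leading_term_diff[OF main D] unfolding eq .
        then show ?thesis using 4 ij by simp
      next
        case 5
        have main: "leading_term (0 + 4) ((a m - a i) * (((\<sigma> + ?\<alpha> i) * (\<sigma> - z (j - 1)) + \<kappa>) * node_product j)) (([:a m:] + \<rho>) * K (m - 1))"
          using less.IH[of j] 5 ij mn by (intro leading_term_mult node_lead) auto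
        have D: "leading_term (2 + 2) (c j * (- (\<sigma> + ?\<alpha> i) * node_product (j - 1))) ([:0, 0, c j:] * K (j - 1))"
          using IH1[of "j - 1"] 5 nonadj by (intro leading_term_mult leading_term_edge) auto
        have L: "leading_term 4 ((a m - a i) * (((\<sigma> + ?\<alpha> i) * (\<sigma> - z (j - 1)) + \<kappa>) * node_product j)
            - c j * (- (\<sigma> + ?\<alpha> i) * node_product (j - 1))) (K m)"
          unfolding rec using leading_term_diff[OF main[unfolded add_0] D[simplified]] 5 ij by simp
        have cz: "c j = z j * (a m - a i)"
          using slope_mult[of j n a c] ij 5 mn distinct[of "j + 1"] z aij by simp
        have w: "node_product m = (a m - a i) * node_product j" using node_product_pred[of m] 5 ij by simp
        have "(a m - a i) * (((\<sigma> + ?\<alpha> i) * (\<sigma> - z (j - 1)) + \<kappa>) * node_product j)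
            - c j * (- (\<sigma> + ?\<alpha> i) * node_product (j - 1)) = ?q * node_product m"
          unfolding cz w wj[symmetric] branch_coeff1_def[of z j] by (simp add: algebra_simps)
        from leading_term_cong[OF L this] have "leading_term 4 (?q * node_product m) (K m)" .
        then show ?thesis using 5 ij by simp
      next
        case 6
        have main: "leading_term (0 + 4) ((a m - a i) * (?q * node_product (m - 1))) (([:a m:] + \<rho>) * K (m - 1))"
          using less.IH[of "m - 1"] 6 ij mn by (intro leading_term_mult node_lead) auto
        have "\<exists>e. leading_term 4 e (K (m - 2))"
        proof (cases "m - 2 = j")
          case True
          then show ?thesis using less.IH[of j] 6 ij mn by auto
        next
          case False
          then have "j < m - 2" using 6 by linarith
          then show ?thesis using less.IH[of "m - 2"] 6 ij mn by auto
        qed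
        then have "leading_term 3 0 (K (m - 2))" by (auto elim: leading_term_lower)
        then have D: "leading_term 4 0 (?D m)" by (intro edge_lead[OF m(1)]) auto
        have "leading_term 4 ((a m - a i) * (?q * node_product (m - 1)) - 0) (K m)"
          unfolding rec by (rule leading_term_diff[OF main[unfolded add_0] D])
        then show ?thesis using 6 node_product_pred[OF m(1)] ij by (simp add: mult_ac)
      qed
    qed
  qed
  from this[of n] have main: "n = j \<Longrightarrow> leading_term 4 (((\<sigma> + ?\<alpha> i) * (\<sigma> - z (j - 1)) + \<kappa>) * node_product n) (K n)"
    "j < n \<Longrightarrow> leading_term 4 (?q * node_product n) (K n)" using ij by auto
  show ?thesis
  proof (cases "n = j")
    case True
    then have "z j = 0" by (simp add: z slope_def)
    then show ?thesis using main(1)[OF True] by (simp add: branch_coeff1_def)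
  next
    case False
    then show ?thesis using main(2) ij by simp
  qed
qed

text \<open>Once the term of order two vanishes, the two nodes share the second order shift: each of the two
  branches moves by the mean of the contributions of the outer edges \<open>i - 1\<close> and \<open>i + 1\<close>.\<close>

lemma adjacent_double_branch:
  assumes adj: "j = i + 1" and r: "coeff \<rho> 1 ^ 2 = c i" and z: "z = slope n a c"
    and distinct: "\<And>l. l \<in> {1..n} - {i, j} \<Longrightarrow> a l \<noteq> a i"
  defines "\<sigma> \<equiv> - coeff \<rho> 2"
  shows "leading_term 3 (- coeff \<rho> 1 * (2 * \<sigma> - z (i - 1) + z (i + 1)) * node_product n) (K n)"
proof -
  let ?r = "coeff \<rho> 1"
  let ?y = "[:a i:] + \<rho>"
  let ?D = "\<lambda>m. if m = 1 then 0 else [:0, 0, c (m - 1):] * K (m - 2)"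
  note low = double_branch_order_two(1)
  have wi: "node_product i = node_product (i - 1)" using node_product_pred[of i] ij by simp
  have wj: "node_product (i + 1) = node_product i" using node_product_pred[of j] ij adj by simp
  have y: "leading_term 1 ?r ?y" using double_node_lead[of i] by simp
  have sq: "leading_term 3 (- 2 * ?r * \<sigma>) (?y * ?y - [:0, 0, c i:])"
  proof -
    obtain u where u: "?y = monom 1 1 * u" "coeff u 0 = ?r" using y unfolding leading_term_iff by blast
    have u1: "coeff u 1 = - \<sigma>"
    proof -
      have "coeff ?y 2 = coeff u 1" unfolding u(1) by (simp add: coeff_monom_mult)
      then show ?thesis by (simp add: \<sigma>_def numeral_2_eq_2)
    qed
    have "?y * ?y - [:0, 0, c i:] = monom 1 2 * (u * u - [:c i:])"
      unfolding u(1) by (simp add: algebra_simps monom_altdef power2_eq_square)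
    moreover have "leading_term 1 (- 2 * ?r * \<sigma>) (u * u - [:c i:])"
      using u(2) u1 r by (simp add: leading_term_def coeff_mult power2_eq_square)
    moreover have "leading_term 2 1 (monom 1 2)" by (simp add: leading_term_def)
    ultimately show ?thesis using leading_term_mult[of 2 1 "monom 1 2" 1 _ "u * u - [:c i:]"]
      by (simp add: numeral_3_eq_3)
  qed
  have K0: "leading_term 0 (node_product (i - 1)) (K (i - 1))" using low[of "i - 1"] ij by simp
  have Di: "leading_term 2 (- z (i - 1) * node_product (i - 1)) (?D i)"
    by (rule first_edge_term[OF z distinct])
  have Ki: "K i = ?y * K (i - 1) - ?D i" by (rule continuant_rec[OF ij(1)])
  have Ki1: "K (i + 1) = ?y * K i - [:0, 0, c i:] * K (i - 1)"
    using continuant_rec[of "i + 1" "\<lambda>l. [:a l:] + \<rho>" "\<lambda>l. [:0, 0, c l:]"] ij adj aij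
    by (simp del: mult_pCons_left)
  have Kj: "K (i + 1) = (?y * ?y - [:0, 0, c i:]) * K (i - 1) - ?y * ?D i"
    unfolding Ki1 Ki by (simp only: left_diff_distrib right_diff_distrib mult.assoc diff_diff_eq2 diff_diff_eq add.commute)
  have left: "leading_term (3 + 0) (- 2 * ?r * \<sigma> * node_product (i - 1)) ((?y * ?y - [:0, 0, c i:]) * K (i - 1))"
    by (intro leading_term_mult sq K0)
  have "leading_term (1 + 2) (?r * (- z (i - 1) * node_product (i - 1))) (?y * ?D i)"
    by (intro leading_term_mult y Di)
  then have right: "leading_term 3 (?r * (- z (i - 1) * node_product (i - 1))) (?y * ?D i)"
    by (simp only: numeral_3_eq_3 numeral_2_eq_2 add_Suc One_nat_def add_0)
  have L: "leading_term 3 (- 2 * ?r * \<sigma> * node_product (i - 1) - ?r * (- z (i - 1) * node_product (i - 1))) (K (i + 1))"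
    unfolding Kj by (rule leading_term_diff[OF left[unfolded add_0_right] right])
  have "- 2 * ?r * \<sigma> * node_product (i - 1) - ?r * (- z (i - 1) * node_product (i - 1))
      = - ?r * (2 * \<sigma> - z (i - 1)) * node_product (i + 1)"
    unfolding wj wi by (simp add: algebra_simps)
  from leading_term_cong[OF L this] have j3:
    "leading_term 3 (- ?r * (2 * \<sigma> - z (i - 1)) * node_product (i + 1)) (K (i + 1))" .
  have i1: "leading_term 1 (?r * node_product i) (K i)" using double_branch_order_two(2)[of i] ij by simp
  have rest: "i + 1 < m \<longrightarrow> m \<le> n \<longrightarrow> leading_term 3 (- ?r * (2 * \<sigma> - z (i - 1) + z (i + 1)) * node_product m) (K m)" for m
  proof (induction m rule: less_induct)
    case (less m)
    show ?case
    proof (intro impI)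
      assume mi: "i + 1 < m" and mn: "m \<le> n"
      have m: "m \<ge> 1" "m - 1 < m" using mi by auto
      have rec: "K m = ([:a m:] + \<rho>) * K (m - 1) - ?D m" by (rule continuant_rec[OF m(1)])
      have w: "node_product m = (a m - a i) * node_product (m - 1)" using node_product_pred[OF m(1)] mi adj by simp
      show "leading_term 3 (- ?r * (2 * \<sigma> - z (i - 1) + z (i + 1)) * node_product m) (K m)"
      proof (cases "m = i + 2")
        case True
        have main: "leading_term (0 + 3) ((a m - a i) * (- ?r * (2 * \<sigma> - z (i - 1)) * node_product (i + 1))) (([:a m:] + \<rho>) * K (m - 1))"
          using j3 True by (intro leading_term_mult node_lead) simp
        have D: "leading_term (2 + 1) (c (i + 1) * (?r * node_product i)) ([:0, 0, c (i + 1):] * K i)"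
          by (intro leading_term_mult leading_term_edge i1)
        have L: "leading_term 3 ((a m - a i) * (- ?r * (2 * \<sigma> - z (i - 1)) * node_product (i + 1)) - c (i + 1) * (?r * node_product i)) (K m)"
          unfolding rec using leading_term_diff[OF main[unfolded add_0] D[simplified]] True by simp
        have cz: "c (i + 1) = z (i + 1) * (a m - a i)"
          using slope_mult[of "i + 1" n a c] True mn distinct[of m] z aij adj by simp
        have w': "node_product m = (a m - a i) * node_product (i + 1)" using w True by simp
        have "(a m - a i) * (- ?r * (2 * \<sigma> - z (i - 1)) * node_product (i + 1)) - c (i + 1) * (?r * node_product i)
            = - ?r * (2 * \<sigma> - z (i - 1) + z (i + 1)) * node_product m"
          unfolding cz w' wj by (simp add: algebra_simps)
        from leading_term_cong[OF L this] show ?thesis .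
      next
        case False
        have main: "leading_term (0 + 3) ((a m - a i) * (- ?r * (2 * \<sigma> - z (i - 1) + z (i + 1)) * node_product (m - 1))) (([:a m:] + \<rho>) * K (m - 1))"
          using less.IH[of "m - 1"] False mi mn by (intro leading_term_mult node_lead) auto
        have "\<exists>e. leading_term 3 e (K (m - 2))"
        proof (cases "m - 2 = i + 1")
          case True
          then show ?thesis using j3 by auto
        next
          case F: False
          then have "i + 1 < m - 2" using False mi by linarith
          then show ?thesis using less.IH[of "m - 2"] mi mn by auto
        qed
        then have "leading_term 2 0 (K (m - 2))" by (auto elim: leading_term_lower)
        then have D: "leading_term 3 0 (?D m)" by (intro edge_lead[OF m(1)]) auto
        have "leading_term 3 ((a m - a i) * (- ?r * (2 * \<sigma> - z (i - 1) + z (i + 1)) * node_product (m - 1)) - 0) (K m)"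
          unfolding rec by (rule leading_term_diff[OF main[unfolded add_0] D])
        then show ?thesis using w by (simp add: mult_ac)
      qed
    qed
  qed
  show ?thesis
  proof (cases "n = i + 1")
    case True
    then have "z (i + 1) = 0" by (simp add: z slope_def)
    then show ?thesis using j3 True by simp
  next
    case False
    then show ?thesis using rest[of n] ij adj by simp
  qed
qed

end

text \<open>All roots of \<open>A\<close> except the one at the double node are known; since the sum of all roots has no term of
  order two, the missing root has second coefficient \<open>- s\<close>. It is a root of \<open>A\<close> to order six, and \<open>B\<close>
  vanishes there at \<open>w = 0\<close>, so \<open>\<chi>\<^sub>n\<close> vanishes to order seven and its leading term must be zero.\<close>

lemma split_double_branch:
  assumes fac: "spectral_factorization a c n S A B"
    and ij: "i < j" "i \<in> S" "j \<in> {1..n} - S" and aij: "a j = a i"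
    and inj: "inj_on a ({1..n} - {j})" and z: "z = slope n a c"
  defines "s \<equiv> (\<Sum>k\<in>S-{i}. branch_coeff1 z k)"
  shows "i + 1 < j \<Longrightarrow> (s + branch_coeff1 z i) * (s + branch_coeff1 z j)
      + (if j = i + 2 then z i * z (i + 1) else 0) = 0"
    and "j = i + 1 \<Longrightarrow> c i \<noteq> 0 \<Longrightarrow> 2 * s - z (i - 1) + z (i + 1) = 0"
proof -
  have S: "S \<subseteq> {1..n}" and AB: "spectral_poly a c n = A * B"
    using fac by (auto simp: spectral_factorization_def)
  have i: "1 \<le> i" "i \<in> {1..n}" and jn: "j \<le> n" using ij S by auto
  have ne: "a l \<noteq> a k" if "k \<in> {1..n} - {j}" "l \<in> {1..n} - {j}" "l \<noteq> k" for k l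
    using inj that by (meson inj_onD)
  have simple: "a l \<noteq> a k" if "k \<in> S - {i}" "l \<in> {1..n} - {k}" for k l
  proof -
    have k: "k \<in> {1..n} - {j}" using that S ij by auto
    show ?thesis
    proof (cases "l = j")
      case True
      then show ?thesis using ne[OF k, of i] aij that ij i by auto
    next
      case False
      then show ?thesis using ne[OF k, of l] that by auto
    qed
  qed
  have "\<exists>\<beta>. monom 1 6 dvd poly (spectral_poly a c n) [:- a k, 0, branch_coeff1 z k, 0, \<beta>:]"
    if "k \<in> S - {i}" for k
    using spectral_poly_approximate_root[OF _ simple[OF that] z] that S by blast
  then obtain \<beta> where \<beta>: "\<And>k. k \<in> S - {i} \<Longrightarrow>
      monom 1 6 dvd poly (spectral_poly a c n) [:- a k, 0, branch_coeff1 z k, 0, \<beta> k:]"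
    by metis
  define r where "r = (\<lambda>k. [:- a k, 0, branch_coeff1 z k, 0, \<beta> k:])"
  have root: "monom 1 6 dvd poly A (r k)" if "k \<in> S - {i}" for k
    unfolding r_def using approximate_root_of_factor[OF fac _ simple[OF that] \<beta>[OF that]] that by simp
  have r0: "coeff (r k) 0 = - a k" for k by (simp add: r_def)
  have "S - {i} \<subseteq> {1..n} - {j}" using S ij by auto
  then have "inj_on a (S - {i})" using inj inj_on_subset by blast
  from remaining_approximate_root[OF fac ij(2) _ root r0 this] obtain \<rho> where
    \<rho>: "monom 1 6 dvd poly A \<rho>" "coeff \<rho> 0 = - a i" "coeff \<rho> 2 = - s"
    by (auto simp: r_def s_def numeral_2_eq_2)
  have "coeff (poly B \<rho>) 0 = (\<Prod>l\<in>{1..n}-S. a l - a i)"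
    using fac unfolding coeff_0_poly \<rho>(2) spectral_factorization_def by (simp add: poly_prod)
  also have "\<dots> = 0" using ij(3) aij by (intro prod_zero) auto
  \<comment> \<open>\<open>B\<close> contributes the seventh order, as \<open>- a\<^sub>j = - a\<^sub>i\<close> is one of its roots at \<open>w = 0\<close>\<close>
  finally have "monom 1 1 dvd poly B \<rho>" by (simp add: monom_1_dvd_iff')
  with \<rho>(1) have "monom 1 6 * monom 1 1 dvd poly (spectral_poly a c n) \<rho>"
    unfolding AB poly_mult by (rule mult_dvd_mono)
  then have dvd: "monom 1 7 dvd continuant (\<lambda>l. [:a l:] + \<rho>) (\<lambda>l. [:0, 0, c l:]) n"
    by (simp add: mult_monom poly_spectral_poly)
  have distinct: "a l \<noteq> a i" if "l \<in> {1..n} - {i, j}" for l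
    using ne[of i l] that i ij by auto
  have w: "node_product a i j n \<noteq> 0"
    using node_product_nonzero[OF i(1) ij(1) jn aij \<rho>(2)] distinct by blast
  note order2 = leading_term_unique[OF double_branch_order_two(3)[OF i(1) ij(1) jn aij \<rho>(2) jn] dvd]
  show "(s + branch_coeff1 z i) * (s + branch_coeff1 z j)
      + (if j = i + 2 then z i * z (i + 1) else 0) = 0" if nonadj: "i + 1 < j"
  proof -
    have "coeff \<rho> 1 = 0" using order2 w nonadj by simp
    from leading_term_unique[OF nonadjacent_double_branch[OF i(1) ij(1) jn aij \<rho>(2) nonadj this z distinct] dvd]
    show ?thesis using w \<rho>(3) by simp
  qed
  show "2 * s - z (i - 1) + z (i + 1) = 0" if adj: "j = i + 1" and ci: "c i \<noteq> 0"
  proof -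
    have sq: "coeff \<rho> 1 ^ 2 = c i" using order2 w adj by simp
    then have "coeff \<rho> 1 \<noteq> 0" using ci by auto
    with leading_term_unique[OF adjacent_double_branch[OF i(1) ij(1) jn aij \<rho>(2) adj sq z distinct] dvd]
    show ?thesis using w \<rho>(3) by simp
  qed
qed

section \<open>The loci that carry the reducible points\<close>

abbreviation slopes :: "nat \<Rightarrow> point \<Rightarrow> nat \<Rightarrow> complex" where
  "slopes n x \<equiv> slope n (fst x) (snd x)"

definition pairs :: "nat \<Rightarrow> (nat \<times> nat) set" where
  "pairs n = {(k, l). 1 \<le> k \<and> k < l \<and> l \<le> n}"

definition collision_locus :: "nat \<Rightarrow> nat \<Rightarrow> nat \<Rightarrow> point set" where
  "collision_locus n i j = {x \<in> param_space n. fst x i = fst x j}"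

definition balanced_locus :: "nat \<Rightarrow> nat set \<Rightarrow> point set" where
  "balanced_locus n S = {x \<in> param_space n. inj_on (fst x) {1..n} \<and>
     (\<Sum>k\<in>S. branch_coeff1 (slopes n x) k) = 0}"

lemma pairs_subset: "pairs n \<subseteq> {1..n} \<times> {1..n}" "finite (pairs n)"
proof -
  show "pairs n \<subseteq> {1..n} \<times> {1..n}" by (auto simp: pairs_def)
  then show "finite (pairs n)" using finite_subset by blast
qed

text \<open>Prescribed slopes are realized by the choice \<open>c\<^sub>k = z\<^sub>k (a\<^sub>k\<^sub>+\<^sub>1 - a\<^sub>k)\<close>, which stays polynomial along a
  polynomial curve of \<open>a\<close> and \<open>z\<close>.\<close>

lemma slope_curve_point:
  assumes "\<And>k. k \<notin> {1..<n} \<or> a (k + 1) = a k \<Longrightarrow> z k = 0"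
    and "\<And>k. k \<in> {1..n} \<Longrightarrow> poly (p k) s = a k"
    and "\<And>k. k \<in> {1..<n} \<Longrightarrow> poly (q k) s = z k * (a (k + 1) - a k)"
  shows "slopes n (curve_point n p q s) = z"
proof
  fix k
  show "slopes n (curve_point n p q s) k = z k"
  proof (cases "k \<in> {1..<n}")
    case True
    then have "k \<in> {1..n}" "k + 1 \<in> {1..n}" "k \<in> {1..n-1}" by auto
    then show ?thesis
      using True assms(1)[of k] assms(2)[of k] assms(2)[of "k + 1"] assms(3)[of k]
      by (cases "a (k + 1) = a k") (simp_all add: slope_def curve_point_def)
  next
    case False
    then show ?thesis using assms(1)[of k] by (auto simp: slope_def)
  qed
qed

lemma finite_curve_outside_balanced_locus:
  assumes z: "\<And>k. k \<notin> {1..<n} \<Longrightarrow> \<zeta> k = 0" "\<And>k. k \<in> {1..<n} \<Longrightarrow> \<exists>s. poly (\<zeta> k) s \<noteq> 0"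
    and sum: "\<And>s. (\<Sum>k\<in>S. branch_coeff1 (\<lambda>k. poly (\<zeta> k) s) k) = 0"
    and p: "inj_on (\<lambda>k. poly (p k) s0) {1..n}"
  shows "finite {s. curve_point n p (\<lambda>k. \<zeta> k * (p (k + 1) - p k)) s \<notin> balanced_locus n S}"
proof -
  let ?q = "\<lambda>k. \<zeta> k * (p (k + 1) - p k)"
  let ?B1 = "{s. \<exists>k\<in>{1..<n}. poly (\<zeta> k) s = 0}"
  let ?B2 = "{s. \<exists>kl\<in>pairs n. poly (p (fst kl) - p (snd kl)) s = 0}"
  have "finite ?B1" by (rule finite_some_root) (use z(2) in auto)
  moreover have "finite ?B2"
  proof (rule finite_some_root[OF pairs_subset(2)])
    fix kl assume "kl \<in> pairs n"
    then have "fst kl \<noteq> snd kl" "fst kl \<in> {1..n}" "snd kl \<in> {1..n}" by (auto simp: pairs_def)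
    then have "poly (p (fst kl)) s0 \<noteq> poly (p (snd kl)) s0"
      using inj_onD[OF p, of "fst kl" "snd kl"] by blast
    then have "poly (p (fst kl) - p (snd kl)) s0 \<noteq> 0" by simp
    then show "\<exists>s. poly (p (fst kl) - p (snd kl)) s \<noteq> 0" by blast
  qed
  moreover have "curve_point n p ?q s \<in> balanced_locus n S" if s: "s \<notin> ?B1 \<union> ?B2" for s
  proof -
    have ne: "poly (p k) s \<noteq> poly (p l) s" if "k < l" "k \<in> {1..n}" "l \<in> {1..n}" for k l
    proof -
      have "(k, l) \<in> pairs n" using that by (simp add: pairs_def)
      moreover have "\<forall>kl\<in>pairs n. poly (p (fst kl) - p (snd kl)) s \<noteq> 0" using s by simp
      ultimately have "poly (p (fst (k, l)) - p (snd (k, l))) s \<noteq> 0" by (rule bspec[rotated])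
      then show ?thesis by simp
    qed
    have inj: "inj_on (\<lambda>k. poly (p k) s) {1..n}"
      using ne by (intro linorder_inj_onI) auto
    have q: "poly (?q k) s \<noteq> 0" if "k \<in> {1..n-1}" for k
    proof -
      have "k \<in> {1..<n}" "k + 1 \<in> {1..n}" "k \<in> {1..n}" using that by auto
      then show ?thesis using s ne[of k "k + 1"] by auto
    qed
    have "slopes n (curve_point n p ?q s) = (\<lambda>k. poly (\<zeta> k) s)"
    proof (rule slope_curve_point[where a = "\<lambda>k. poly (p k) s"])
      fix k assume k: "k \<notin> {1..<n} \<or> poly (p (k + 1)) s = poly (p k) s"
      have "k \<notin> {1..<n}"
      proof
        assume "k \<in> {1..<n}"
        then show False using ne[of k "k + 1"] k by auto
      qed
      then show "poly (\<zeta> k) s = 0" using z(1) by simp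
    qed auto
    moreover have "inj_on (fst (curve_point n p ?q s)) {1..n}"
      by (rule iffD2[OF inj_on_cong inj]) (simp add: curve_point_def)
    moreover have "curve_point n p ?q s \<in> param_space n"
      using q by (simp add: curve_point_def param_space_def)
    ultimately show ?thesis using sum by (simp add: balanced_locus_def)
  qed
  then have "{s. curve_point n p ?q s \<notin> balanced_locus n S} \<subseteq> ?B1 \<union> ?B2" by blast
  ultimately show ?thesis using finite_subset by blast
qed

lemma balanced_locusD:
  assumes "x \<in> balanced_locus n S"
  shows "x \<in> param_space n" "inj_on (fst x) {1..n}" "(\<Sum>k\<in>S. branch_coeff1 (slopes n x) k) = 0"
    "\<And>k. k \<notin> {1..<n} \<Longrightarrow> slopes n x k = 0" "\<And>k. k \<in> {1..<n} \<Longrightarrow> slopes n x k \<noteq> 0"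
    "\<And>k. k \<in> {1..<n} \<Longrightarrow> slopes n x k * (fst x (k + 1) - fst x k) = snd x k"
proof -
  show x: "x \<in> param_space n" "inj_on (fst x) {1..n}" "(\<Sum>k\<in>S. branch_coeff1 (slopes n x) k) = 0"
    using assms by (auto simp: balanced_locus_def)
  show "slopes n x k = 0" if "k \<notin> {1..<n}" for k using that by (auto simp: slope_def)
  have ne: "fst x (k + 1) \<noteq> fst x k" if "k \<in> {1..<n}" for k
    using inj_onD[OF x(2), of "k + 1" k] that by auto
  have c: "snd x k \<noteq> 0" if "k \<in> {1..<n}" for k
    using x(1) that by (auto simp: param_space_def PiE_def Pi_def)
  show "slopes n x k \<noteq> 0" if "k \<in> {1..<n}" for k using ne[OF that] c[OF that] that by (simp add: slope_def)
  show "slopes n x k * (fst x (k + 1) - fst x k) = snd x k" if "k \<in> {1..<n}" for k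
    using ne[OF that] that by (simp add: slope_def)
qed

lemma branch_sum_linear:
  "(\<Sum>k\<in>S. branch_coeff1 (\<lambda>k. u * z k + v * z' k) k)
    = u * (\<Sum>k\<in>S. branch_coeff1 z k) + v * (\<Sum>k\<in>S. branch_coeff1 z' k)"
  unfolding sum_distrib_left sum.distrib[symmetric]
  by (intro sum.cong) (simp_all add: branch_coeff1_def algebra_simps)

text \<open>In the coordinates \<open>(a, z)\<close> the balanced locus is an open part of a linear space, so that its points are
  joined by lines.\<close>

lemma curve_connected_balanced_locus:
  assumes "balanced_locus n S \<noteq> {}"
  shows "curve_connected n (balanced_locus n S)"
  unfolding curve_connected_def
proof (intro conjI ballI assms)
  show "balanced_locus n S \<subseteq> param_space n" by (auto simp: balanced_locus_def)
  fix y y' assume y: "y \<in> balanced_locus n S" and y': "y' \<in> balanced_locus n S"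
  define p where "p = (\<lambda>i. [:fst y i, fst y' i - fst y i:])"
  define \<zeta> where "\<zeta> = (\<lambda>k. [:slopes n y k, slopes n y' k - slopes n y k:])"
  let ?q = "\<lambda>k. \<zeta> k * (p (k + 1) - p k)"
  have ext: "fst y = (\<lambda>i\<in>{1..n}. fst y i)" "snd y = (\<lambda>i\<in>{1..n-1}. snd y i)" if "y \<in> param_space n" for y
    using that by (auto simp: param_space_def PiE_def extensional_restrict)
  have idx: "k \<in> {1..<n}" if "k \<in> {1..n-1}" for k using that by auto
  have ends: "poly (p k) 0 = fst y k" "poly (p k) 1 = fst y' k"
    "poly (\<zeta> k) 0 = slopes n y k" "poly (\<zeta> k) 1 = slopes n y' k" for k
    by (simp_all add: p_def \<zeta>_def)
  have "curve_point n p ?q 0 = y"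
  proof (rule prod_eqI)
    show "fst (curve_point n p ?q 0) = fst y"
      unfolding curve_point_def fst_conv
      by (subst ext(1)[OF balanced_locusD(1)[OF y]]) (rule restrict_ext, simp add: p_def)
    show "snd (curve_point n p ?q 0) = snd y"
      unfolding curve_point_def snd_conv
      by (subst ext(2)[OF balanced_locusD(1)[OF y]])
        (rule restrict_ext, use balanced_locusD(6)[OF y idx] in \<open>simp add: ends\<close>)
  qed
  moreover have "curve_point n p ?q 1 = y'"
  proof (rule prod_eqI)
    show "fst (curve_point n p ?q 1) = fst y'"
      unfolding curve_point_def fst_conv
      by (subst ext(1)[OF balanced_locusD(1)[OF y']]) (rule restrict_ext, simp add: p_def)
    show "snd (curve_point n p ?q 1) = snd y'"
      unfolding curve_point_def snd_conv
      by (subst ext(2)[OF balanced_locusD(1)[OF y']])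
        (rule restrict_ext, use balanced_locusD(6)[OF y' idx] in \<open>simp add: ends\<close>)
  qed
  moreover have "finite {s. curve_point n p ?q s \<notin> balanced_locus n S}"
  proof (rule finite_curve_outside_balanced_locus)
    show "\<zeta> k = 0" if "k \<notin> {1..<n}" for k
      using balanced_locusD(4)[OF y that] balanced_locusD(4)[OF y' that] by (simp add: \<zeta>_def)
    show "\<exists>s. poly (\<zeta> k) s \<noteq> 0" if "k \<in> {1..<n}" for k
      using balanced_locusD(5)[OF y that] by (intro exI[of _ 0]) (simp add: \<zeta>_def)
    show "inj_on (\<lambda>k. poly (p k) 0) {1..n}"
      using balanced_locusD(2)[OF y] by (simp add: p_def)
    show "(\<Sum>k\<in>S. branch_coeff1 (\<lambda>k. poly (\<zeta> k) s) k) = 0" for s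
    proof -
      have "(\<lambda>k. poly (\<zeta> k) s) = (\<lambda>k. (1 - s) * slopes n y k + s * slopes n y' k)"
        by (simp add: \<zeta>_def fun_eq_iff algebra_simps)
      then show ?thesis
        using balanced_locusD(3)[OF y] balanced_locusD(3)[OF y'] by (simp only: branch_sum_linear) simp
    qed
  qed
  ultimately show "\<exists>p q. curve_point n p q 0 = y \<and> curve_point n p q 1 = y' \<and>
      finite {s. curve_point n p q s \<notin> balanced_locus n S}" by blast
qed

lemma curve_connected_collision_locus:
  assumes ij: "i \<in> {1..n}" "j \<in> {1..n}"
  shows "curve_connected n (collision_locus n i j)"
proof (rule curve_connectedI_lines)
  have "(\<lambda>i\<in>{1..n}. 0, \<lambda>i\<in>{1..n-1}. 1) \<in> collision_locus n i j"
    using ij by (simp add: collision_locus_def param_space_def)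
  then show "collision_locus n i j \<noteq> {}" by blast
  show "collision_locus n i j \<subseteq> param_space n" by (auto simp: collision_locus_def)
  fix a c a' c' assume *: "(a, c) \<in> collision_locus n i j" "(a', c') \<in> collision_locus n i j"
  let ?p = "\<lambda>i. [:a i, a' i - a i:]" and ?q = "\<lambda>i. [:c i, c' i - c i:]"
  have "finite {s. curve_point n ?p ?q s \<notin> param_space n}"
    by (rule finite_line_outside_param_space) (use * in \<open>auto simp: collision_locus_def\<close>)
  moreover have "fst (curve_point n ?p ?q s) i = fst (curve_point n ?p ?q s) j" for s
    using * ij by (simp add: curve_point_def collision_locus_def)
  ultimately show "finite {s. curve_point n ?p ?q s \<notin> collision_locus n i j}"
    by (simp add: collision_locus_def)
qed

text \<open>The sum over \<open>S\<close> only sees the edges with one end in \<open>S\<close> and one outside, with a sign that tells which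
  end is in \<open>S\<close>.\<close>

lemma branch_sum_indicator:
  assumes "finite S" "0 \<notin> S"
  shows "(\<Sum>k\<in>S. branch_coeff1 (\<lambda>k. if k = l then t else 0) k) = t * (of_bool (l \<in> S) - of_bool (l + 1 \<in> S))"
proof -
  have "(\<Sum>k\<in>S. branch_coeff1 (\<lambda>k. if k = l then t else 0) k)
      = (\<Sum>k\<in>S. if k = l then t else 0) - (\<Sum>k\<in>S. if k = l + 1 then t else 0)"
    unfolding sum_subtractf[symmetric] branch_coeff1_def
  proof (intro sum.cong refl)
    fix k assume "k \<in> S"
    then have "(k - 1 = l) = (k = l + 1)" using assms(2) by (cases k) auto
    then show "(if k = l then t else 0) - (if k - 1 = l then t else 0)
      = (if k = l then t else 0) - (if k = l + 1 then t else 0)" by simp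
  qed
  then show ?thesis using assms(1) by (simp add: sum.delta)
qed

lemma branch_sum_interval:
  assumes "finite S" "0 \<notin> S" "l \<le> m"
  shows "(\<Sum>k\<in>S. branch_coeff1 (\<lambda>k. of_bool (l \<le> k \<and> k < m)) k)
    = (of_bool (l \<in> S) - of_bool (m \<in> S) :: complex)"
  using assms(3)
proof (induction m rule: dec_induct)
  case base
  have "(\<lambda>k. of_bool (l \<le> k \<and> k < l)) = (\<lambda>_::nat. 0 :: complex)" by auto
  then show ?case by (simp add: branch_coeff1_def)
next
  case (step m)
  have eq: "(\<lambda>k. of_bool (l \<le> k \<and> k < Suc m) :: complex)
      = (\<lambda>k. 1 * of_bool (l \<le> k \<and> k < m) + 1 * (if k = m then 1 else 0))"
    using step by (auto simp: fun_eq_iff)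
  show ?case unfolding eq branch_sum_linear branch_sum_indicator[OF assms(1,2)] step.IH by simp
qed

text \<open>If no two neighbouring slopes are nonzero, the second coefficients telescope in the same way as the first
  ones. Both conditions can then be evaluated with the same formula.\<close>

lemma branch_coeff2_isolated:
  assumes "z 0 = 0" "\<And>j. z j * z (j + 1) = 0" "k \<ge> 1"
  shows "branch_coeff2 a z k = - branch_coeff1 (\<lambda>j. z j ^ 2 / (a (j + 1) - a j)) k"
proof -
  have e: "k - 1 + 1 = k" using assms(3) by simp
  have 1: "z (k - 1) * z k = 0" using assms(2)[of "k - 1"] e by simp
  have 2: "z (k - 1) * z (k - 2) = 0"
  proof (cases "k = 1")
    case False
    then have "k - 2 + 1 = k - 1" using assms(3) by simp
    then show ?thesis using assms(2)[of "k - 2"] by (simp add: mult.commute)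
  qed (simp add: assms(1))
  show ?thesis
    unfolding branch_coeff2_def branch_coeff1_def using 1 2 assms(2)[of k] e
    by (auto simp: power2_eq_square)
qed

lemma rational_on_slope:
  assumes "Q \<subseteq> {1..n} \<times> {1..n}" "k \<in> {1..<n} \<Longrightarrow> (k, k + 1) \<in> Q"
  shows "(\<lambda>x. slopes n x k) \<in> rational_on n Q"
proof (cases "k \<in> {1..<n}")
  case True
  then have "k \<in> {1..n-1}" by auto
  then have "(\<lambda>x. snd x k / (fst x (k + 1) - fst x k)) \<in> rational_on n Q"
    using assms True
    by (intro rational_on_divide_difference rational_on_polynomial polynomial_functions.coord_c) auto
  then show ?thesis using True by (simp add: slope_def)
next
  case False
  then have "(\<lambda>x. slopes n x k) = (\<lambda>_. 0)" by (auto simp: slope_def)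
  then show ?thesis by (simp add: rational_on_const)
qed

lemma rational_on_branch_sum:
  assumes Q: "Q \<subseteq> {1..n} \<times> {1..n}"
    and "\<And>k. k \<in> S \<Longrightarrow> k \<in> {1..<n} \<Longrightarrow> (k, k + 1) \<in> Q"
    and "\<And>k. k \<in> S \<Longrightarrow> k - 1 \<in> {1..<n} \<Longrightarrow> (k - 1, k) \<in> Q"
  shows "(\<lambda>x. \<Sum>k\<in>S. branch_coeff1 (slopes n x) k) \<in> rational_on n Q"
proof (intro rational_on_sum[OF Q])
  fix k assume k: "k \<in> S"
  have "k - 1 + 1 = k" if "k - 1 \<in> {1..<n}" using that by (cases k) auto
  then show "(\<lambda>x. branch_coeff1 (slopes n x) k) \<in> rational_on n Q"
    unfolding branch_coeff1_def
    using assms(2,3)[OF k] by (intro rational_on_diff[OF Q] rational_on_slope[OF Q]) auto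
qed

lemma rational_on_branch_coeff2:
  assumes k: "k \<in> {1..n}"
  shows "(\<lambda>x. branch_coeff2 (fst x) (slopes n x) k) \<in> rational_on n (pairs n)"
proof -
  note Q = pairs_subset(1)[of n]
  have z: "(\<lambda>x. slopes n x l) \<in> rational_on n (pairs n)" for l
    by (intro rational_on_slope[OF Q]) (auto simp: pairs_def)
  have a: "(\<lambda>x. fst x l) \<in> rational_on n (pairs n)" if "l \<in> {1..n}" for l
    by (intro rational_on_polynomial polynomial_functions.coord_a that)
  have zero: "slopes n x l = 0" if "l \<notin> {1..<n}" for x l
    using that by (auto simp: slope_def)
  have 1: "(\<lambda>x. slopes n x k / (fst x (k + 1) - fst x k)) \<in> rational_on n (pairs n)"
  proof (cases "k \<in> {1..<n}")
    case True
    then show ?thesis by (intro rational_on_divide_difference[OF Q] z) (auto simp: pairs_def)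
  qed (simp add: zero rational_on_const)
  have 2: "(\<lambda>x. slopes n x (k - 1) / (fst x k - fst x (k - 1))) \<in> rational_on n (pairs n)"
  proof (cases "k - 1 \<in> {1..<n}")
    case True
    then show ?thesis using k by (intro rational_on_divide_difference[OF Q] z) (auto simp: pairs_def)
  qed (simp add: zero rational_on_const)
  have 3: "(\<lambda>x. slopes n x k * slopes n x (k + 1) * (fst x (k + 2) - fst x (k + 1))
      / (fst x (k + 1) - fst x k) / (fst x (k + 2) - fst x k)) \<in> rational_on n (pairs n)"
  proof (cases "k + 1 \<in> {1..<n}")
    case True
    then show ?thesis using k
      by (intro rational_on_divide_difference[OF Q] rational_on_mult rational_on_diff[OF Q] z a)
        (auto simp: pairs_def)
  qed (simp add: zero rational_on_const)
  have 4: "(\<lambda>x. slopes n x (k - 1) * slopes n x (k - 2) * (fst x (k - 1) - fst x (k - 2))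
      / (fst x k - fst x (k - 1)) / (fst x k - fst x (k - 2))) \<in> rational_on n (pairs n)"
  proof (cases "k - 2 \<in> {1..<n}")
    case True
    then show ?thesis using k
      by (intro rational_on_divide_difference[OF Q] rational_on_mult rational_on_diff[OF Q] z a)
        (auto simp: pairs_def)
  qed (simp add: zero rational_on_const)
  have "(\<lambda>x. (slopes n x (k - 1) - slopes n x k) * (slopes n x k / (fst x (k + 1) - fst x k)
        + slopes n x (k - 1) / (fst x k - fst x (k - 1)))
      + slopes n x k * slopes n x (k + 1) * (fst x (k + 2) - fst x (k + 1))
        / (fst x (k + 1) - fst x k) / (fst x (k + 2) - fst x k)
      - slopes n x (k - 1) * slopes n x (k - 2) * (fst x (k - 1) - fst x (k - 2))
        / (fst x k - fst x (k - 1)) / (fst x k - fst x (k - 2))) \<in> rational_on n (pairs n)"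
    by (intro rational_on_diff[OF Q] rational_on_add[OF Q] rational_on_mult z 1 2 3 4)
  then show ?thesis
    unfolding branch_coeff2_def branch_coeff1_def by (simp add: divide_divide_eq_left)
qed

section \<open>The reducible loci\<close>

lemma two_power_eq_iff: "(2::complex) ^ k = 2 ^ l \<longleftrightarrow> k = l"
proof -
  have "(2::complex) ^ k = of_nat (2 ^ k)" for k by simp
  then show ?thesis by (metis of_nat_eq_iff power_inject_exp one_less_numeral_iff semiring_norm(76))
qed

text \<open>Let \<open>m\<close> be the least node of \<open>S\<close>. If \<open>S\<close> has a boundary edge \<open>l\<close> that does not touch the edge
  \<open>m - 1\<close>, slopes on these two edges alone suffice, where the quadratic condition becomes
  \<open>1 / 2\<^sup>m\<^sup>-\<^sup>1 = \<plusminus> 1 / 2\<^sup>l\<close>. Otherwise \<open>S\<close> is a final segment, which is impossible because its only boundary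
  edge would have slope zero, or \<open>S = {m}\<close> with \<open>m < n\<close>. In the last case a third edge beside \<open>m - 1\<close>
  and \<open>m\<close> is used, which exists as \<open>n \<ge> 4\<close>.\<close>

lemma balanced_slopes_with_nonzero_second_sum:
  assumes n: "n \<ge> 4" and S: "S \<subseteq> {2..n}" "S \<noteq> {}"
    and z: "\<And>k. k \<in> {1..<n} \<Longrightarrow> z k \<noteq> 0" "\<And>k. k \<notin> {1..<n} \<Longrightarrow> z k = 0"
      "(\<Sum>k\<in>S. branch_coeff1 z k) = 0"
    and a: "\<And>k. k \<in> {1..n} \<Longrightarrow> a k = 2 ^ k"
  shows "\<exists>z'. (\<forall>k. k \<notin> {1..<n} \<longrightarrow> z' k = 0) \<and> (\<Sum>k\<in>S. branch_coeff1 z' k) = 0 \<and>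
    (\<Sum>k\<in>S. branch_coeff2 a z' k) \<noteq> 0"
proof -
  have fin: "finite S" "0 \<notin> S" using S finite_subset by auto
  define m where "m = Min S"
  have m: "m \<in> S" "2 \<le> m" "m \<le> n" "m - 1 \<notin> S" "m - 1 + 1 = m"
  proof -
    show "m \<in> S" using fin S by (simp add: m_def)
    then show "2 \<le> m" "m \<le> n" "m - 1 + 1 = m" using S by auto
    show "m - 1 \<notin> S" using Min_le[OF fin(1), of "m - 1"] \<open>2 \<le> m\<close> by (fastforce simp: m_def)
  qed
  have low: "x \<ge> m" if "x \<in> S" for x using that fin by (simp add: m_def)
  show ?thesis
  proof (cases "\<exists>l. m < l \<and> l < n \<and> (l \<in> S) \<noteq> (l + 1 \<in> S)")
    case True
    then obtain l where l: "m < l" "l < n" "(l \<in> S) \<noteq> (l + 1 \<in> S)" by blast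
    define \<epsilon> :: complex where "\<epsilon> = of_bool (l \<in> S) - of_bool (l + 1 \<in> S)"
    have \<epsilon>: "\<epsilon> = 1 \<or> \<epsilon> = -1" using l(3) by (auto simp: \<epsilon>_def)
    define z' where "z' = (\<lambda>k. \<epsilon> * (if k = m - 1 then 1 else 0) + 1 * (if k = l then 1 else 0))"
    have out: "z' k = 0" if "k \<notin> {1..<n}" for k using that l m by (auto simp: z'_def)
    have sum: "(\<Sum>k\<in>S. branch_coeff1 z' k) = 0"
      unfolding z'_def branch_sum_linear branch_sum_indicator[OF fin] using m
      by (simp add: \<epsilon>_def)
    define w where "w = (\<lambda>k. 1 / (a m - a (m - 1)) * (if k = m - 1 then 1 else 0)
        + 1 / (a (l + 1) - a l) * (if k = l then 1 else 0))"
    have w: "(\<lambda>j. z' j ^ 2 / (a (j + 1) - a j)) = w"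
      using \<epsilon> l m by (auto simp: fun_eq_iff w_def z'_def)
    have "(\<Sum>k\<in>S. branch_coeff2 a z' k) = (\<Sum>k\<in>S. - branch_coeff1 w k)"
    proof (intro sum.cong refl)
      fix k assume "k \<in> S"
      then show "branch_coeff2 a z' k = - branch_coeff1 w k"
        unfolding w[symmetric] using l m S
        by (intro branch_coeff2_isolated) (auto simp: z'_def)
    qed
    also have "\<dots> = 1 / (a m - a (m - 1)) - \<epsilon> / (a (l + 1) - a l)"
      unfolding sum_negf w_def branch_sum_linear branch_sum_indicator[OF fin] using m
      by (simp add: \<epsilon>_def diff_divide_distrib)
    also have "a m - a (m - 1) = 2 ^ (m - 1)"
    proof -
      have "m - 1 \<in> {1..n}" using m by auto
      then show ?thesis using a[of m] a[of "m - 1"] m power_Suc[of "2::complex" "m - 1"] by simp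
    qed
    also have "a (l + 1) - a l = 2 ^ l"
      using a[of l] a[of "l + 1"] l m by simp
    also have "1 / 2 ^ (m - 1) - \<epsilon> / 2 ^ l \<noteq> (0::complex)"
    proof
      assume "1 / 2 ^ (m - 1) - \<epsilon> / 2 ^ l = (0::complex)"
      then have "(2::complex) ^ l = \<epsilon> * 2 ^ (m - 1)" by (simp add: field_simps)
      then have "norm ((2::complex) ^ l) = norm (\<epsilon> * 2 ^ (m - 1))" by simp
      then have "(2::real) ^ l = 2 ^ (m - 1)" using \<epsilon> by (auto simp: norm_mult norm_power)
      then have "l = m - 1" by simp
      then show False using l by simp
    qed
    finally have "(\<Sum>k\<in>S. branch_coeff2 a z' k) \<noteq> 0" .
    then show ?thesis using out sum by blast
  next
    case False
    have full: "S \<noteq> {m..n}"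
    proof
      assume "S = {m..n}"
      then have "(\<Sum>k\<in>S. branch_coeff1 z k) = (\<Sum>k\<in>{Suc (m - 1)..n}. z k - z (k - 1))"
        using m by (simp add: branch_coeff1_def)
      also have "\<dots> = z n - z (m - 1)" using m by (intro sum_telescope'') auto
      finally have "z (m - 1) = 0" using z(2)[of n] z(3) by simp
      moreover have "m - 1 \<in> {1..<n}" using m by auto
      ultimately show False using z(1) by blast
    qed
    have iff: "m < j \<Longrightarrow> j \<le> n \<Longrightarrow> (j \<in> S) = (m + 1 \<in> S)" for j
    proof (induction j)
      case (Suc j)
      show ?case
      proof (cases "j = m")
        case False
        then have "m < j" "j < n" using Suc.prems by auto
        then show ?thesis using Suc.IH \<open>\<not> (\<exists>l. _ l)\<close> by auto
      qed simp
    qed simp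
    have mem: "x \<in> S \<longleftrightarrow> x = m \<or> m < x \<and> x \<le> n \<and> m + 1 \<in> S" for x
    proof -
      consider "x < m" | "x = m" | "m < x" "x \<le> n" | "n < x" by linarith
      then show ?thesis
      proof cases
        case 1
        then show ?thesis using low[of x] by auto
      next
        case 2
        then show ?thesis using m(1) by simp
      next
        case 3
        then show ?thesis using iff[OF 3] by simp
      next
        case 4
        then have "x \<notin> S" using S(1) by auto
        then show ?thesis using 4 m(3) by simp
      qed
    qed
    have m1: "m + 1 \<notin> S"
    proof
      assume "m + 1 \<in> S"
      have "S = {m..n}"
      proof (rule set_eqI)
        show "x \<in> S \<longleftrightarrow> x \<in> {m..n}" for x using mem[of x] \<open>m + 1 \<in> S\<close> m(3) by auto
      qed
      then show False using full by simp
    qed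
    have Sm: "S = {m}"
    proof (rule set_eqI)
      show "x \<in> S \<longleftrightarrow> x \<in> {m}" for x using mem[of x] m1 by blast
    qed
    have "m \<noteq> n" using full Sm by auto
    then have mn: "m < n" using m by simp
    have ne: "a k - a l \<noteq> 0" if "k \<in> {1..n}" "l \<in> {1..n}" "k \<noteq> l" for k l
      unfolding a[OF that(1)] a[OF that(2)] using that(3) by (simp add: two_power_eq_iff)
    show ?thesis
    proof (cases "m + 1 < n")
      case True
      define z' :: "nat \<Rightarrow> complex" where "z' = (\<lambda>k. of_bool (m - 1 \<le> k \<and> k < m + 2))"
      have out: "z' k = 0" if "k \<notin> {1..<n}" for k using that m True by (auto simp: z'_def)
      have vals: "z' m = 1" "z' (m - 1) = 1" "z' (m + 1) = 1" "z' (m - 2) = 0"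
        using m by (auto simp: z'_def)
      have "branch_coeff2 a z' m \<noteq> 0"
        unfolding branch_coeff2_def branch_coeff1_def vals
        using ne[of "m + 2" "m + 1"] ne[of "m + 1" m] ne[of "m + 2" m] m True by simp
      then show ?thesis using out vals unfolding Sm by (intro exI[of _ z']) (simp add: branch_coeff1_def)
    next
      case False
      then have nm: "n = m + 1" using mn by simp
      define z' :: "nat \<Rightarrow> complex" where "z' = (\<lambda>k. of_bool (m - 2 \<le> k \<and> k < m + 1))"
      have out: "z' k = 0" if "k \<notin> {1..<n}" for k using that m n nm by (auto simp: z'_def)
      have vals: "z' m = 1" "z' (m - 1) = 1" "z' (m + 1) = 0" "z' (m - 2) = 1"
        using m n nm by (auto simp: z'_def)
      have "m - 1 \<in> {1..n}" "m - 2 \<in> {1..n}" "m \<in> {1..n}" "m - 1 \<noteq> m - 2" "m \<noteq> m - 2" "m \<noteq> m - 1"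
        using m n nm by auto
      then have "branch_coeff2 a z' m \<noteq> 0"
        unfolding branch_coeff2_def branch_coeff1_def vals
        using ne[of "m - 1" "m - 2"] ne[of m "m - 2"] ne[of m "m - 1"] by simp
      then show ?thesis using out vals unfolding Sm by (intro exI[of _ z']) (simp add: branch_coeff1_def)
    qed
  qed
qed

lemma separation_pairs_nonzero_iff: "separation (pairs n) x \<noteq> 0 \<longleftrightarrow> inj_on (fst x) {1..n}"
proof -
  have "(\<forall>(k, l)\<in>pairs n. fst x k \<noteq> fst x l) \<longleftrightarrow> inj_on (fst x) {1..n}"
  proof
    assume *: "\<forall>(k, l)\<in>pairs n. fst x k \<noteq> fst x l"
    show "inj_on (fst x) {1..n}" using * by (intro linorder_inj_onI) (auto simp: pairs_def)
  next
    assume "inj_on (fst x) {1..n}"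
    then show "\<forall>(k, l)\<in>pairs n. fst x k \<noteq> fst x l" by (auto simp: pairs_def dest: inj_onD)
  qed
  then show ?thesis using separation_nonzero_iff[OF pairs_subset(2)] by blast
qed

text \<open>The witness curve adds multiples of the slopes of an existing point of the balanced locus to the
  slopes of \<open>balanced_slopes_with_nonzero_second_sum\<close>. The linear condition itself, with denominators cleared, serves as the
  equation of the hypersurface; doubling one boundary slope violates it.\<close>

lemma small_locus_balanced_locus:
  assumes n: "n \<ge> 4" and S: "S \<subseteq> {2..n}" "S \<noteq> {}"
  shows "small_locus n {x \<in> balanced_locus n S. (\<Sum>k\<in>S. branch_coeff2 (fst x) (slopes n x) k) = 0}"
proof (cases "balanced_locus n S = {}")
  case True
  then show ?thesis using small_locus_empty by simp
next
  case False
  then obtain y where y: "y \<in> balanced_locus n S" by blast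
  note yD = balanced_locusD[OF y]
  note Q = pairs_subset(1)[of n]
  have fin: "finite S" "0 \<notin> S" using S finite_subset by auto
  let ?a = "\<lambda>k::nat. (2::complex) ^ k" and ?p = "\<lambda>k::nat. [:(2::complex) ^ k:]"
  have curve: "fst (curve_point n ?p q s) k = ?a k" if "k \<in> {1..n}" for q s k
    using that by (simp add: curve_point_def)
  have sep: "separation (pairs n) (curve_point n ?p q s) \<noteq> 0" for q s
    unfolding separation_pairs_nonzero_iff using curve by (simp add: inj_on_def two_power_eq_iff)
  obtain z' where z': "\<And>k. k \<notin> {1..<n} \<Longrightarrow> z' k = 0" "(\<Sum>k\<in>S. branch_coeff1 z' k) = 0"
    "(\<Sum>k\<in>S. branch_coeff2 (fst (curve_point n ?p (\<lambda>_. 0) 0)) z' k) \<noteq> 0"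
    using balanced_slopes_with_nonzero_second_sum[OF n S yD(5,4,3) curve[of _ "\<lambda>_. 0" 0]] by blast
  define \<zeta> where "\<zeta> = (\<lambda>k. [:z' k, slopes n y k:])"
  let ?q = "\<lambda>k. \<zeta> k * (?p (k + 1) - ?p k)"
  have fincurve: "finite {s. curve_point n ?p ?q s \<notin> balanced_locus n S}"
  proof (rule finite_curve_outside_balanced_locus)
    show "\<zeta> k = 0" if "k \<notin> {1..<n}" for k using z'(1)[OF that] yD(4)[OF that] by (simp add: \<zeta>_def)
    show "\<exists>s. poly (\<zeta> k) s \<noteq> 0" if "k \<in> {1..<n}" for k
    proof -
      have "\<zeta> k \<noteq> 0" using yD(5)[OF that] by (simp add: \<zeta>_def)
      then show ?thesis using poly_all_0_iff_0 by blast
    qed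
    show "inj_on (\<lambda>k. poly (?p k) 0) {1..n}" by (simp add: inj_on_def two_power_eq_iff)
    show "(\<Sum>k\<in>S. branch_coeff1 (\<lambda>k. poly (\<zeta> k) s) k) = 0" for s
    proof -
      have "(\<lambda>k. poly (\<zeta> k) s) = (\<lambda>k. 1 * z' k + s * slopes n y k)" by (simp add: \<zeta>_def)
      then show ?thesis using z'(2) yD(3) by (simp only: branch_sum_linear) simp
    qed
  qed
  have slope0: "slopes n (curve_point n ?p ?q 0) = z'"
    by (rule slope_curve_point[where a = ?a]) (use z'(1) in \<open>auto simp: \<zeta>_def\<close>)
  have rat1: "(\<lambda>x. \<Sum>k\<in>S. branch_coeff1 (slopes n x) k) \<in> rational_on n (pairs n)"
    using S by (intro rational_on_branch_sum[OF Q]) (auto simp: pairs_def)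
  have rat2: "(\<lambda>x. \<Sum>k\<in>S. branch_coeff2 (fst x) (slopes n x) k) \<in> rational_on n (pairs n)"
    using S by (intro rational_on_sum[OF Q] rational_on_branch_coeff2) auto
  obtain N e where e: "e \<in> polynomial_functions n" "\<forall>x. separation (pairs n) x \<noteq> 0 \<longrightarrow>
      e x = (\<Sum>k\<in>S. branch_coeff1 (slopes n x) k) * separation (pairs n) x ^ N"
    using rat1 unfolding rational_on_def by blast
  define m where "m = Min S"
  have m: "m \<in> S" "m - 1 \<notin> S" "m - 1 \<in> {1..<n}" "m - 1 + 1 = m"
  proof -
    show "m \<in> S" using fin S by (simp add: m_def)
    then have "2 \<le> m" "m \<le> n" using S by auto
    then show "m - 1 \<in> {1..<n}" "m - 1 + 1 = m" by auto
    show "m - 1 \<notin> S" using Min_le[OF fin(1), of "m - 1"] \<open>2 \<le> m\<close> by (fastforce simp: m_def)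
  qed
  \<comment> \<open>a point of the parameter space outside of the hypersurface\<close>
  define zu where "zu = (\<lambda>k. 1 * slopes n y k + 1 * (if k = m - 1 then slopes n y (m - 1) else 0))"
  let ?qu = "\<lambda>k. [:zu k * (?a (k + 1) - ?a k):]"
  let ?u = "curve_point n ?p ?qu 0"
  have "slopes n ?u = zu"
    by (rule slope_curve_point[where a = ?a]) (use yD(4) m in \<open>auto simp: zu_def\<close>)
  then have "(\<Sum>k\<in>S. branch_coeff1 (slopes n ?u) k) = - slopes n y (m - 1)"
    unfolding zu_def using m yD(3)
    by (simp only: branch_sum_linear branch_sum_indicator[OF fin]) simp
  then have eu: "e ?u \<noteq> 0"
    using spec[OF e(2), of ?u] sep[of ?qu 0] yD(5)[OF m(3)] by (simp only:) simp
  have u: "?u \<in> param_space n"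
  proof -
    have "zu k * (?a (k + 1) - ?a k) \<noteq> 0" if "k \<in> {1..n-1}" for k
    proof -
      have "k \<in> {1..<n}" using that by auto
      then show ?thesis using yD(5) by (auto simp: zu_def)
    qed
    then show ?thesis by (simp add: curve_point_def param_space_def)
  qed
  have "(\<Sum>k\<in>S. branch_coeff2 (fst (curve_point n ?p ?q 0)) (slopes n (curve_point n ?p ?q 0)) k) \<noteq> 0"
    using z'(3) unfolding slope0 by (simp add: curve_point_def)
  from small_locus_zero_set[OF Q curve_connected_balanced_locus[OF False] rat2 e(1) _ u eu fincurve sep this]
  have "small_locus n {x \<in> balanced_locus n S. separation (pairs n) x \<noteq> 0 \<and>
      (\<Sum>k\<in>S. branch_coeff2 (fst x) (slopes n x) k) = 0}"
    using e(2) unfolding balanced_locus_def separation_pairs_nonzero_iff by auto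
  moreover have "{x \<in> balanced_locus n S. separation (pairs n) x \<noteq> 0 \<and>
      (\<Sum>k\<in>S. branch_coeff2 (fst x) (slopes n x) k) = 0}
    = {x \<in> balanced_locus n S. (\<Sum>k\<in>S. branch_coeff2 (fst x) (slopes n x) k) = 0}"
    by (auto simp: balanced_locus_def separation_pairs_nonzero_iff)
  ultimately show ?thesis by simp
qed

lemma curve_point_in_param_space:
  assumes "\<And>k. k \<in> {1..n-1} \<Longrightarrow> poly (q k) s \<noteq> 0"
  shows "curve_point n p q s \<in> param_space n"
  using assms by (simp add: curve_point_def param_space_def)

text \<open>The slopes are free on the hyperplane \<open>a\<^sub>i = a\<^sub>j\<close>, except on the edge between \<open>i\<close> and \<open>j\<close> if they are
  adjacent. So a condition can be tested on any convenient slopes.\<close>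

lemma small_locus_collision_locus:
  assumes ij: "1 \<le> i" "i < j" "j \<le> n" and Q: "Q \<subseteq> pairs n - {(i, j)}" and f: "f \<in> rational_on n Q"
    and z: "\<And>k. k \<notin> {1..<n} \<or> k = i \<and> k + 1 = j \<Longrightarrow> z k = 0"
    and w: "\<And>x. slopes n x = z \<Longrightarrow> (\<forall>k\<in>{1..n}. fst x k = of_nat (if k = j then i else k)) \<Longrightarrow> f x \<noteq> 0"
  shows "small_locus n {x \<in> collision_locus n i j. separation Q x \<noteq> 0 \<and> f x = 0}"
proof -
  let ?a = "\<lambda>k. of_nat (if k = j then i else k) :: complex"
  let ?p = "\<lambda>k. [:?a k:]" and ?q = "\<lambda>k. [:z k * (?a (k + 1) - ?a k), 1:]"
  let ?u = "curve_point n (\<lambda>k. [:of_nat k:]) (\<lambda>_. [:1:]) 0"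
  have Qn: "Q \<subseteq> {1..n} \<times> {1..n}" "finite Q"
    using Q pairs_subset[of n] finite_subset[of Q "pairs n"] by auto
  have i: "i \<in> {1..n}" "j \<in> {1..n}" using ij by auto
  have a: "fst (curve_point n ?p ?q s) k = ?a k" if "k \<in> {1..n}" for s k
    using that by (simp add: curve_point_def)
  have fincurve: "finite {s. curve_point n ?p ?q s \<notin> collision_locus n i j}"
  proof -
    have "finite {s. \<exists>k\<in>{1..n-1}. poly (?q k) s = 0}"
    proof (rule finite_some_root)
      fix k
      have "?q k \<noteq> 0" by simp
      then show "\<exists>s. poly (?q k) s \<noteq> 0" using poly_all_0_iff_0 by blast
    qed simp
    moreover have "{s. curve_point n ?p ?q s \<notin> collision_locus n i j} \<subseteq> {s. \<exists>k\<in>{1..n-1}. poly (?q k) s = 0}"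
    proof (rule subsetI, rule ccontr)
      fix s
      assume s: "s \<in> {s. curve_point n ?p ?q s \<notin> collision_locus n i j}"
        "s \<notin> {s. \<exists>k\<in>{1..n-1}. poly (?q k) s = 0}"
      have "curve_point n ?p ?q s \<in> param_space n"
        by (rule curve_point_in_param_space) (use s(2) in blast)
      moreover have "fst (curve_point n ?p ?q s) i = fst (curve_point n ?p ?q s) j"
        using a[OF i(1)] a[OF i(2)] ij by simp
      ultimately show False using s(1) by (simp add: collision_locus_def)
    qed
    ultimately show ?thesis using finite_subset by blast
  qed
  have "slopes n (curve_point n ?p ?q 0) = z"
  proof (rule slope_curve_point[where a = ?a])
    fix k assume "k \<notin> {1..<n} \<or> ?a (k + 1) = ?a k"
    then have "k \<notin> {1..<n} \<or> k = i \<and> k + 1 = j"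
      using ij by (auto simp only: of_nat_eq_iff split: if_splits)
    then show "z k = 0" by (rule z)
  qed simp_all
  then have fw: "f (curve_point n ?p ?q 0) \<noteq> 0" using a by (intro w) auto
  have sep: "separation Q (curve_point n ?p ?q 0) \<noteq> 0"
    unfolding separation_nonzero_iff[OF Qn(2)]
  proof clarify
    fix k l assume kl: "(k, l) \<in> Q" and eq: "fst (curve_point n ?p ?q 0) k = fst (curve_point n ?p ?q 0) l"
    have *: "1 \<le> k" "k < l" "l \<le> n" "(k, l) \<noteq> (i, j)" using kl Q by (auto simp: pairs_def)
    have "(if k = j then i else k) = (if l = j then i else l)"
      using eq a[of k] a[of l] * by (simp only: of_nat_eq_iff atLeastAtMost_iff) simp
    then show False using * ij by (auto split: if_splits)
  qed
  have e: "(\<lambda>x. fst x i - fst x j) \<in> polynomial_functions n"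
    by (intro polynomial_functions_diff polynomial_functions.coord_a i)
  have u: "?u \<in> param_space n" by (simp add: curve_point_def param_space_def)
  have eu: "fst ?u i - fst ?u j \<noteq> 0" using i ij by (simp add: curve_point_def)
  show ?thesis
    by (rule small_locus_zero_set[OF Qn(1) curve_connected_collision_locus[OF i] f e _ u eu fincurve sep fw])
      (simp add: collision_locus_def)
qed

lemma exists_boundary_edge:
  fixes n :: nat
  assumes "S \<subseteq> {1..n}" "S \<noteq> {}" "S \<noteq> {1..n}"
  shows "\<exists>l\<in>{1..<n}. (l \<in> S) \<noteq> (l + 1 \<in> S)"
proof (rule ccontr)
  assume neg: "\<not> ?thesis"
  have const: "1 \<le> j \<Longrightarrow> j \<le> n \<Longrightarrow> (j \<in> S) = (1 \<in> S)" for j :: nat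
  proof (induction j rule: dec_induct)
    case (step j)
    then have "j \<in> {1..<n}" by auto
    then have "(j \<in> S) = (j + 1 \<in> S)" using neg by blast
    then show ?case using step by simp
  qed simp
  have "S = {} \<or> S = {1..n}"
  proof (cases "1 \<in> S")
    case True
    then have "{1..n} \<subseteq> S" using const by auto
    then show ?thesis using assms(1) by blast
  next
    case False
    then have "x \<notin> S" for x using const[of x] assms(1) by auto
    then show ?thesis by blast
  qed
  then show False using assms by blast
qed

text \<open>The conditions of \<open>split_double_branch\<close>, for adjacent and for other pairs of nodes.\<close>

definition split_obstruction :: "nat \<Rightarrow> nat \<Rightarrow> nat \<Rightarrow> nat set \<Rightarrow> point \<Rightarrow> complex" where
  "split_obstruction n i j S x =
    (let z = slopes n x; s = \<Sum>k\<in>S-{i}. branch_coeff1 z k in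
      if j = i + 1 then 2 * s - z (i - 1) + z (i + 1)
      else (s + branch_coeff1 z i) * (s + branch_coeff1 z j)
        + (if j = i + 2 then z i * z (i + 1) else 0))"

lemma small_locus_further_collision:
  assumes ij: "1 \<le> i" "i < j" "j \<le> n"
  shows "small_locus n {x \<in> collision_locus n i j. separation (pairs n - {(i, j)}) x = 0}"
proof -
  let ?Q = "pairs n - {(i, j)}"
  have sub: "?Q \<subseteq> {1..n} \<times> {1..n}" using pairs_subset(1)[of n] by blast
  have "small_locus n {x \<in> collision_locus n i j. separation {} x \<noteq> 0 \<and> separation ?Q x = 0}"
  proof (rule small_locus_collision_locus[OF ij, where z = "\<lambda>_. 0"])
    show "separation ?Q \<in> rational_on n {}"
      by (intro rational_on_polynomial separation_polynomial sub)
    fix x :: point assume x: "\<forall>k\<in>{1..n}. fst x k = of_nat (if k = j then i else k)"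
    show "separation ?Q x \<noteq> 0"
      unfolding separation_nonzero_iff[OF finite_Diff[OF pairs_subset(2)]]
    proof (rule ballI, rule case_prodI2, rule notI)
      fix kl k l assume "kl \<in> pairs n - {(i, j)}" "kl = (k, l)" and eq: "fst x k = fst x l"
      then have kl: "(k, l) \<in> pairs n" "(k, l) \<noteq> (i, j)" by auto
      have *: "1 \<le> k" "k < l" "l \<le> n" using kl by (auto simp: pairs_def)
      then have "k \<in> {1..n}" "l \<in> {1..n}" by auto
      then have "(if k = j then i else k) = (if l = j then i else l)"
        using eq bspec[OF x, of k] bspec[OF x, of l] by (simp only: of_nat_eq_iff)
      then show False using * kl(2) ij by (auto split: if_splits)
    qed
  qed auto
  then show ?thesis by (simp add: separation_def)
qed

text \<open>Slope one on a single boundary edge of \<open>S\<close>, and zero elsewhere, violates the condition.\<close>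

lemma small_locus_common_factor:
  assumes ij: "1 \<le> i" "i < j" "j \<le> n" and S: "S \<subseteq> {1..n} - {i, j}" "S \<noteq> {}"
  shows "small_locus n {x \<in> collision_locus n i j. separation (pairs n - {(i, j)}) x \<noteq> 0 \<and>
    (\<Sum>k\<in>S. branch_coeff1 (slopes n x) k) = 0}"
proof -
  have Sn: "S \<subseteq> {1..n}" "S \<noteq> {1..n}" "finite S" "0 \<notin> S" using S ij finite_subset by auto
  obtain l where l: "l \<in> {1..<n}" "(l \<in> S) \<noteq> (l + 1 \<in> S)"
    using exists_boundary_edge[OF Sn(1) S(2) Sn(2)] by blast
  have lij: "\<not> (l = i \<and> l + 1 = j)"
  proof
    assume "l = i \<and> l + 1 = j"
    then have "l \<notin> S" "l + 1 \<notin> S" using S(1) by auto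
    then show False using l(2) by simp
  qed
  show ?thesis
  proof (rule small_locus_collision_locus[OF ij, where z = "\<lambda>k. if k = l then 1 else 0"])
    show "(\<lambda>x. \<Sum>k\<in>S. branch_coeff1 (slopes n x) k) \<in> rational_on n (pairs n - {(i, j)})"
    proof (rule rational_on_branch_sum)
      show "pairs n - {(i, j)} \<subseteq> {1..n} \<times> {1..n}" using pairs_subset(1)[of n] by blast
      fix k assume k: "k \<in> S"
      then have kij: "k \<noteq> i" "k \<noteq> j" "k \<le> n" using S(1) by auto
      show "(k, k + 1) \<in> pairs n - {(i, j)}" if "k \<in> {1..<n}" using that kij by (simp add: pairs_def)
      show "(k - 1, k) \<in> pairs n - {(i, j)}" if "k - 1 \<in> {1..<n}" using that kij by (auto simp: pairs_def)
    qed
    show "(if k = l then 1 else 0) = (0::complex)" if "k \<notin> {1..<n} \<or> k = i \<and> k + 1 = j" for k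
      using that l(1) lij by auto
    show "(\<Sum>k\<in>S. branch_coeff1 (slopes n x) k) \<noteq> 0"
      if "slopes n x = (\<lambda>k. if k = l then 1 else 0)" for x
      unfolding that branch_sum_indicator[OF Sn(3,4)] using l(2) by auto
  qed simp
qed

text \<open>The sums over \<open>S\<close> and over \<open>S\<close> with \<open>i\<close> exchanged for \<open>j\<close> are nonzero linear forms in the slopes, and
  their product is nonzero at one of two suitable slopes or at the sum of these. For \<open>j = i + 2\<close> a product of two slopes is added. Then
  slopes one on three consecutive edges including \<open>i\<close> and \<open>i + 1\<close> make the first product zero and
  the second one \<open>1\<close>; three such edges exist as \<open>n \<ge> 4\<close>.\<close>

lemma small_locus_nonadjacent_split:
  assumes n: "n \<ge> 4" and ij: "1 \<le> i" "i + 1 < j" "j \<le> n" and S: "S \<subseteq> {1..n}" "i \<in> S" "j \<notin> S"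
  shows "small_locus n {x \<in> collision_locus n i j. separation (pairs n - {(i, j)}) x \<noteq> 0 \<and>
    split_obstruction n i j S x = 0}"
proof -
  let ?Q = "pairs n - {(i, j)}"
  have ij': "i < j" using ij by simp
  have Q: "?Q \<subseteq> {1..n} \<times> {1..n}" using pairs_subset(1)[of n] by blast
  have rz: "(\<lambda>x. slopes n x k) \<in> rational_on n ?Q" for k
    by (rule rational_on_slope[OF Q]) (use ij in \<open>auto simp: pairs_def\<close>)
  have rb: "(\<lambda>x. branch_coeff1 (slopes n x) k) \<in> rational_on n ?Q" for k
    unfolding branch_coeff1_def by (intro rational_on_diff[OF Q] rz)
  define S' where "S' = insert j (S - {i})"
  define F where "F = (\<lambda>z. \<Sum>k\<in>S. branch_coeff1 z k)"
  define G where "G = (\<lambda>z. \<Sum>k\<in>S'. branch_coeff1 z k)"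
  have fin: "finite S" "0 \<notin> S" "finite S'" "0 \<notin> S'" using S ij finite_subset[of S "{1..n}"] by (auto simp: S'_def)
  have F: "F z = (\<Sum>k\<in>S-{i}. branch_coeff1 z k) + branch_coeff1 z i" for z
    unfolding F_def using sum.remove[OF fin(1) S(2), of "branch_coeff1 z"] by simp
  have G: "G z = (\<Sum>k\<in>S-{i}. branch_coeff1 z k) + branch_coeff1 z j" for z
    unfolding G_def S'_def using fin(1) S(3) by simp
  have obstruction: "split_obstruction n i j S x
      = F (slopes n x) * G (slopes n x) + (if j = i + 2 then slopes n x i * slopes n x (i + 1) else 0)" for x
    unfolding split_obstruction_def Let_def F G using ij by simp
  have "\<exists>z. (\<forall>k. k \<notin> {1..<n} \<longrightarrow> z k = 0) \<and> F z * G z + (if j = i + 2 then z i * z (i + 1) else 0) \<noteq> 0"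
  proof (cases "j = i + 2")
    case True
    define l where "l = (if i = 1 then i else i - 1)"
    define z :: "nat \<Rightarrow> complex" where "z = (\<lambda>k. of_bool (l \<le> k \<and> k < l + 3))"
    have l: "1 \<le> l" "l + 3 \<le> n" "l = i \<or> l + 1 = i" using n ij True by (auto simp: l_def)
    have FG: "F z = of_bool (l \<in> S) - of_bool (l + 3 \<in> S)" "G z = of_bool (l \<in> S') - of_bool (l + 3 \<in> S')"
      unfolding F_def G_def z_def using branch_sum_interval fin by simp_all
    \<comment> \<open>\<open>S\<close> and \<open>S'\<close> differ at exactly one end of this run of edges, so exactly one of the sums vanishes\<close>
    have "F z * G z = 0"
    proof (cases "l = i")
      case True
      then have "l + 3 \<noteq> i" "l + 3 \<noteq> j" "l \<noteq> j" using \<open>j = i + 2\<close> by auto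
      then show ?thesis using True S unfolding FG S'_def by auto
    next
      case False
      then have "l + 3 = j" "l \<noteq> j" using l(3) \<open>j = i + 2\<close> by auto
      then show ?thesis using False S unfolding FG S'_def by auto
    qed
    moreover have "z i = 1" "z (i + 1) = 1" using l(3) by (auto simp: z_def)
    moreover have "z k = 0" if "k \<notin> {1..<n}" for k using that l by (auto simp: z_def)
    ultimately show ?thesis using True by (intro exI[of _ z]) auto
  next
    case False
    have FG: "F (\<lambda>k. 1 * z k + 1 * z' k) = F z + F z'" "G (\<lambda>k. 1 * z k + 1 * z' k) = G z + G z'" for z z'
      unfolding F_def G_def branch_sum_linear by simp_all
    define \<delta> :: "nat \<Rightarrow> nat \<Rightarrow> complex" where "\<delta> = (\<lambda>l k. if k = l then 1 else 0)"
    have "S \<noteq> {}" "S \<noteq> {1..n}" "S' \<subseteq> {1..n}" "S' \<noteq> {}" "S' \<noteq> {1..n}"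
      using S ij by (auto simp: S'_def)
    then obtain l l' where l: "l \<in> {1..<n}" "(l \<in> S) \<noteq> (l + 1 \<in> S)"
      and l': "l' \<in> {1..<n}" "(l' \<in> S') \<noteq> (l' + 1 \<in> S')"
      using exists_boundary_edge[of S n] exists_boundary_edge[of S' n] S(1) by blast
    have nz: "F (\<delta> l) \<noteq> 0" "G (\<delta> l') \<noteq> 0"
      unfolding F_def G_def \<delta>_def branch_sum_indicator[OF fin(1,2)] branch_sum_indicator[OF fin(3,4)]
      using l(2) l'(2) by auto
    have zero: "\<delta> l k = 0" "\<delta> l' k = 0" if "k \<notin> {1..<n}" for k using that l(1) l'(1) by (auto simp: \<delta>_def)
    consider "G (\<delta> l) \<noteq> 0" | "F (\<delta> l') \<noteq> 0" | "G (\<delta> l) = 0" "F (\<delta> l') = 0" by blast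
    then show ?thesis
    proof cases
      case 1
      then show ?thesis using nz zero False by (intro exI[of _ "\<delta> l"]) simp
    next
      case 2
      then show ?thesis using nz zero False by (intro exI[of _ "\<delta> l'"]) simp
    next
      case 3
      then show ?thesis using nz zero False FG[of "\<delta> l" "\<delta> l'"]
        by (intro exI[of _ "\<lambda>k. 1 * \<delta> l k + 1 * \<delta> l' k"]) simp
    qed
  qed
  then obtain z where z: "\<And>k. k \<notin> {1..<n} \<Longrightarrow> z k = 0"
    "F z * G z + (if j = i + 2 then z i * z (i + 1) else 0) \<noteq> 0" by blast
  show ?thesis
  proof (rule small_locus_collision_locus[OF ij(1) ij' ij(3) order_refl, where z = z])
    have "(\<lambda>x. if j = i + 2 then slopes n x i * slopes n x (i + 1) else 0) \<in> rational_on n ?Q"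
      using rational_on_mult[OF rz[of i] rz[of "i + 1"]] rational_on_const[of 0 n ?Q]
      by (cases "j = i + 2") (simp_all only: simp_thms if_True if_False)
    then show "split_obstruction n i j S \<in> rational_on n ?Q"
      unfolding obstruction[abs_def] F_def G_def
      by (intro rational_on_add[OF Q] rational_on_mult rational_on_sum[OF Q] rb)
    show "z k = 0" if "k \<notin> {1..<n} \<or> k = i \<and> k + 1 = j" for k using that z(1) ij(2) by auto
    show "split_obstruction n i j S x \<noteq> 0" if "slopes n x = z" for x
      unfolding obstruction that using z(2) .
  qed
qed

text \<open>Slope one on an edge next to the pair makes \<open>2 * s\<close> an even integer and the rest \<open>\<plusminus> 1\<close>.\<close>

lemma small_locus_adjacent_split:
  assumes n: "n \<ge> 4" and ij: "1 \<le> i" "j = i + 1" "j \<le> n" and S: "S \<subseteq> {1..n}" "i \<in> S" "j \<notin> S"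
  shows "small_locus n {x \<in> collision_locus n i j. separation (pairs n - {(i, j)}) x \<noteq> 0 \<and>
    split_obstruction n i j S x = 0}"
proof -
  let ?Q = "pairs n - {(i, j)}"
  have ij': "i < j" using ij by simp
  have Q: "?Q \<subseteq> {1..n} \<times> {1..n}" using pairs_subset(1)[of n] by blast
  have fin: "finite (S - {i})" "0 \<notin> S - {i}" using S finite_subset[of S "{1..n}"] by auto
  define l where "l = (if i = 1 then i + 1 else i - 1)"
  have l: "l \<in> {1..<n}" "l \<noteq> i" using n ij by (auto simp: l_def)
  show ?thesis
  proof (rule small_locus_collision_locus[OF ij(1) ij' ij(3) order_refl, where z = "\<lambda>k. if k = l then 1 else 0"])
    have s: "(\<lambda>x. \<Sum>k\<in>S-{i}. branch_coeff1 (slopes n x) k) \<in> rational_on n ?Q"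
    proof (rule rational_on_branch_sum[OF Q])
      fix k assume k: "k \<in> S - {i}"
      then have kij: "k \<noteq> i" "k \<noteq> j" "k \<le> n" using S by auto
      show "(k, k + 1) \<in> ?Q" if "k \<in> {1..<n}" using that kij by (simp add: pairs_def)
      show "(k - 1, k) \<in> ?Q" if "k - 1 \<in> {1..<n}" using that kij by (auto simp: pairs_def)
    qed
    have "(\<lambda>x. 2 * (\<Sum>k\<in>S-{i}. branch_coeff1 (slopes n x) k) - slopes n x (i - 1) + slopes n x (i + 1))
        \<in> rational_on n ?Q"
      by (intro rational_on_add[OF Q] rational_on_diff[OF Q] rational_on_mult rational_on_const s
          rational_on_slope[OF Q]) (use ij in \<open>auto simp: pairs_def\<close>)
    then show "split_obstruction n i j S \<in> rational_on n ?Q"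
      using ij(2) by (simp add: split_obstruction_def[abs_def] Let_def)
    show "(if k = l then 1 else 0) = (0::complex)" if "k \<notin> {1..<n} \<or> k = i \<and> k + 1 = j" for k
      using that l by auto
    show "split_obstruction n i j S x \<noteq> 0" if x: "slopes n x = (\<lambda>k. if k = l then 1 else 0)" for x
    proof (cases "i = 1")
      case True
      then show ?thesis
        using ij S unfolding split_obstruction_def Let_def x branch_sum_indicator[OF fin]
        by (auto simp: l_def)
    next
      case False
      then have "i - 1 + 1 = i" "i - 1 \<noteq> i + 1" using ij by auto
      then show ?thesis
        using False ij S unfolding split_obstruction_def Let_def x branch_sum_indicator[OF fin]
        by (auto simp: l_def)
    qed
  qed
qed

text \<open>The four covering families correspond to distinct diagonal entries, to at least two coincidences, and to
  a single coincidence \<open>a\<^sub>i = a\<^sub>j\<close> with both nodes in one factor or one node in each.\<close>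

lemma small_locus_original_reducible_locus:
  assumes n: "n \<ge> 4"
  shows "small_locus n (original_reducible_locus n)"
proof -
  let ?sep = "\<lambda>i j. separation (pairs n - {(i, j)})"
  define balanced where "balanced = (\<Union>S\<in>{S. S \<subseteq> {2..n} \<and> S \<noteq> {}}.
    {x \<in> balanced_locus n S. (\<Sum>k\<in>S. branch_coeff2 (fst x) (slopes n x) k) = 0})"
  define further where "further = (\<Union>(i, j)\<in>pairs n. {x \<in> collision_locus n i j. ?sep i j x = 0})"
  define common where "common = (\<Union>(i, j)\<in>pairs n. \<Union>S\<in>{S. S \<subseteq> {1..n} - {i, j} \<and> S \<noteq> {}}.
    {x \<in> collision_locus n i j. ?sep i j x \<noteq> 0 \<and> (\<Sum>k\<in>S. branch_coeff1 (slopes n x) k) = 0})"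
  define split where "split = (\<Union>(i, j)\<in>pairs n. \<Union>S\<in>{S. S \<subseteq> {1..n} \<and> i \<in> S \<and> j \<notin> S}.
    {x \<in> collision_locus n i j. ?sep i j x \<noteq> 0 \<and> split_obstruction n i j S x = 0})"
  have finite_subsets: "finite {S. S \<subseteq> A \<and> P S}" if "finite A" for A :: "nat set" and P
    by (rule finite_subset[of _ "Pow A"]) (use that in auto)
  have "small_locus n balanced"
    unfolding balanced_def
    by (intro small_locus_UN finite_subsets) (auto intro: small_locus_balanced_locus[OF n])
  moreover have "small_locus n further"
    unfolding further_def case_prod_unfold
  proof (intro small_locus_UN pairs_subset(2))
    fix ij assume "ij \<in> pairs n"
    then have "1 \<le> fst ij" "fst ij < snd ij" "snd ij \<le> n" by (auto simp: pairs_def)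
    then show "small_locus n {x \<in> collision_locus n (fst ij) (snd ij). ?sep (fst ij) (snd ij) x = 0}"
      by (rule small_locus_further_collision)
  qed
  moreover have "small_locus n common"
    unfolding common_def case_prod_unfold
  proof (intro small_locus_UN pairs_subset(2) finite_subsets)
    fix ij S assume "ij \<in> pairs n" and S: "S \<in> {S. S \<subseteq> {1..n} - {fst ij, snd ij} \<and> S \<noteq> {}}"
    then have "1 \<le> fst ij" "fst ij < snd ij" "snd ij \<le> n" by (auto simp: pairs_def)
    then show "small_locus n {x \<in> collision_locus n (fst ij) (snd ij). ?sep (fst ij) (snd ij) x \<noteq> 0 \<and>
        (\<Sum>k\<in>S. branch_coeff1 (slopes n x) k) = 0}"
      using S by (intro small_locus_common_factor) auto
  qed simp
  moreover have "small_locus n split"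
    unfolding split_def case_prod_unfold
  proof (intro small_locus_UN pairs_subset(2) finite_subsets)
    fix ij S assume "ij \<in> pairs n" and S: "S \<in> {S. S \<subseteq> {1..n} \<and> fst ij \<in> S \<and> snd ij \<notin> S}"
    then have ij: "1 \<le> fst ij" "fst ij < snd ij" "snd ij \<le> n" by (auto simp: pairs_def)
    show "small_locus n {x \<in> collision_locus n (fst ij) (snd ij). ?sep (fst ij) (snd ij) x \<noteq> 0 \<and>
        split_obstruction n (fst ij) (snd ij) S x = 0}"
    proof (cases "snd ij = fst ij + 1")
      case True
      then show ?thesis using small_locus_adjacent_split[OF n ij(1) True ij(3)] S by blast
    next
      case False
      then have "fst ij + 1 < snd ij" using ij by simp
      then show ?thesis using small_locus_nonadjacent_split[OF n ij(1) _ ij(3)] S by blast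
    qed
  qed simp
  ultimately have small: "small_locus n (balanced \<union> further \<union> common \<union> split)"
    by (intro small_locus_Un)
  have "original_reducible_locus n \<subseteq> balanced \<union> further \<union> common \<union> split"
  proof
    fix x assume "x \<in> original_reducible_locus n"
    then obtain a c where x: "x = (a, c)" and xU: "x \<in> param_space n"
      and red: "\<not> irreducible (spectral_poly a c n)"
      by (auto simp: original_reducible_locus_def)
    obtain S A B where fac: "spectral_factorization a c n S A B"
      using exists_spectral_factorization[OF red] n by auto
    note fac' = spectral_factorization_swap[OF fac]
    have S: "S \<subseteq> {1..n}" "S \<noteq> {}" "S \<noteq> {1..n}" using fac by (auto simp: spectral_factorization_def)
    show "x \<in> balanced \<union> further \<union> common \<union> split"
    proof (cases "inj_on a {1..n}")
      case True
      \<comment> \<open>both factors satisfy the conditions, so one may take the factor without node \<open>1\<close>\<close>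
      have key: "x \<in> balanced" if fac: "spectral_factorization a c n T A' B'" and "1 \<notin> T" for T A' B'
      proof -
        have T: "T \<subseteq> {1..n}" "T \<noteq> {}" using fac by (auto simp: spectral_factorization_def)
        have "T \<subseteq> {2..n}"
        proof
          fix k assume "k \<in> T"
          then have "k \<in> {1..n}" "k \<noteq> 1" using T \<open>1 \<notin> T\<close> by auto
          then show "k \<in> {2..n}" by auto
        qed
        moreover have ne: "a l \<noteq> a k" if "k \<in> T" "l \<in> {1..n} - {k}" for k l
          using inj_onD[OF True, of l k] that T by auto
        ultimately show ?thesis
          unfolding balanced_def balanced_locus_def
          using branch_sums_vanish[OF fac ne refl] True xU T unfolding x by auto
      qed
      show ?thesis
      proof (cases "1 \<in> S")
        case True
        then show ?thesis using key[OF fac'] by blast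
      next
        case False
        then show ?thesis using key[OF fac] by blast
      qed
    next
      case False
      have "\<exists>i j. i < j \<and> i \<in> {1..n} \<and> j \<in> {1..n} \<and> a i = a j"
      proof (rule ccontr)
        assume "\<not> ?thesis"
        then have "inj_on a {1..n}" by (intro linorder_inj_onI) auto
        then show False using False by simp
      qed
      then obtain i j where ij: "i < j" "i \<in> {1..n}" "j \<in> {1..n}" "a i = a j" by blast
      have pair: "(i, j) \<in> pairs n" using ij by (auto simp: pairs_def)
      have coll: "x \<in> collision_locus n i j" using xU ij(4) by (simp add: collision_locus_def x)
      show ?thesis
      proof (cases "?sep i j x = 0")
        case True
        then have "x \<in> further" unfolding further_def using pair coll by blast
        then show ?thesis by blast
      next
        case sep: False
        have ne: "a k \<noteq> a l" if "k < l" "k \<in> {1..n}" "l \<in> {1..n}" "(k, l) \<noteq> (i, j)" for k l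
        proof -
          have "(k, l) \<in> pairs n - {(i, j)}" using that by (auto simp: pairs_def)
          moreover have "\<forall>(k, l)\<in>pairs n - {(i, j)}. fst x k \<noteq> fst x l"
            by (rule iffD1[OF separation_nonzero_iff[OF finite_Diff[OF pairs_subset(2)]] sep])
          ultimately have "case (k, l) of (k, l) \<Rightarrow> fst x k \<noteq> fst x l" by (rule bspec[rotated])
          then show ?thesis by (simp add: x)
        qed
        have simple: "a l \<noteq> a k" if "k \<in> {1..n} - {i, j}" "l \<in> {1..n} - {k}" for k l
        proof (cases "k < l")
          case True
          then show ?thesis using ne[of k l] that by auto
        next
          case False
          then have "l < k" using that by auto
          then show ?thesis using ne[of l k] that by auto
        qed
        have inj: "inj_on a ({1..n} - {j})"
          using ne by (intro linorder_inj_onI) auto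
        have common: "x \<in> common" if fac: "spectral_factorization a c n T A' B'"
          and T: "i \<notin> T" "j \<notin> T" for T A' B'
        proof -
          have T': "T \<subseteq> {1..n} - {i, j}" "T \<noteq> {}" using fac T by (auto simp: spectral_factorization_def)
          have "(\<Sum>k\<in>T. branch_coeff1 (slopes n x) k) = 0"
            unfolding x fst_conv snd_conv
            by (rule branch_sums_vanish(1)[OF fac _ refl]) (use simple T' in blast)
          then show ?thesis unfolding common_def using pair coll sep T' by blast
        qed
        have split: "x \<in> split" if fac: "spectral_factorization a c n T A' B'"
          and T: "i \<in> T" "j \<notin> T" for T A' B'
        proof -
          have T': "T \<subseteq> {1..n}" using fac by (auto simp: spectral_factorization_def)
          have jT: "j \<in> {1..n} - T" using ij T by blast
          have ci: "c i \<noteq> 0" using xU ij by (auto simp: param_space_def PiE_def Pi_def x)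
          have "split_obstruction n i j T x = 0"
          proof (cases "j = i + 1")
            case True
            then show ?thesis
              using split_double_branch(2)[OF fac ij(1) T(1) jT ij(4)[symmetric] inj refl True ci]
              by (simp add: split_obstruction_def Let_def x)
          next
            case False
            then have "i + 1 < j" using ij(1) by simp
            then show ?thesis
              using split_double_branch(1)[OF fac ij(1) T(1) jT ij(4)[symmetric] inj refl] False
              by (simp add: split_obstruction_def Let_def x)
          qed
          then show ?thesis unfolding split_def using pair coll sep T T' by blast
        qed
        consider "i \<in> S" "j \<in> S" | "i \<notin> S" "j \<notin> S" | "i \<in> S" "j \<notin> S" | "i \<notin> S" "j \<in> S" by blast
        then show ?thesis
        proof cases
          case 1
          then show ?thesis using common[OF fac'] by blast
        next
          case 2
          then show ?thesis using common[OF fac] by blast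
        next
          case 3
          then show ?thesis using split[OF fac] by blast
        next
          case 4
          then show ?thesis using split[OF fac'] ij by blast
        qed
      qed
    qed
  qed
  then show ?thesis by (rule small_locus_subset[OF small])
qed

theorem theorem7p1:
  fixes n :: nat
  assumes "n \<ge> 4"
  shows "codimension (zariski_param n) (reduced_reducible_locus n) \<ge> 2
    \<and> codimension (zariski_param n) (original_reducible_locus n) \<ge> 2"
proof
  have small: "small_locus n (original_reducible_locus n)"
    by (rule small_locus_original_reducible_locus[OF assms])
  then show "codimension (zariski_param n) (original_reducible_locus n) \<ge> 2"
    by (rule codimension_ge_2_if_small_locus)
  have "reduced_reducible_locus n \<subseteq> original_reducible_locus n"
    using spectral_poly_reducible_if_reduced_continuant_reducible assms
    by (auto simp: reduced_reducible_locus_def original_reducible_locus_def)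
  then show "codimension (zariski_param n) (reduced_reducible_locus n) \<ge> 2"
    by (intro codimension_ge_2_if_small_locus small_locus_subset[OF small])
qed

end
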